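(* Let $G$ be a $2$-edge-connected hyperelliptic graph. Then $G$ has no Weierstrass points if and only if $G$ is isomorphic to one of the following: (1) $B_n$ for some integer $n\ge3$; (2) $B(l_1,l_2,l_3)$ for some odd integers $l_1,l_2,l_3\ge1$; (3) $\Phi(l)$ for some integer $l\ge1$.
   Context: A graph is a finite, connected multigraph without loop edges, with genus $g=|E(G)|-|V(G)|+1$. It is $2$-edge-connected if deleting any single edge leaves it connected. Divisors are elements of the free abelian group on $V(G)$. For $f:V(G)\to\mathbb{Z}$, $\mathrm{div}(f)=\sum_x\sum_{e=xy}(f(x)-f(y))(x)$, and $D\sim D'$ means $D-D'=\mathrm{div}(f)$ for some $f$. Let $|D|=\{E\ge0:E\sim D\}$. Set $r(D)=-1$ if $|D|=\emptyset$; otherwise $r(D)$ is the largest $k$ such that $|D-E|\ne\emptyset$ for every effective $E$ of degree $k$. $G$ is hyperelliptic if some divisor $D$ has $\deg D=2$ and $r(D)=1$. A vertex $x$ is a Weierstrass point if $r(g\cdot(x))\ge1$, where $g$ is the genus of $G$. $B(l_1,\dots,l_n)$ ($n\ge3$) is the graph with two vertices $x,y$ joined by $n$ internally disjoint paths of lengths $l_1,\dots,l_n$. $B_n=B(1,\dots,1)$ is two vertices joined by $n$ parallel edges. $\Phi(l)$ consists of two disjoint paths $x_0x_1\cdots x_l$ and $y_0y_1\cdots y_l$ of length $l$, together with two parallel edges joining $x_0$ to $y_0$ and two parallel edges joining $x_l$ to $y_l$.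
   Formalization: The genus of G is assumed to be at least 2; as literally stated the claim fails for cycles (genus 1), which are 2-edge-connected, satisfy the given definition of hyperelliptic, have no Weierstrass points, and are not in the list. *)

theory Defs
  imports "HOL-Algebra.Free_Abelian_Groups"
begin

section \<open>Multigraphs\<close>

text \<open>Edges are individually named, so that parallel edges are distinct elements of
  \<open>edges G\<close> with the same set of end points.\<close>

record ('v, 'e) multigraph =
  verts :: "'v set"
  edges :: "'e set"
  ends  :: "'e \<Rightarrow> 'v set"

definition adjacency :: "('v, 'e) multigraph \<Rightarrow> ('v \<times> 'v) set" where
  "adjacency G = {(x, y). \<exists>e\<in>edges G. ends G e = {x, y}}"

definition connected_graph :: "('v, 'e) multigraph \<Rightarrow> bool" where
  "connected_graph G \<longleftrightarrow>
     verts G \<noteq> {} \<and> (\<forall>x\<in>verts G. \<forall>y\<in>verts G. (x, y) \<in> (adjacency G)\<^sup>*)"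

text \<open>The condition that an edge has exactly two end points excludes loops.\<close>

definition is_graph :: "('v, 'e) multigraph \<Rightarrow> bool" where
  "is_graph G \<longleftrightarrow>
     finite (verts G) \<and> finite (edges G) \<and>
     (\<forall>e\<in>edges G. ends G e \<subseteq> verts G \<and> card (ends G e) = 2) \<and>
     connected_graph G"

definition delete_edge :: "('v, 'e) multigraph \<Rightarrow> 'e \<Rightarrow> ('v, 'e) multigraph" where
  "delete_edge G e = G\<lparr>edges := edges G - {e}\<rparr>"

definition two_edge_connected :: "('v, 'e) multigraph \<Rightarrow> bool" where
  "two_edge_connected G \<longleftrightarrow> (\<forall>e\<in>edges G. connected_graph (delete_edge G e))"

definition genus :: "('v, 'e) multigraph \<Rightarrow> int" where
  "genus G = int (card (edges G)) - int (card (verts G)) + 1"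

definition isomorphic :: "('v, 'e) multigraph \<Rightarrow> ('w, 'f) multigraph \<Rightarrow> bool" where
  "isomorphic G H \<longleftrightarrow>
     (\<exists>\<phi> \<psi>. bij_betw \<phi> (verts G) (verts H) \<and> bij_betw \<psi> (edges G) (edges H) \<and>
        (\<forall>e\<in>edges G. ends H (\<psi> e) = \<phi> ` ends G e))"


section \<open>Divisors\<close>

definition divisors :: "('v, 'e) multigraph \<Rightarrow> ('v \<Rightarrow>\<^sub>0 int) set" where
  "divisors G = carrier (free_Abelian_group (verts G))"

definition deg :: "('v \<Rightarrow>\<^sub>0 int) \<Rightarrow> int" where
  "deg D = (\<Sum>x\<in>Poly_Mapping.keys D. Poly_Mapping.lookup D x)"

text \<open>Stated pointwise rather than as \<open>0 \<le> D\<close>: the library's order on \<open>\<Rightarrow>\<^sub>0\<close> is lexicographic.\<close>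

definition effective :: "('v \<Rightarrow>\<^sub>0 int) \<Rightarrow> bool" where
  "effective D \<longleftrightarrow> (\<forall>x. 0 \<le> Poly_Mapping.lookup D x)"

definition other_end :: "('v, 'e) multigraph \<Rightarrow> 'e \<Rightarrow> 'v \<Rightarrow> 'v" where
  "other_end G e x = (THE y. ends G e = {x, y})"

definition principal :: "('v, 'e) multigraph \<Rightarrow> ('v \<Rightarrow> int) \<Rightarrow> ('v \<Rightarrow>\<^sub>0 int)" where
  "principal G f =
     (\<Sum>x\<in>verts G. \<Sum>e\<in>{e\<in>edges G. x \<in> ends G e}.
        frag_cmul (f x - f (other_end G e x)) (frag_of x))"

definition lin_equiv :: "('v, 'e) multigraph \<Rightarrow> ('v \<Rightarrow>\<^sub>0 int) \<Rightarrow> ('v \<Rightarrow>\<^sub>0 int) \<Rightarrow> bool" where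
  "lin_equiv G D D' \<longleftrightarrow> (\<exists>f. D - D' = principal G f)"

definition linear_system :: "('v, 'e) multigraph \<Rightarrow> ('v \<Rightarrow>\<^sub>0 int) \<Rightarrow> ('v \<Rightarrow>\<^sub>0 int) set" where
  "linear_system G D = {E \<in> divisors G. effective E \<and> lin_equiv G E D}"

text \<open>The greatest \<open>k\<close> exists: \<open>k = 0\<close> qualifies when the linear system of \<open>D\<close> is nonempty,
  and no \<open>k > deg D\<close> does, since linearly equivalent divisors have the same degree.\<close>

definition rank :: "('v, 'e) multigraph \<Rightarrow> ('v \<Rightarrow>\<^sub>0 int) \<Rightarrow> int" where
  "rank G D =
     (if linear_system G D = {} then - 1
      else int (GREATEST k. \<forall>E\<in>divisors G. effective E \<and> deg E = int k
                              \<longrightarrow> linear_system G (D - E) \<noteq> {}))"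

definition hyperelliptic :: "('v, 'e) multigraph \<Rightarrow> bool" where
  "hyperelliptic G \<longleftrightarrow> (\<exists>D\<in>divisors G. deg D = 2 \<and> rank G D = 1)"

definition weierstrass_point :: "('v, 'e) multigraph \<Rightarrow> 'v \<Rightarrow> bool" where
  "weierstrass_point G x \<longleftrightarrow>
     x \<in> verts G \<and> 1 \<le> rank G (frag_cmul (genus G) (frag_of x))"


section \<open>The graphs in the classification\<close>

datatype banana_vertex = Pole_x | Pole_y | Inner nat nat

text \<open>\<open>banana_vertex_at ls i j\<close> is the vertex at distance \<open>j\<close> from \<open>x\<close> along the \<open>i\<close>-th path.\<close>

definition banana_vertex_at :: "nat list \<Rightarrow> nat \<Rightarrow> nat \<Rightarrow> banana_vertex" where
  "banana_vertex_at ls i j =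
     (if j = 0 then Pole_x else if j = ls ! i then Pole_y else Inner i j)"

text \<open>\<open>B [l\<^sub>1, \<dots>, l\<^sub>n]\<close>; meaningful only if all lengths are positive.
  The edge \<open>(i, j)\<close> is the \<open>j\<close>-th edge, counted from 0, of the \<open>i\<close>-th path.\<close>

definition B :: "nat list \<Rightarrow> (banana_vertex, nat \<times> nat) multigraph" where
  "B ls =
     \<lparr>verts = {Pole_x, Pole_y} \<union> {Inner i j | i j. i < length ls \<and> 0 < j \<and> j < ls ! i},
      edges = {(i, j). i < length ls \<and> j < ls ! i},
      ends = (\<lambda>(i, j). {banana_vertex_at ls i j, banana_vertex_at ls i (Suc j)})\<rparr>"

definition banana :: "nat \<Rightarrow> (banana_vertex, nat \<times> nat) multigraph" where
  "banana n = B (replicate n 1)"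

datatype phi_vertex = X nat | Y nat

text \<open>The Boolean argument distinguishes the two parallel edges at each end.\<close>

datatype phi_edge = X_step nat | Y_step nat | Start bool | Finish bool

definition Phi :: "nat \<Rightarrow> (phi_vertex, phi_edge) multigraph" where
  "Phi l =
     \<lparr>verts = X ` {..l} \<union> Y ` {..l},
      edges = X_step ` {..<l} \<union> Y_step ` {..<l} \<union> range Start \<union> range Finish,
      ends = (\<lambda>e. case e of
          X_step i \<Rightarrow> {X i, X (Suc i)}
        | Y_step i \<Rightarrow> {Y i, Y (Suc i)}
        | Start _ \<Rightarrow> {X 0, Y 0}
        | Finish _ \<Rightarrow> {X l, Y l})\<rparr>"

end

theory Submission
  imports Defs
begin

text \<open>On a 2-edge-connected hyperelliptic graph of genus at least 2, every vertex \<open>x\<close> has a unique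
  conjugate \<open>\<iota> x\<close> with \<open>(x) + (\<iota> x)\<close> in the degree 2 class of rank 1, and a fixed point of \<open>\<iota>\<close> is a
  Weierstrass point. If \<open>\<iota>\<close> has no fixed point, moving the two chips from one fibre of \<open>\<iota>\<close> to another
  shows that every edge between two fibres lies with its conjugate in a 2-edge cut. Hence the fibres
  form a tree, and its leaves are fibres \<open>{v, \<iota> v}\<close> with \<open>deg v = m + 1\<close>, where \<open>m\<close> is the number of
  edges between \<open>v\<close> and \<open>\<iota> v\<close>. If \<open>m + 2 \<le> g\<close>, firing \<open>v\<close> shows that \<open>v\<close> is a Weierstrass point;
  otherwise summing \<open>deg - 2\<close> over the vertices leaves only one fibre, genus 2, or genus 3 with all
  vertices outside two leaves of degree 2. The last two cases are read off after suppressing the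
  vertices of degree 2.

  Conversely, a divisor bounded by \<open>(number of edges to earlier vertices) - 1\<close> for some ordering of
  the vertices is not equivalent to an effective one, and in each of the listed graphs some
  \<open>g (x) - (y)\<close> is equivalent to such a divisor.\<close>


section \<open>Divisors as integer-valued functions\<close>

text \<open>Principal divisors depend on edge multiplicities only, so the argument runs on a
  symmetric weight function \<open>a\<close> on the vertices; the names of edges return in the
  isomorphisms, where parallel edges are matched arbitrarily. Two mechanisms recur. A function that
  is not constant sends chips out of the set where it is maximal across a whole cut, hence at least
  two chips: this makes distinct vertices inequivalent and pins down the cuts between fibres. Along
  a path of degree 2 vertices the divisor classes form an arithmetic progression: this puts a
  Weierstrass point at the midpoint of an even path from \<open>x\<close> to
  \<open>\<iota> x\<close>, whence the odd lengths in genus 2, and it supplies the equivalent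
  divisors needed for the converse. The equal lengths of the two sides of \<open>Phi l\<close> have
  a different source: \<open>\<iota>\<close> preserves multiplicities and so carries one side onto
  the other. Genus at least 2 lets \<open>2 (x)\<close> fit into \<open>g (x)\<close> when
  \<open>\<iota>\<close> fixes \<open>x\<close>.\<close>

definition pt :: "'v \<Rightarrow> 'v \<Rightarrow> int" where
  "pt x v = of_bool (v = x)"

definition lap :: "'v set \<Rightarrow> ('v \<Rightarrow> 'v \<Rightarrow> int) \<Rightarrow> ('v \<Rightarrow> int) \<Rightarrow> 'v \<Rightarrow> int" where
  "lap V a f v = (\<Sum>u\<in>V. a v u * (f v - f u))"

definition degree :: "'v set \<Rightarrow> ('v \<Rightarrow> 'v \<Rightarrow> int) \<Rightarrow> 'v \<Rightarrow> int" where
  "degree V a v = (\<Sum>u\<in>V. a v u)"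

definition cut :: "'v set \<Rightarrow> ('v \<Rightarrow> 'v \<Rightarrow> int) \<Rightarrow> 'v set \<Rightarrow> int" where
  "cut V a S = (\<Sum>s\<in>S. \<Sum>t\<in>V - S. a s t)"

text \<open>Divisors are compared on \<open>V\<close> only; the values of these functions elsewhere
  carry no meaning.\<close>

definition prin :: "'v set \<Rightarrow> ('v \<Rightarrow> 'v \<Rightarrow> int) \<Rightarrow> ('v \<Rightarrow> int) \<Rightarrow> bool" where
  "prin V a h \<longleftrightarrow> (\<exists>f. \<forall>v\<in>V. h v = lap V a f v)"

definition eff_equiv :: "'v set \<Rightarrow> ('v \<Rightarrow> 'v \<Rightarrow> int) \<Rightarrow> ('v \<Rightarrow> int) \<Rightarrow> bool" where
  "eff_equiv V a D \<longleftrightarrow> (\<exists>f. \<forall>v\<in>V. 0 \<le> D v + lap V a f v)"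

definition wpt :: "'v set \<Rightarrow> ('v \<Rightarrow> 'v \<Rightarrow> int) \<Rightarrow> int \<Rightarrow> 'v \<Rightarrow> bool" where
  "wpt V a g x \<longleftrightarrow> x \<in> V \<and> (\<forall>y\<in>V. eff_equiv V a (\<lambda>v. g * pt x v - pt y v))"

lemma lap_add: "lap V a (\<lambda>v. f v + h v) v = lap V a f v + lap V a h v"
  unfolding lap_def by (simp add: algebra_simps flip: sum.distrib)

lemma lap_cmul: "lap V a (\<lambda>v. c * f v) v = c * lap V a f v"
  unfolding lap_def sum_distrib_left by (intro sum.cong refl) (simp add: algebra_simps)

lemma prin_add:
  assumes "prin V a h" "prin V a k"
  shows "prin V a (\<lambda>v. h v + k v)"
proof -
  obtain f f' where "\<forall>v\<in>V. h v = lap V a f v" "\<forall>v\<in>V. k v = lap V a f' v"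
    using assms unfolding prin_def by blast
  then show ?thesis
    unfolding prin_def by (intro exI[of _ "\<lambda>v. f v + f' v"]) (simp add: lap_add)
qed

lemma prin_cmul:
  assumes "prin V a h"
  shows "prin V a (\<lambda>v. c * h v)"
proof -
  obtain f where "\<forall>v\<in>V. h v = lap V a f v"
    using assms unfolding prin_def by blast
  then show ?thesis
    unfolding prin_def by (intro exI[of _ "\<lambda>v. c * f v"]) (simp add: lap_cmul)
qed

lemma prin_cong: "prin V a h \<Longrightarrow> (\<And>v. v \<in> V \<Longrightarrow> k v = h v) \<Longrightarrow> prin V a k"
  unfolding prin_def by metis

lemma prin_diff: "prin V a h \<Longrightarrow> prin V a k \<Longrightarrow> prin V a (\<lambda>v. h v - k v)"
  using prin_add[of V a h "\<lambda>v. - 1 * k v"] prin_cmul[of V a k "-1"] by simp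

lemma prin_zero: "prin V a (\<lambda>_. 0)"
  unfolding prin_def by (intro exI[of _ "\<lambda>_. 0"]) (simp add: lap_def)

lemma eff_equiv_prin:
  assumes "eff_equiv V a D" "prin V a h" "\<And>v. v \<in> V \<Longrightarrow> D v + h v \<le> D' v"
  shows "eff_equiv V a D'"
proof -
  obtain f where f: "\<forall>v\<in>V. 0 \<le> D v + lap V a f v"
    using assms(1) unfolding eff_equiv_def by blast
  obtain k where k: "\<forall>v\<in>V. h v = lap V a k v"
    using assms(2) unfolding prin_def by blast
  have "0 \<le> D' v + lap V a (\<lambda>v. f v + (- 1) * k v) v" if "v \<in> V" for v
    using f k assms(3)[OF that] that unfolding lap_add lap_cmul by fastforce
  then show ?thesis unfolding eff_equiv_def by blast
qed

lemma eff_equiv_prin_nonneg: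
  assumes "prin V a h" "\<And>v. v \<in> V \<Longrightarrow> h v \<le> D v"
  shows "eff_equiv V a D"
  by (rule eff_equiv_prin[of V a "\<lambda>_. 0", OF _ assms(1)])
    (use assms(2) in \<open>auto simp: eff_equiv_def lap_def intro!: exI[of _ "\<lambda>_. 0"]\<close>)

lemma eff_equivE:
  assumes "eff_equiv V a D"
  obtains E where "\<And>v. v \<in> V \<Longrightarrow> 0 \<le> E v" "prin V a (\<lambda>v. E v - D v)"
proof -
  obtain f where f: "\<forall>v\<in>V. 0 \<le> D v + lap V a f v"
    using assms unfolding eff_equiv_def by blast
  show thesis
    by (rule that[of "\<lambda>v. D v + lap V a f v"]) (use f in \<open>auto simp: prin_def\<close>)
qed

section \<open>Chip firing on a symmetric weight function\<close>

locale weighted_graph =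
  fixes V :: "'v set" and a :: "'v \<Rightarrow> 'v \<Rightarrow> int"
  assumes finite_V: "finite V"
    and nonneg: "0 \<le> a u v"
    and adj_sym: "a u v = a v u"
    and irrefl: "a v v = 0"
begin

lemma sum_pt: "S \<subseteq> V \<Longrightarrow> (\<Sum>v\<in>S. pt x v) = of_bool (x \<in> S)"
  unfolding pt_def using finite_V by (auto simp: of_bool_def sum.delta' dest: finite_subset)

lemma lap_pt:
  assumes "q \<in> V" "v \<in> V"
  shows "lap V a (pt q) v = degree V a q * pt q v - a q v"
proof (cases "v = q")
  case True
  have "lap V a (pt q) v = (\<Sum>u\<in>V. a q u - (if u = q then a q u else 0))"
    unfolding lap_def True by (intro sum.cong refl) (auto simp: pt_def)
  also have "\<dots> = degree V a q - a q q"
    unfolding degree_def sum_subtractf using finite_V assms by (simp add: sum.delta)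
  finally show ?thesis using True irrefl by (simp add: pt_def)
next
  case False
  have "lap V a (pt q) v = (\<Sum>u\<in>V. if u = q then - a v u else 0)"
    unfolding lap_def by (intro sum.cong refl) (use False in \<open>auto simp: pt_def\<close>)
  then show ?thesis using False finite_V assms adj_sym[of v q] by (simp add: pt_def sum.delta)
qed

text \<open>Subtracting this divisor fires \<open>q\<close>: it loses its degree, and each neighbour
  gains one chip per edge.\<close>

lemma prin_pt: "q \<in> V \<Longrightarrow> prin V a (\<lambda>v. degree V a q * pt q v - a q v)"
  unfolding prin_def using lap_pt by metis

lemma sum_antisym:
  assumes "finite S"
  shows "(\<Sum>s\<in>S. \<Sum>t\<in>S. a s t * (f s - f t)) = 0"
proof -
  let ?X = "\<Sum>s\<in>S. \<Sum>t\<in>S. a s t * (f s - f t)"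
  have "?X = (\<Sum>s\<in>S. \<Sum>t\<in>S. a t s * (f t - f s))"
    by (rule sum.swap)
  also have "\<dots> = (\<Sum>s\<in>S. \<Sum>t\<in>S. - (a s t * (f s - f t)))"
    by (intro sum.cong refl) (simp add: adj_sym algebra_simps)
  also have "\<dots> = - ?X" by (simp add: sum_negf)
  finally show ?thesis by simp
qed

text \<open>Edges inside \<open>S\<close> contribute opposite amounts at their two ends, so only the
  cut remains.\<close>

lemma sum_lap_cut:
  assumes "S \<subseteq> V"
  shows "(\<Sum>s\<in>S. lap V a f s) = (\<Sum>s\<in>S. \<Sum>t\<in>V - S. a s t * (f s - f t))"
proof -
  have "finite S" using assms finite_V finite_subset by blast
  have "lap V a f s = (\<Sum>t\<in>S. a s t * (f s - f t)) + (\<Sum>t\<in>V - S. a s t * (f s - f t))" for s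
    unfolding lap_def using sum.subset_diff[OF assms finite_V] by (metis add.commute)
  then show ?thesis using sum_antisym[OF \<open>finite S\<close>] by (simp add: sum.distrib)
qed

lemma sum_lap: "(\<Sum>v\<in>V. lap V a f v) = 0"
  using sum_lap_cut[of V f] by simp

lemma prin_sum: "prin V a h \<Longrightarrow> sum h V = 0"
  unfolding prin_def using sum_lap by (metis (no_types, lifting) sum.cong)

lemma degree_ge:
  assumes "U \<subseteq> V"
  shows "(\<Sum>u\<in>U. a v u) \<le> degree V a v"
  unfolding degree_def using finite_V assms by (intro sum_mono2) (auto simp: nonneg)

text \<open>The value \<open>-1\<close> plus the number of edges to earlier vertices is a divisor of degree
  \<open>g - 1\<close> without effective representative: a function \<open>f\<close> making it effective would
  be violated at the earliest vertex where \<open>f\<close> is minimal.\<close>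

lemma not_eff_equiv_order:
  fixes \<rho> :: "'v \<Rightarrow> nat"
  assumes ne: "V \<noteq> {}"
    and D: "\<And>v. v \<in> V \<Longrightarrow> D v < (\<Sum>u\<in>{u\<in>V. \<rho> u < \<rho> v}. a v u)"
  shows "\<not> eff_equiv V a D"
proof
  assume "eff_equiv V a D"
  then obtain f where f: "\<forall>v\<in>V. 0 \<le> D v + lap V a f v" unfolding eff_equiv_def by blast
  define S where "S = {v\<in>V. \<forall>u\<in>V. f v \<le> f u}"
  have ne_S: "S \<noteq> {}"
  proof -
    have "Min (f ` V) \<in> f ` V" using finite_V ne by simp
    then obtain v where "v \<in> V" "f v = Min (f ` V)" by auto
    then have "v \<in> S" using finite_V by (auto simp: S_def)
    then show ?thesis by blast
  qed
  obtain v where v: "v \<in> S" "\<And>u. u \<in> S \<Longrightarrow> \<rho> v \<le> \<rho> u"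
    using ex_has_least_nat[of "\<lambda>v. v \<in> S" _ \<rho>] ne_S by blast
  let ?U = "{u\<in>V. \<rho> u < \<rho> v}"
  have vV: "v \<in> V" and min: "\<And>u. u \<in> V \<Longrightarrow> f v \<le> f u" using v(1) by (auto simp: S_def)
  have less: "f v < f u" if "u \<in> ?U" for u
  proof (rule ccontr)
    assume "\<not> f v < f u"
    then have "u \<in> S" using min that by (force simp: S_def)
    then show False using v(2) that by force
  qed
  have "lap V a f v \<le> (\<Sum>u\<in>V. if u \<in> ?U then - a v u else 0)"
    unfolding lap_def
  proof (rule sum_mono)
    fix u assume u: "u \<in> V"
    show "a v u * (f v - f u) \<le> (if u \<in> ?U then - a v u else 0)"
    proof (cases "u \<in> ?U")
      case True
      then have "a v u * (f v - f u) \<le> a v u * (- 1)"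
        using less[OF True] nonneg by (intro mult_left_mono) auto
      then show ?thesis using True by simp
    next
      case False
      then show ?thesis using min[OF u] nonneg[of v u]
        by (simp only: if_False) (simp add: mult_nonneg_nonpos)
    qed
  qed
  also have "\<dots> = - (\<Sum>u\<in>?U. a v u)"
    using finite_V by (simp add: sum.If_cases sum_negf Int_def conj_commute)
  finally show False using f vV D[OF vV] by force
qed

text \<open>Firing the vertex \<open>p (k + 1)\<close> shows that \<open>2 p (k + 1)\<close> is
  equivalent to \<open>p k + p (k + 2)\<close>. Hence the classes of \<open>p 0, p 1, ...\<close>
  form an arithmetic progression with difference \<open>p 1 - p 0\<close>.\<close>

lemma prin_arith:
  assumes "\<And>j. j \<le> l \<Longrightarrow> p j \<in> V"
    and row: "\<And>j v. 0 < j \<Longrightarrow> j < l \<Longrightarrow> v \<in> V \<Longrightarrow> a (p j) v = pt (p (j - 1)) v + pt (p (j + 1)) v"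
    and "j \<le> l"
  shows "prin V a (\<lambda>v. pt (p j) v - pt (p 0) v - int j * (pt (p 1) v - pt (p 0) v))"
  using \<open>j \<le> l\<close>
proof (induction j rule: less_induct)
  case (less j)
  consider "j = 0" | "j = 1" | k where "j = Suc (Suc k)"
    by (metis One_nat_def not0_implies_Suc)
  then show ?case
  proof cases
    case 3
    let ?q = "p (Suc k)"
    have q: "?q \<in> V" using less.prems 3 assms(1) by simp
    have r: "a ?q v = pt (p k) v + pt (p j) v" if "v \<in> V" for v
      using row[of "Suc k" v] less.prems 3 that by simp
    have "degree V a ?q = (\<Sum>v\<in>V. pt (p k) v + pt (p j) v)"
      unfolding degree_def using r by (intro sum.cong) auto
    also have "\<dots> = 2" using assms(1)[of k] assms(1)[of j] less.prems 3
      by (simp add: sum.distrib sum_pt)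
    finally have d: "degree V a ?q = 2" .
    have 0: "prin V a (\<lambda>v. degree V a ?q * pt ?q v - a ?q v)" by (rule prin_pt[OF q])
    have 1: "prin V a (\<lambda>v. pt ?q v - pt (p 0) v - int (Suc k) * (pt (p 1) v - pt (p 0) v))"
      using less.IH[of "Suc k"] less.prems 3 by simp
    have 2: "prin V a (\<lambda>v. pt (p k) v - pt (p 0) v - int k * (pt (p 1) v - pt (p 0) v))"
      using less.IH[of k] less.prems 3 by simp
    show ?thesis
      by (rule prin_cong[OF prin_diff[OF prin_diff[OF prin_cmul[OF 1, of 2] 2] 0]])
        (use r d in \<open>auto simp: 3 algebra_simps\<close>)
  qed (auto intro: prin_cong[OF prin_zero])
qed

end

section \<open>Graphs in which every cut has at least two edges\<close>

locale two_edge_connected_graph = weighted_graph +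
  assumes cut_ge_2: "S \<subseteq> V \<Longrightarrow> S \<noteq> {} \<Longrightarrow> S \<noteq> V \<Longrightarrow> 2 \<le> cut V a S"
begin

lemma edge_across:
  assumes "S \<subseteq> V" "S \<noteq> {}" "S \<noteq> V"
  obtains s t where "s \<in> S" "t \<in> V - S" "0 < a s t"
proof -
  have "\<exists>s\<in>S. \<exists>t\<in>V - S. a s t \<noteq> 0"
    using cut_ge_2[OF assms] unfolding cut_def by (force intro: ccontr)
  then show thesis using that nonneg by (metis less_le)
qed

lemma degree_ge_2:
  assumes "v \<in> V" "V \<noteq> {v}"
  shows "2 \<le> degree V a v"
proof -
  have "cut V a {v} = degree V a v"
    using finite_V assms irrefl by (simp add: cut_def degree_def sum.remove[of V v])
  then show ?thesis using cut_ge_2[of "{v}"] assms by auto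
qed

text \<open>Chips leave the set where \<open>f\<close> is maximal, along all edges of a cut.\<close>

lemma firing_set:
  assumes "\<not> (\<forall>u\<in>V. \<forall>v\<in>V. f u = f v)"
  obtains S where "S \<subseteq> V" "S \<noteq> {}" "S \<noteq> V"
    "2 \<le> cut V a S" "cut V a S \<le> (\<Sum>s\<in>S. lap V a f s)"
    "\<And>s t. s \<in> S \<Longrightarrow> t \<in> V - S \<Longrightarrow> f t < f s"
    "\<And>s t. s \<in> S \<Longrightarrow> t \<in> S \<Longrightarrow> f t = f s"
proof -
  define S where "S = {v\<in>V. f v = Max (f ` V)}"
  have V: "V \<noteq> {}" using assms by auto
  have S: "S \<subseteq> V" by (auto simp: S_def)
  have "Max (f ` V) \<in> f ` V" using finite_V V by simp
  then have ne: "S \<noteq> {}" by (auto simp: S_def)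
  have neV: "S \<noteq> V"
  proof
    assume "S = V"
    then have "f v = Max (f ` V)" if "v \<in> V" for v using that by (auto simp: S_def)
    then show False using assms by metis
  qed
  have less: "f t < f s" if "s \<in> S" "t \<in> V - S" for s t
    using that finite_V by (auto simp: S_def order.strict_iff_order)
  have "cut V a S \<le> (\<Sum>s\<in>S. lap V a f s)"
    unfolding sum_lap_cut[OF S] cut_def
  proof (intro sum_mono)
    fix s t assume "s \<in> S" "t \<in> V - S"
    then have "a s t * 1 \<le> a s t * (f s - f t)"
      using less nonneg by (intro mult_left_mono) (auto simp: int_one_le_iff_zero_less)
    then show "a s t \<le> a s t * (f s - f t)" by simp
  qed
  then show thesis
    by (rule that[of S, OF S ne neV cut_ge_2[OF S ne neV] _ less]) (simp_all add: S_def)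
qed

text \<open>The set where \<open>f\<close> is maximal would have to lose at least two chips across
  its cut, while \<open>(x) - (y)\<close> offers at most one. This gives uniqueness of the conjugate
  vertex, hence that conjugation is an involution.\<close>

lemma prin_pt_eq:
  assumes "prin V a (\<lambda>v. pt x v - pt y v)" "x \<in> V" "y \<in> V"
  shows "x = y"
proof -
  obtain f where f: "\<forall>v\<in>V. pt x v - pt y v = lap V a f v"
    using assms unfolding prin_def by blast
  have "\<forall>u\<in>V. \<forall>v\<in>V. f u = f v"
  proof (rule ccontr)
    assume "\<not> ?thesis"
    then obtain S where S: "S \<subseteq> V" "2 \<le> cut V a S" "cut V a S \<le> (\<Sum>s\<in>S. lap V a f s)"
      by (rule firing_set)
    have "(\<Sum>s\<in>S. lap V a f s) = (\<Sum>s\<in>S. pt x s - pt y s)"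
      using f S by (intro sum.cong) auto
    also have "\<dots> \<le> 1" using S(1) by (auto simp: sum_subtractf sum_pt)
    finally show False using S by linarith
  qed
  then have "a x u * (f x - f u) = 0" if "u \<in> V" for u
    using assms(2) that by (metis cancel_comm_monoid_add_class.diff_cancel mult_zero_right)
  then have "lap V a f x = 0" unfolding lap_def by (rule sum.neutral[OF ballI])
  then show ?thesis using f assms(2) by (force simp: pt_def)
qed

end


section \<open>The hyperelliptic involution\<close>

text \<open>A degree 2 divisor of rank 1 is remembered through its representatives
  \<open>(x) + (\<iota> x)\<close>, which are all equivalent.\<close>

locale hyperelliptic_graph = two_edge_connected_graph +
  fixes \<iota> :: "'v \<Rightarrow> 'v"
  assumes iota_V: "x \<in> V \<Longrightarrow> \<iota> x \<in> V"
    and iota_iota: "x \<in> V \<Longrightarrow> \<iota> (\<iota> x) = x"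
    and iota_prin: "x \<in> V \<Longrightarrow> y \<in> V \<Longrightarrow>
      prin V a (\<lambda>v. (pt x v + pt (\<iota> x) v) - (pt y v + pt (\<iota> y) v))"
begin

lemma iota_eq_iff: "x \<in> V \<Longrightarrow> y \<in> V \<Longrightarrow> \<iota> x = \<iota> y \<longleftrightarrow> x = y"
  using iota_iota by metis

lemma bij_iota: "bij_betw \<iota> V V"
  by (rule bij_betw_byWitness[of _ \<iota>]) (use iota_V iota_iota in auto)

text \<open>The pair \<open>{p, \<iota> p}\<close> contained in \<open>E\<close> can be exchanged
  for \<open>{y, \<iota> y}\<close>, so one representative \<open>E\<close> of \<open>g (x)\<close>
  serves every target \<open>y\<close>.\<close>

lemma wpt_if_pair:
  assumes "x \<in> V" "p \<in> V" "prin V a (\<lambda>v. E v - g * pt x v)"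
    "\<And>v. v \<in> V \<Longrightarrow> pt p v + pt (\<iota> p) v \<le> E v"
  shows "wpt V a g x"
  unfolding wpt_def
proof (intro conjI ballI)
  fix y assume y: "y \<in> V"
  have "prin V a (\<lambda>v. (pt p v + pt (\<iota> p) v - (pt y v + pt (\<iota> y) v)) - (E v - g * pt x v))"
    by (intro prin_diff iota_prin assms(2,3) y)
  then show "eff_equiv V a (\<lambda>v. g * pt x v - pt y v)"
  proof (rule eff_equiv_prin_nonneg)
    fix v assume "v \<in> V"
    moreover have "0 \<le> pt (\<iota> y) v" by (simp add: pt_def)
    ultimately show "pt p v + pt (\<iota> p) v - (pt y v + pt (\<iota> y) v) - (E v - g * pt x v)
      \<le> g * pt x v - pt y v" using assms(4)[of v] by linarith
  qed
qed (fact assms(1))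

end

section \<open>Involutions without fixed points: 2-edge cuts between fibres, and leaves\<close>

locale free_hyperelliptic_graph = hyperelliptic_graph V a \<iota>
  for V :: "'v set" and a \<iota> +
  assumes iota_neq: "x \<in> V \<Longrightarrow> \<iota> x \<noteq> x"
begin

text \<open>An edge \<open>zw\<close> between different fibres of \<open>\<iota>\<close> lies, together with its image, in a
  2-edge cut: moving the two chips from \<open>{z, \<iota> z}\<close> to \<open>{w, \<iota> w}\<close> fires a set that the two chips
  must be able to leave, and no cut has fewer than two edges.\<close>

lemma two_cut:
  assumes "z \<in> V" "w \<in> V" "w \<noteq> z" "w \<noteq> \<iota> z" "0 < a z w"
  obtains S where "S \<subseteq> V" "z \<in> S" "\<iota> z \<in> S" "w \<notin> S" "\<iota> w \<notin> S"
    "\<And>s t. s \<in> S \<Longrightarrow> t \<in> V - S \<Longrightarrow> a s t = of_bool (s = z \<and> t = w \<or> s = \<iota> z \<and> t = \<iota> w)"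
proof -
  obtain f where f: "\<And>v. v \<in> V \<Longrightarrow> pt z v + pt (\<iota> z) v - (pt w v + pt (\<iota> w) v) = lap V a f v"
    using iota_prin[OF assms(1,2)] unfolding prin_def by blast
  have iz: "\<iota> z \<in> V" "\<iota> z \<noteq> z" and iw: "\<iota> w \<in> V" "\<iota> w \<noteq> w"
    and izw: "\<iota> w \<noteq> z" "\<iota> w \<noteq> \<iota> z"
    using assms iota_V iota_neq iota_iota by metis+
  have "\<not> (\<forall>u\<in>V. \<forall>v\<in>V. f u = f v)"
  proof
    assume c: "\<forall>u\<in>V. \<forall>v\<in>V. f u = f v"
    have "lap V a f z = 0"
      unfolding lap_def
    proof (rule sum.neutral, rule ballI)
      fix u assume "u \<in> V"
      then have "f z = f u" using c assms(1) by blast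
      then show "a z u * (f z - f u) = 0" by simp
    qed
    then show False using f[OF assms(1)] assms iz izw by (simp add: pt_def)
  qed
  then obtain S where S: "S \<subseteq> V" "2 \<le> cut V a S" "cut V a S \<le> (\<Sum>s\<in>S. lap V a f s)"
    and less: "\<And>s t. s \<in> S \<Longrightarrow> t \<in> V - S \<Longrightarrow> f t < f s"
    and eq: "\<And>s t. s \<in> S \<Longrightarrow> t \<in> S \<Longrightarrow> f t = f s"
    by (rule firing_set) blast
  have fS: "finite S" "finite (V - S)" using S(1) finite_V by (auto dest: finite_subset)
  have "(\<Sum>s\<in>S. lap V a f s) = (\<Sum>s\<in>S. pt z s + pt (\<iota> z) s - (pt w s + pt (\<iota> w) s))"
    using f S by (intro sum.cong) auto
  also have "\<dots> = of_bool (z \<in> S) + of_bool (\<iota> z \<in> S) - (of_bool (w \<in> S) + of_bool (\<iota> w \<in> S))"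
    using S(1) by (simp add: sum_subtractf sum.distrib sum_pt)
  finally have sum: "(\<Sum>s\<in>S. lap V a f s) =
    of_bool (z \<in> S) + of_bool (\<iota> z \<in> S) - (of_bool (w \<in> S) + of_bool (\<iota> w \<in> S))" .
  \<comment> \<open>The signed count of the four points in \<open>S\<close> is at most 2 and at
    least the size of the cut, so it equals 2; this forces both sources into \<open>S\<close> and
    both targets out of it.\<close>
  have mem: "z \<in> S" "\<iota> z \<in> S" "w \<notin> S" "\<iota> w \<notin> S"
    and cut2: "cut V a S = 2" "(\<Sum>s\<in>S. lap V a f s) = 2"
    using S(2,3) sum by (auto simp: of_bool_def split: if_splits)
  have ge: "a s t \<le> a s t * (f s - f t)" if "s \<in> S" "t \<in> V - S" for s t
    using mult_left_mono[of 1 "f s - f t" "a s t"] less[OF that] nonneg by simp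
  \<comment> \<open>Each term dominates the corresponding \<open>a s t\<close> and both totals are
    2, so no row can be strictly larger.\<close>
  have eq_cut: "(\<Sum>t\<in>V - S. a s t * (f s - f t)) = (\<Sum>t\<in>V - S. a s t)" if "s \<in> S" for s
  proof (rule ccontr)
    assume ne: "\<not> ?thesis"
    have "cut V a S < (\<Sum>s\<in>S. \<Sum>t\<in>V - S. a s t * (f s - f t))"
      unfolding cut_def
    proof (rule sum_strict_mono_ex1[OF fS(1)])
      show "\<forall>s\<in>S. (\<Sum>t\<in>V - S. a s t) \<le> (\<Sum>t\<in>V - S. a s t * (f s - f t))"
        using ge by (intro ballI sum_mono)
      then show "\<exists>s\<in>S. (\<Sum>t\<in>V - S. a s t) < (\<Sum>t\<in>V - S. a s t * (f s - f t))"
        using ne that by (intro bexI[of _ s]) (auto simp: less_le)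
    qed
    then show False using cut2 sum_lap_cut[OF S(1), of f] by simp
  qed
  have out: "(\<Sum>t\<in>V - S. a s t) = pt z s + pt (\<iota> z) s" if "s \<in> S" for s
  proof -
    have "lap V a f s = (\<Sum>t\<in>S. a s t * (f s - f t)) + (\<Sum>t\<in>V - S. a s t * (f s - f t))"
      unfolding lap_def using sum.subset_diff[OF S(1) finite_V] by (metis add.commute)
    also have "(\<Sum>t\<in>S. a s t * (f s - f t)) = 0"
    proof (rule sum.neutral, rule ballI)
      fix t assume "t \<in> S"
      then have "f s = f t" using eq that by metis
      then show "a s t * (f s - f t) = 0" by simp
    qed
    finally have "(\<Sum>t\<in>V - S. a s t) = pt z s + pt (\<iota> z) s - (pt w s + pt (\<iota> w) s)"
      using eq_cut[OF that] f[of s] that S(1) by auto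
    moreover have "pt w s = 0" "pt (\<iota> w) s = 0" using that mem by (auto simp: pt_def)
    ultimately show ?thesis by simp
  qed
  have single: "\<exists>u\<in>V - S. \<forall>t\<in>V - S. a s t = pt u t" if s: "s = z \<or> s = \<iota> z" for s
  proof -
    have 1: "(\<Sum>t\<in>V - S. a s t) = 1" using out[of s] s mem iz by (auto simp: pt_def)
    then obtain u where u: "u \<in> V - S" "a s u \<noteq> 0" by (metis sum.neutral zero_neq_one)
    have r: "(\<Sum>t\<in>V - S. a s t) = a s u + (\<Sum>t\<in>V - S - {u}. a s t)"
      using fS u by (intro sum.remove) auto
    have n0: "0 \<le> (\<Sum>t\<in>V - S - {u}. a s t)" by (intro sum_nonneg) (simp add: nonneg)
    have "a s u \<ge> 1" using u nonneg[of s u] by simp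
    then have su: "a s u = 1" and "(\<Sum>t\<in>V - S - {u}. a s t) = 0" using 1 r n0 by linarith+
    then have "\<forall>t\<in>V - S - {u}. a s t = 0"
      using fS by (subst (asm) sum_nonneg_eq_0_iff) (auto simp: nonneg)
    then show ?thesis using u su by (intro bexI[of _ u]) (auto simp: pt_def)
  qed
  obtain u where u: "u \<in> V - S" "\<And>t. t \<in> V - S \<Longrightarrow> a z t = pt u t" using single by blast
  obtain u' where u': "u' \<in> V - S" "\<And>t. t \<in> V - S \<Longrightarrow> a (\<iota> z) t = pt u' t" using single by blast
  have uw: "u = w" using u(2)[of w] assms(2,5) mem by (auto simp: pt_def split: if_splits)
  have zero: "a s t = 0" if "s \<in> S" "t \<in> V - S" "s \<noteq> z" "s \<noteq> \<iota> z" for s t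
  proof -
    have "(\<Sum>t\<in>V - S. a s t) = 0" using out[OF that(1)] that by (simp add: pt_def)
    then have "\<forall>t\<in>V - S. a s t = 0"
      using fS by (subst (asm) sum_nonneg_eq_0_iff) (auto simp: nonneg)
    then show ?thesis using that by blast
  qed
  \<comment> \<open>The function \<open>f\<close> may descend further outside \<open>S\<close>, so
    \<open>S\<close> is now fired exactly once. This moves the chips to the far ends
    \<open>u = w\<close> and \<open>u'\<close> of the two cut edges. Comparison with the equivalence
    to \<open>(w) + (\<iota> w)\<close> leaves \<open>(\<iota> w)\<close> equivalent to
    \<open>(u')\<close>, and these two vertices coincide.\<close>
  define h where "h v = (of_bool (v \<in> S) :: int)" for v
  have h: "lap V a h v = pt z v + pt (\<iota> z) v - (pt u v + pt u' v)" if v: "v \<in> V" for v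
  proof (cases "v \<in> S")
    case True
    have "lap V a h v = (\<Sum>t\<in>S. a v t * (h v - h t)) + (\<Sum>t\<in>V - S. a v t * (h v - h t))"
      unfolding lap_def using sum.subset_diff[OF S(1) finite_V] by (metis add.commute)
    also have "(\<Sum>t\<in>S. a v t * (h v - h t)) = 0" using True by (simp add: h_def)
    also have "(\<Sum>t\<in>V - S. a v t * (h v - h t)) = (\<Sum>t\<in>V - S. a v t)"
      using True by (intro sum.cong) (auto simp: h_def)
    finally show ?thesis using out[OF True] True u(1) u'(1) by (auto simp: pt_def)
  next
    case False
    then have v': "v \<in> V - S" using v by blast
    have "lap V a h v = (\<Sum>t\<in>S. a v t * (h v - h t)) + (\<Sum>t\<in>V - S. a v t * (h v - h t))"
      unfolding lap_def using sum.subset_diff[OF S(1) finite_V] by (metis add.commute)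
    also have "(\<Sum>t\<in>V - S. a v t * (h v - h t)) = 0" using False by (simp add: h_def)
    also have "(\<Sum>t\<in>S. a v t * (h v - h t)) = (\<Sum>t\<in>S. - (if t = z then a z v else 0) - (if t = \<iota> z then a (\<iota> z) v else 0))"
      using False iz zero[OF _ v'] adj_sym[of v] by (intro sum.cong) (auto simp: h_def)
    also have "\<dots> = - a z v - a (\<iota> z) v"
      unfolding sum_subtractf sum_negf using fS mem by (simp add: sum.delta)
    finally show ?thesis using False mem u(2)[OF v'] u'(2)[OF v'] by (auto simp: pt_def)
  qed
  then have "prin V a (\<lambda>v. (pt z v + pt (\<iota> z) v) - (pt u v + pt u' v))"
    unfolding prin_def by metis
  from prin_diff[OF this iota_prin[OF assms(1,2)]]
  have "prin V a (\<lambda>v. pt (\<iota> w) v - pt u' v)"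
    by (rule prin_cong) (simp add: uw)
  then have "\<iota> w = u'" using prin_pt_eq iw u'(1) by blast
  have "a s t = of_bool (s = z \<and> t = w \<or> s = \<iota> z \<and> t = \<iota> w)"
    if "s \<in> S" "t \<in> V - S" for s t
    using u(2)[OF that(2)] u'(2)[OF that(2)] zero[OF that] iz uw \<open>\<iota> w = u'\<close>
    by (cases "s = z"; cases "s = \<iota> z") (auto simp: pt_def)
  then show thesis by (rule that[OF S(1) mem])
qed

lemma two_cut_adj:
  assumes "z \<in> V" "w \<in> V" "w \<noteq> z" "w \<noteq> \<iota> z" "0 < a z w"
  shows "a z w = 1" "a (\<iota> z) (\<iota> w) = 1"
proof -
  obtain S where "z \<in> S" "\<iota> z \<in> S" "w \<in> V - S" "\<iota> w \<in> V - S"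
    "\<And>s t. s \<in> S \<Longrightarrow> t \<in> V - S \<Longrightarrow> a s t = of_bool (s = z \<and> t = w \<or> s = \<iota> z \<and> t = \<iota> w)"
    using two_cut[OF assms] iota_V assms(2) by (metis DiffI)
  then show "a z w = 1" "a (\<iota> z) (\<iota> w) = 1"
    using iota_neq[OF assms(1)] iota_neq[OF assms(2)] by auto
qed

text \<open>An edge between different fibres is simple and so is its image, by the 2-edge cut;
  inside a fibre \<open>\<iota>\<close> merely exchanges the two ends. Thus \<open>\<iota>\<close>
  acts as an automorphism of the multiplicities.\<close>

lemma adj_iota:
  assumes "z \<in> V" "w \<in> V"
  shows "a (\<iota> z) (\<iota> w) = a z w"
proof -
  consider "w = z" | "w = \<iota> z" | "w \<noteq> z" "w \<noteq> \<iota> z" by blast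
  then show ?thesis
  proof cases
    case 3
    have "\<iota> w \<noteq> \<iota> z" "\<iota> w \<noteq> \<iota> (\<iota> z)" using 3 assms iota_iota by metis+
    then show ?thesis
      using two_cut_adj(1,2)[OF assms 3] two_cut_adj(1,2)[of "\<iota> z" "\<iota> w"] iota_V assms iota_iota
        nonneg[of z w] nonneg[of "\<iota> z" "\<iota> w"] by (metis less_le)
  qed (use assms in \<open>simp_all add: irrefl iota_iota adj_sym\<close>)
qed

lemma degree_iota:
  assumes "x \<in> V"
  shows "degree V a (\<iota> x) = degree V a x"
proof -
  have "degree V a (\<iota> x) = (\<Sum>u\<in>V. a (\<iota> x) (\<iota> u))"
    unfolding degree_def by (rule sum.reindex_bij_betw[symmetric, OF bij_iota])
  then show ?thesis using assms by (simp add: degree_def adj_iota)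
qed

lemma not_singleton:
  assumes "x \<in> V"
  shows "V \<noteq> {x}"
  using iota_V iota_neq assms by blast

text \<open>The fibre \<open>{v, \<iota> v}\<close> is a leaf of the tree of fibres, attached to \<open>{u, \<iota> u}\<close>.\<close>

definition leaf :: "'v \<Rightarrow> 'v \<Rightarrow> bool" where
  "leaf v u \<longleftrightarrow> v \<in> V \<and> u \<in> V \<and> u \<noteq> v \<and> u \<noteq> \<iota> v \<and>
     (\<forall>t\<in>V. a v t = pt u t + a v (\<iota> v) * pt (\<iota> v) t)"

lemma leaf_degree:
  assumes "leaf v u"
  shows "degree V a v = a v (\<iota> v) + 1" "1 \<le> a v (\<iota> v)"
proof -
  have V: "v \<in> V" "u \<in> V" "\<iota> v \<in> V" using assms iota_V by (auto simp: leaf_def)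
  have "degree V a v = (\<Sum>t\<in>V. pt u t + a v (\<iota> v) * pt (\<iota> v) t)"
    using assms unfolding degree_def leaf_def by (intro sum.cong) auto
  also have "\<dots> = a v (\<iota> v) + 1"
    using V by (simp add: sum.distrib sum_pt flip: sum_distrib_left)
  finally show "degree V a v = a v (\<iota> v) + 1" .
  then show "1 \<le> a v (\<iota> v)" using degree_ge_2[OF V(1) not_singleton[OF V(1)]] by simp
qed

text \<open>Descent into the far side \<open>V - S\<close>: if it is the single fibre of
  \<open>w\<close>, that fibre is a leaf. Otherwise some edge joins this fibre to the rest of the
  far side, and its own 2-edge cut has a strictly smaller far side.\<close>

lemma leaf_exists_cut:
  assumes "S \<subseteq> V" "z \<in> S" "\<iota> z \<in> S" "w \<in> V - S" "\<iota> w \<in> V - S"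
    "\<And>s t. s \<in> S \<Longrightarrow> t \<in> V - S \<Longrightarrow> a s t = of_bool (s = z \<and> t = w \<or> s = \<iota> z \<and> t = \<iota> w)"
  shows "\<exists>v\<in>V - S. \<exists>u. leaf v u"
  using assms
proof (induction "card (V - S)" arbitrary: S z w rule: less_induct)
  case less
  note S = less.prems
  have zw: "z \<in> V" "\<iota> z \<in> V" "w \<in> V" "\<iota> w \<in> V" using S by auto
  show ?case
  proof (cases "V - S = {w, \<iota> w}")
    case True
    have "a w t = pt z t + a w (\<iota> w) * pt (\<iota> w) t" if t: "t \<in> V" for t
    proof (cases "t \<in> S")
      case True
      then have "a w t = of_bool (t = z)"
        using S(6)[OF True S(4)] iota_neq[OF zw(3)] adj_sym[of w t] by auto
      then show ?thesis using True S(5) by (auto simp: pt_def)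
    next
      case False
      then have "t = w \<or> t = \<iota> w" using True t by blast
      then show ?thesis using S irrefl by (auto simp: pt_def)
    qed
    then have "leaf w z" using S zw unfolding leaf_def by blast
    then show ?thesis using S(4) by blast
  next
    case False
    define Q where "Q = V - S - {w, \<iota> w}"
    have "Q \<subseteq> V" "Q \<noteq> {}" "Q \<noteq> V" using False S by (auto simp: Q_def)
    then obtain q w' where q: "q \<in> Q" "w' \<in> V - Q" "0 < a q w'" by (rule edge_across)
    \<comment> \<open>No edge joins \<open>Q\<close> to \<open>S\<close>, because the edges leaving
      \<open>S\<close> end in \<open>w\<close> and \<open>\<iota> w\<close>; so the edge found ends
      in the fibre of \<open>w\<close>.\<close>
    have "w' \<notin> S" using S(6)[of w' q] q adj_sym[of q w'] by (auto simp: Q_def)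
    then have w': "w' = w \<or> w' = \<iota> w" using q(2) by (auto simp: Q_def)
    then have W: "{w', \<iota> w'} = {w, \<iota> w}" "w' \<in> V" using iota_iota zw by auto
    have qV: "q \<in> V" "q \<notin> S" "q \<noteq> w'" "q \<noteq> \<iota> w'" using q W by (auto simp: Q_def)
    obtain S' where S': "S' \<subseteq> V" "w' \<in> S'" "\<iota> w' \<in> S'" "q \<notin> S'" "\<iota> q \<notin> S'"
      "\<And>s t. s \<in> S' \<Longrightarrow> t \<in> V - S' \<Longrightarrow> a s t = of_bool (s = w' \<and> t = q \<or> s = \<iota> w' \<and> t = \<iota> q)"
      using two_cut[OF W(2) qV(1,3,4)] q(3) adj_sym[of q w'] by metis
    \<comment> \<open>Otherwise some edge leaves \<open>S - S'\<close>. If it enters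
      \<open>S'\<close>, its end in \<open>S\<close> is \<open>q\<close> or
      \<open>\<iota> q\<close>. The first is excluded by \<open>q \<notin> S\<close>; in the second
      case the edge also crosses the cut of \<open>S\<close>, so \<open>q\<close> would be
      \<open>z\<close> or \<open>\<iota> z\<close>. If it does not enter \<open>S'\<close>, it
      leaves \<open>S\<close> and ends in the fibre of \<open>w\<close>, which lies in
      \<open>S'\<close>.\<close>
    have "S \<subseteq> S'"
    proof (rule ccontr)
      assume "\<not> S \<subseteq> S'"
      then have "S - S' \<subseteq> V" "S - S' \<noteq> {}" "S - S' \<noteq> V" using S(1,4) by auto
      then obtain s t where st: "s \<in> S" "s \<notin> S'" "t \<in> V" "t \<notin> S - S'" "0 < a s t"
        by (rule edge_across) blast
      have sV: "s \<in> V" using st S by blast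
      show False
      proof (cases "t \<in> S'")
        case True
        then have "t = w' \<and> s = q \<or> t = \<iota> w' \<and> s = \<iota> q"
          using S'(6)[of t s] st sV adj_sym[of s t] by (auto split: if_splits)
        then have 1: "s = \<iota> q" "t = \<iota> w'" using st qV by auto
        have "t \<in> {w, \<iota> w}" unfolding 1(2) W(1)[symmetric] by simp
        then have "t \<in> V - S" using S(4,5) by blast
        then have "s = z \<or> s = \<iota> z" using S(6)[of s t] st by (auto split: if_splits)
        then have "q = z \<or> q = \<iota> z" using 1 iota_iota qV(1) zw by metis
        then show False using qV S by blast
      next
        case False
        then have t: "t \<in> V - S" using st by blast
        then have "t \<in> {w', \<iota> w'}" unfolding W(1) using S(6)[of s t] st by (auto split: if_splits)
        then show False using False S'(2,3) by blast
      qed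
    qed
    then have "V - S' \<subset> V - S" using S'(2) W \<open>w' \<notin> S\<close> by blast
    then have "card (V - S') < card (V - S)" using finite_V by (intro psubset_card_mono) auto
    from less.hyps[OF this S'(1-3) _ _ S'(6)] S'(4,5) qV(1) iota_V
    have "\<exists>v\<in>V - S'. \<exists>u. leaf v u" by simp
    then show ?thesis using \<open>V - S' \<subset> V - S\<close> by blast
  qed
qed

lemma leaf_exists:
  assumes "z \<in> V" "w \<in> V" "w \<noteq> z" "w \<noteq> \<iota> z" "0 < a z w"
  shows "\<exists>v\<in>V - {z, \<iota> z}. \<exists>u. leaf v u"
proof -
  obtain S where S: "S \<subseteq> V" "z \<in> S" "\<iota> z \<in> S" "w \<notin> S" "\<iota> w \<notin> S"
    "\<And>s t. s \<in> S \<Longrightarrow> t \<in> V - S \<Longrightarrow> a s t = of_bool (s = z \<and> t = w \<or> s = \<iota> z \<and> t = \<iota> w)"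
    by (rule two_cut[OF assms]) blast
  then show ?thesis
    using leaf_exists_cut[OF S(1-3) _ _ S(6)] assms(2) iota_V by blast
qed

text \<open>The edge attaching the first leaf, read from the leaf outwards, again has a leaf on its
  far side.\<close>

lemma two_leaves:
  assumes "x \<in> V" "V \<noteq> {x, \<iota> x}"
  obtains v u v' u' where "leaf v u" "leaf v' u'" "v' \<noteq> v" "v' \<noteq> \<iota> v"
proof -
  obtain s t where st: "s \<in> {x, \<iota> x}" "t \<in> V - {x, \<iota> x}" "0 < a s t"
    using edge_across[of "{x, \<iota> x}"] assms iota_V by blast
  then have "s \<in> V" "t \<in> V" "t \<noteq> s" "t \<noteq> \<iota> s" using assms iota_V iota_iota by auto
  then obtain v u where vu: "leaf v u" using leaf_exists st by blast
  have "0 < a v u" using vu leaf_degree(2)[OF vu] by (auto simp: leaf_def pt_def)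
  then have "\<exists>v'\<in>V - {v, \<iota> v}. \<exists>u'. leaf v' u'"
    using vu leaf_exists[of v u] unfolding leaf_def by blast
  then show thesis using that vu by blast
qed

text \<open>If \<open>v\<close> has degree less than \<open>g\<close>, firing it leaves a chip at \<open>v\<close> and sends one to \<open>\<iota> v\<close>.\<close>

lemma leaf_wpt:
  assumes "leaf v u" "a v (\<iota> v) + 2 \<le> g"
  shows "wpt V a g v"
proof -
  have v: "v \<in> V" and row: "\<And>t. t \<in> V \<Longrightarrow> a v t = pt u t + a v (\<iota> v) * pt (\<iota> v) t"
    using assms(1) by (auto simp: leaf_def)
  show ?thesis
  proof (rule wpt_if_pair[OF v v, of "\<lambda>t. g * pt v t - (degree V a v * pt v t - a v t)"])
    show "prin V a (\<lambda>t. g * pt v t - (degree V a v * pt v t - a v t) - g * pt v t)"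
      by (rule prin_cong[OF prin_cmul[OF prin_pt[OF v], of "-1"]]) simp
    fix t assume "t \<in> V"
    then show "pt v t + pt (\<iota> v) t \<le> g * pt v t - (degree V a v * pt v t - a v t)"
      using row[of t] leaf_degree[OF assms(1)] assms(2) iota_neq[OF v]
      by (auto simp: pt_def irrefl of_bool_def)
  qed
qed

end


section \<open>Suppressing vertices of degree 2\<close>

text \<open>\<open>path_adj p I r s t\<close> counts the edges between \<open>s\<close> and \<open>t\<close> on the path from \<open>p\<close> to \<open>r\<close> with
  list of inner vertices \<open>I\<close>.\<close>

fun path_adj :: "'v \<Rightarrow> 'v list \<Rightarrow> 'v \<Rightarrow> 'v \<Rightarrow> 'v \<Rightarrow> int" where
  "path_adj p [] r s t = of_bool ({s, t} = {p, r})"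
| "path_adj p (q # I) r s t = of_bool ({s, t} = {p, q}) + path_adj q I r s t"

lemma path_adj_nonneg: "0 \<le> path_adj p I r s t"
  by (induction I arbitrary: p) auto

lemma path_adj_commute: "path_adj p I r s t = path_adj p I r t s"
  by (induction I arbitrary: p) (simp_all add: insert_commute)

lemma path_adj_eq_0:
  assumes "s \<notin> insert p (insert r (set I))"
  shows "path_adj p I r s t = 0"
  using assms by (induction I arbitrary: p) (auto simp: doubleton_eq_iff)

text \<open>Subdivision of one edge \<open>uw\<close> by \<open>q\<close>. Only the first occurrence
  of \<open>uw\<close> along the path is split, which matches the single edge removed from the
  count.\<close>

lemma path_adj_insert:
  assumes "0 < path_adj p I r u w"
  shows "\<exists>I1 I2. I = I1 @ I2 \<and> (\<forall>s t. path_adj p (I1 @ q # I2) r s t =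
    path_adj p I r s t - of_bool ({s, t} = {u, w}) + of_bool ({s, t} = {u, q}) + of_bool ({s, t} = {q, w}))"
  using assms
proof (induction I arbitrary: p)
  case Nil
  then have "(u = p \<and> w = r) \<or> (u = r \<and> w = p)" by (auto simp: doubleton_eq_iff split: if_splits)
  moreover have "{r, q} = {q, r}" "{q, p} = {p, q}" "{r, p} = {p, r}" by auto
  ultimately have "\<forall>s t. path_adj p ([] @ q # []) r s t =
    path_adj p [] r s t - of_bool ({s, t} = {u, w}) + of_bool ({s, t} = {u, q}) + of_bool ({s, t} = {q, w})"
    by (elim disjE) simp_all
  then show ?case by blast
next
  case (Cons y I)
  show ?case
  proof (cases "{u, w} = {p, y}")
    case True
    then have "(u = p \<and> w = y) \<or> (u = y \<and> w = p)" by (auto simp: doubleton_eq_iff)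
    moreover have "{y, q} = {q, y}" "{q, p} = {p, q}" "{y, p} = {p, y}" by auto
    ultimately have "\<forall>s t. path_adj p ([] @ q # y # I) r s t =
      path_adj p (y # I) r s t - of_bool ({s, t} = {u, w}) + of_bool ({s, t} = {u, q}) + of_bool ({s, t} = {q, w})"
      by (elim disjE) simp_all
    then show ?thesis by (metis append_Nil)
  next
    case False
    then have "0 < path_adj y I r u w" using Cons.prems by simp
    then obtain I1 I2 where I: "I = I1 @ I2" "\<And>s t. path_adj y (I1 @ q # I2) r s t =
      path_adj y I r s t - of_bool ({s, t} = {u, w}) + of_bool ({s, t} = {u, q}) + of_bool ({s, t} = {q, w})"
      using Cons.IH by blast
    show ?thesis
      by (rule exI[of _ "y # I1"], rule exI[of _ I2]) (use I in auto)
  qed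
qed

lemma path_adj_nth:
  assumes "j \<le> length I"
  shows "0 < path_adj p I r ((p # I @ [r]) ! j) ((p # I @ [r]) ! Suc j)"
  using assms
proof (induction I arbitrary: p j)
  case (Cons y I)
  show ?case
  proof (cases j)
    case 0
    then show ?thesis using path_adj_nonneg[of y I r p y] by simp
  next
    case (Suc k)
    then show ?thesis using Cons.IH[of k y] Cons.prems
      by (simp add: add_nonneg_pos)
  qed
qed simp

text \<open>Counting edges by their position on the path is the form that matches the indexing of
  edges in \<open>B\<close> and \<open>Phi\<close>.\<close>

lemma path_adj_card:
  "path_adj p I r s t = int (card {j. j \<le> length I \<and> {(p # I @ [r]) ! j, (p # I @ [r]) ! Suc j} = {s, t}})"
proof (induction I arbitrary: p)
  case Nil
  have "{j. j \<le> length [] \<and> {(p # [] @ [r]) ! j, (p # [] @ [r]) ! Suc j} = {s, t}} = {j. j = 0 \<and> {s, t} = {p, r}}"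
    by (rule Collect_cong) (simp add: eq_commute[of "{s, t}"] cong: conj_cong)
  also have "card \<dots> = of_bool ({s, t} = {p, r})" by (simp add: of_bool_def)
  finally show ?case by simp
next
  case (Cons y I)
  let ?P = "\<lambda>j. {(p # (y # I) @ [r]) ! j, (p # (y # I) @ [r]) ! Suc j} = {s, t}"
  let ?Q = "{j. j \<le> length I \<and> {(y # I @ [r]) ! j, (y # I @ [r]) ! Suc j} = {s, t}}"
  have "{j. j \<le> length (y # I) \<and> ?P j} = (if {s, t} = {p, y} then {0} else {}) \<union> Suc ` ?Q"
    (is "?L = ?R")
  proof (rule Set.set_eqI)
    fix j show "j \<in> ?L \<longleftrightarrow> j \<in> ?R"
      by (cases j) (simp_all add: eq_commute[of "{s, t}"] image_iff)
  qed
  moreover have "card ((if {s, t} = {p, y} then {0} else {}) \<union> Suc ` ?Q) = of_bool ({s, t} = {p, y}) + card ?Q"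
    by (simp add: card_image card_insert_if image_iff)
  ultimately have "card {j. j \<le> length (y # I) \<and> ?P j} = of_bool ({s, t} = {p, y}) + card ?Q"
    by (simp only:)
  then show ?case using Cons.IH[of y] by simp
qed

text \<open>The graph is the union of \<open>n\<close> paths between vertices of \<open>R\<close>, the \<open>i\<close>-th one from \<open>p i\<close> to
  \<open>r i\<close> through \<open>I i\<close>, which are disjoint except for their ends.\<close>

definition subdivides :: "'v set \<Rightarrow> 'v set \<Rightarrow> ('v \<Rightarrow> 'v \<Rightarrow> int) \<Rightarrow> nat \<Rightarrow> (nat \<Rightarrow> 'v) \<Rightarrow> (nat \<Rightarrow> 'v) \<Rightarrow> (nat \<Rightarrow> 'v list) \<Rightarrow> bool" where
  "subdivides V R a n p r I \<longleftrightarrow>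
     (\<forall>s\<in>V. \<forall>t\<in>V. a s t = (\<Sum>i<n. path_adj (p i) (I i) (r i) s t)) \<and>
     (\<forall>i<n. distinct (I i)) \<and>
     (\<forall>i<n. \<forall>j<n. i \<noteq> j \<longrightarrow> set (I i) \<inter> set (I j) = {}) \<and>
     (\<Union>i<n. set (I i)) = V - R"

text \<open>Undoes the suppression of \<open>q\<close>: the added edge \<open>uw\<close> lies on one
  of the paths, and \<open>q\<close> is put back in the middle of it.\<close>

lemma subdivides_insert:
  assumes S: "subdivides (V - {q}) R (\<lambda>s t. a s t + of_bool ({s, t} = {u, w})) n p r I"
    and ends: "\<And>i. i < n \<Longrightarrow> p i \<in> R \<and> r i \<in> R"
    and R: "R \<subseteq> V" "q \<in> V - R" and uw: "u \<in> V - {q}" "w \<in> V - {q}"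
    and nonneg: "0 \<le> a u w"
    and row: "\<And>t. t \<in> V \<Longrightarrow> a q t = of_bool (t = u) + of_bool (t = w) \<and> a t q = a q t"
  shows "\<exists>J. subdivides V R a n p r J"
proof -
  have adj: "a s t + of_bool ({s, t} = {u, w}) = (\<Sum>i<n. path_adj (p i) (I i) (r i) s t)"
    if "s \<in> V - {q}" "t \<in> V - {q}" for s t
    using S that by (auto simp: subdivides_def)
  have dist: "\<And>i. i < n \<Longrightarrow> distinct (I i)"
    and disj: "\<And>i j. i < n \<Longrightarrow> j < n \<Longrightarrow> i \<noteq> j \<Longrightarrow> set (I i) \<inter> set (I j) = {}"
    and un: "(\<Union>i<n. set (I i)) = V - {q} - R"
    using S by (auto simp: subdivides_def)
  \<comment> \<open>The added edge makes the multiplicity of \<open>uw\<close> at least 1, so some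
    path runs through it.\<close>
  have "\<exists>i<n. path_adj (p i) (I i) (r i) u w \<noteq> 0"
  proof (rule ccontr)
    assume "\<not> ?thesis"
    then have "(\<Sum>i<n. path_adj (p i) (I i) (r i) u w) = 0" by simp
    then show False using adj[OF uw] nonneg by simp
  qed
  then obtain i where i: "i < n" "0 < path_adj (p i) (I i) (r i) u w"
    using path_adj_nonneg by (metis less_le)
  obtain I1 I2 where I12: "I i = I1 @ I2" and ins: "\<And>s t. path_adj (p i) (I1 @ q # I2) (r i) s t =
    path_adj (p i) (I i) (r i) s t - of_bool ({s, t} = {u, w}) + of_bool ({s, t} = {u, q}) + of_bool ({s, t} = {q, w})"
    using path_adj_insert[OF i(2), of q] by blast
  define J where "J = I(i := I1 @ q # I2)"
  have q: "q \<notin> set (I j)" if "j < n" for j using un that by blast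
  have set_J: "set (J j) = (if j = i then insert q (set (I i)) else set (I j))" for j
    using I12 by (auto simp: J_def)
  have sum_J: "(\<Sum>j<n. path_adj (p j) (J j) (r j) s t) = (\<Sum>j<n. path_adj (p j) (I j) (r j) s t)
      - of_bool ({s, t} = {u, w}) + of_bool ({s, t} = {u, q}) + of_bool ({s, t} = {q, w})" for s t
  proof -
    let ?c = "- of_bool ({s, t} = {u, w}) + of_bool ({s, t} = {u, q}) + of_bool ({s, t} = {q, w}) :: int"
    have "(\<Sum>j<n. path_adj (p j) (J j) (r j) s t)
      = (\<Sum>j<n. path_adj (p j) (I j) (r j) s t + (if j = i then ?c else 0))"
      by (intro sum.cong refl) (simp add: J_def ins)
    also have "\<dots> = (\<Sum>j<n. path_adj (p j) (I j) (r j) s t) + ?c"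
      using i(1) by (simp add: sum.distrib sum.delta)
    finally show ?thesis by simp
  qed
  have zero: "(\<Sum>j<n. path_adj (p j) (I j) (r j) q t) = 0" for t
    by (intro sum.neutral ballI path_adj_eq_0) (use q ends R in auto)
  have q_row: "a q t = (\<Sum>j<n. path_adj (p j) (J j) (r j) q t)" if "t \<in> V" for t
    unfolding sum_J zero using row[OF that] uw by (auto simp: doubleton_eq_iff)
  have "a s t = (\<Sum>j<n. path_adj (p j) (J j) (r j) s t)" if st: "s \<in> V" "t \<in> V" for s t
  proof -
    consider "s = q" | "t = q" | "s \<noteq> q" "t \<noteq> q" by blast
    then show ?thesis
    proof cases
      case 1
      then show ?thesis using q_row st by simp
    next
      case 2
      then show ?thesis using q_row[OF st(1)] row[OF st(1)] by (simp add: path_adj_commute[of _ _ _ s q])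
    next
      case 3
      then show ?thesis unfolding sum_J using adj[of s t] st by (auto simp: doubleton_eq_iff)
    qed
  qed
  moreover have "distinct (J j)" if "j < n" for j
    using dist[OF that] dist[OF i(1)] q[OF i(1)] I12 by (auto simp: J_def)
  moreover have "set (J j) \<inter> set (J k) = {}" if "j < n" "k < n" "j \<noteq> k" for j k
    using disj[OF that] q that unfolding set_J by auto
  moreover have "(\<Union>j<n. set (J j)) = V - R"
  proof -
    have "(\<Union>j<n. set (J j)) = insert q (\<Union>j<n. set (I j))" using i(1) unfolding set_J by (auto split: if_splits)
    then show ?thesis using un R by auto
  qed
  ultimately show ?thesis unfolding subdivides_def by blast
qed

text \<open>The cut of \<open>S\<close> in the new graph has the size of the old cut of
  \<open>S\<close> or of \<open>insert q S\<close>: \<open>q\<close> joins the side of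
  \<open>u\<close> and \<open>w\<close> when they are together, and either side when they are
  separated.\<close>

lemma (in two_edge_connected_graph) smooth_vertex:
  assumes q: "q \<in> V" and u: "u \<in> V - {q}" and w: "w \<in> V - {q}" and "u \<noteq> w"
    and row: "\<And>t. t \<in> V \<Longrightarrow> a q t = of_bool (t = u) + of_bool (t = w)"
  defines "b \<equiv> \<lambda>s t. a s t + of_bool ({s, t} = {u, w})"
  shows "two_edge_connected_graph (V - {q}) b"
    and "v \<in> V - {q} \<Longrightarrow> degree (V - {q}) b v = degree V a v"
proof -
  have b_cut: "(\<Sum>s\<in>S. \<Sum>t\<in>V - {q} - S. of_bool ({s, t} = {u, w})) = of_bool (u \<in> S) * of_bool (w \<notin> S)
      + of_bool (w \<in> S) * (of_bool (u \<notin> S) :: int)" if S: "S \<subseteq> V - {q}" for S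
  proof -
    have "finite S" "finite (V - {q} - S)" using S finite_V finite_subset by auto
    have "(\<Sum>s\<in>S. \<Sum>t\<in>V - {q} - S. of_bool ({s, t} = {u, w})) = 
      (\<Sum>s\<in>S. \<Sum>t\<in>V - {q} - S. (if t = w then of_bool (s = u) else 0) + (if t = u then of_bool (s = w) else (0::int)))"
      using \<open>u \<noteq> w\<close> by (intro sum.cong refl) (auto simp: doubleton_eq_iff)
    also have "\<dots> = (\<Sum>s\<in>S. (if s = u then of_bool (w \<notin> S) else 0) + (if s = w then of_bool (u \<notin> S) else 0))"
      using u w \<open>finite (V - {q} - S)\<close> by (intro sum.cong refl) (auto simp: sum.distrib sum.delta)
    also have "\<dots> = of_bool (u \<in> S) * of_bool (w \<notin> S) + of_bool (w \<in> S) * of_bool (u \<notin> S)"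
      using \<open>finite S\<close> by (simp add: sum.distrib sum.delta)
    finally show ?thesis .
  qed
  have Vq: "\<And>X. X \<subseteq> V - {q} \<Longrightarrow> finite X" using finite_V finite_subset by blast
  show "two_edge_connected_graph (V - {q}) b"
  proof
    show "finite (V - {q})" using finite_V by simp
    show "0 \<le> b s t" "b s t = b t s" "b s s = 0" for s t
      using nonneg adj_sym[of s t] irrefl \<open>u \<noteq> w\<close> by (auto simp: b_def insert_commute)
    fix S assume S: "S \<subseteq> V - {q}" "S \<noteq> {}" "S \<noteq> V - {q}"
    have cut_b: "cut (V - {q}) b S = (\<Sum>s\<in>S. \<Sum>t\<in>V - {q} - S. a s t)
        + of_bool (u \<in> S) * of_bool (w \<notin> S) + of_bool (w \<in> S) * (of_bool (u \<notin> S))"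
      using b_cut[OF S(1)] by (simp add: cut_def b_def sum.distrib)
    have rem: "V - S = insert q (V - {q} - S)" using q S by auto
    have "cut V a S = (\<Sum>s\<in>S. a s q) + (\<Sum>s\<in>S. \<Sum>t\<in>V - {q} - S. a s t)"
      unfolding cut_def rem using Vq[of "V - {q} - S"] by (simp add: sum.distrib)
    also have "(\<Sum>s\<in>S. a s q) = (\<Sum>s\<in>S. (if s = u then 1 else 0) + (if s = w then 1 else 0))"
      using S(1) row adj_sym[of _ q] by (intro sum.cong) (auto simp: subset_iff)
    also have "\<dots> = of_bool (u \<in> S) + of_bool (w \<in> S)"
      using Vq[OF S(1)] by (simp add: sum.distrib sum.delta)
    finally have cut1: "cut V a S = of_bool (u \<in> S) + of_bool (w \<in> S) + (\<Sum>s\<in>S. \<Sum>t\<in>V - {q} - S. a s t)" .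
    have rem': "V - insert q S = V - {q} - S" by auto
    have "q \<notin> S" using S by blast
    then have "cut V a (insert q S) = (\<Sum>t\<in>V - {q} - S. a q t) + (\<Sum>s\<in>S. \<Sum>t\<in>V - {q} - S. a s t)"
      unfolding cut_def rem' using Vq[OF S(1)] by simp
    also have "(\<Sum>t\<in>V - {q} - S. a q t) = (\<Sum>t\<in>V - {q} - S. (if t = u then 1 else 0) + (if t = w then 1 else 0))"
      using row by (intro sum.cong) auto
    also have "\<dots> = of_bool (u \<notin> S) + of_bool (w \<notin> S)"
      using Vq[of "V - {q} - S"] u w by (simp add: sum.distrib sum.delta)
    finally have cut2: "cut V a (insert q S) = of_bool (u \<notin> S) + of_bool (w \<notin> S) + (\<Sum>s\<in>S. \<Sum>t\<in>V - {q} - S. a s t)" .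
    have "2 \<le> cut V a S" using S q by (intro cut_ge_2) auto
    moreover have "2 \<le> cut V a (insert q S)" using S q by (intro cut_ge_2) auto
    ultimately show "2 \<le> cut (V - {q}) b S"
      unfolding cut_b cut1 cut2 by (cases "u \<in> S"; cases "w \<in> S") auto
  qed
  show "degree (V - {q}) b v = degree V a v" if v: "v \<in> V - {q}"
  proof -
    have "degree V a v = a v q + (\<Sum>t\<in>V - {q}. a v t)"
      unfolding degree_def using finite_V q by (rule sum.remove)
    moreover have "a v q = of_bool (v = u) + of_bool (v = w)"
      using row[of v] v adj_sym[of v q] by simp
    moreover have "degree (V - {q}) b v = (\<Sum>t\<in>V - {q}. a v t)
        + (\<Sum>t\<in>V - {q}. (if t = w then of_bool (v = u) else 0) + (if t = u then of_bool (v = w) else 0))"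
      unfolding degree_def b_def sum.distrib[symmetric]
      by (intro sum.cong refl) (use \<open>u \<noteq> w\<close> in \<open>auto simp: doubleton_eq_iff\<close>)
    moreover have "(\<Sum>t\<in>V - {q}. (if t = w then of_bool (v = u) else 0) + (if t = u then of_bool (v = w) else (0::int)))
      = of_bool (v = u) + of_bool (v = w)"
      using finite_V u w by (simp add: sum.distrib sum.delta)
    ultimately show ?thesis by simp
  qed
qed

text \<open>A double edge \<open>qu\<close> would leave at most \<open>3 - 2\<close> edges out of
  \<open>{q, u}\<close>, against the cut condition; \<open>3 \<le> card V\<close> makes this set a
  proper one.\<close>

lemma (in two_edge_connected_graph) degree_2_row:
  assumes q: "q \<in> V" "degree V a q = 2" and le: "\<And>v. v \<in> V \<Longrightarrow> degree V a v \<le> 3"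
    and c: "3 \<le> card V"
  obtains u w where "u \<in> V - {q}" "w \<in> V - {q}" "u \<noteq> w"
    "\<And>t. t \<in> V \<Longrightarrow> a q t = of_bool (t = u) + of_bool (t = w)"
proof -
  have "\<exists>u\<in>V. a q u \<noteq> 0"
    using q(2) unfolding degree_def by (metis sum.neutral zero_neq_numeral)
  then obtain u where u: "u \<in> V" "a q u \<noteq> 0" by blast
  have uq: "u \<noteq> q" using u irrefl by metis
  have dq: "(\<Sum>t\<in>V. a q t) = a q u + (\<Sum>t\<in>V - {u}. a q t)" using finite_V u(1) by (rule sum.remove)
  have "a q u \<noteq> 2"
  proof
    assume 2: "a q u = 2"
    let ?S = "{q, u}"
    have "?S \<noteq> V"
    proof
      assume "?S = V"
      then have "card V = 2" using uq by (metis card_2_iff)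
      then show False using c by simp
    qed
    then have "2 \<le> cut V a ?S" using q u by (intro cut_ge_2) auto
    moreover have "degree V a s = (\<Sum>t\<in>?S. a s t) + (\<Sum>t\<in>V - ?S. a s t)" for s
      unfolding degree_def using sum.subset_diff[of ?S V] finite_V q u by (simp add: add.commute)
    then have "degree V a q + degree V a u = 2 * a q u + cut V a ?S"
      using uq irrefl adj_sym[of u q] by (simp add: cut_def)
    ultimately show False using q(2) le[OF u(1)] 2 by simp
  qed
  moreover have "0 \<le> (\<Sum>t\<in>V - {u}. a q t)" by (intro sum_nonneg) (simp add: nonneg)
  ultimately have 1: "a q u = 1" "(\<Sum>t\<in>V - {u}. a q t) = 1"
    using dq q(2) u(2) nonneg[of q u] unfolding degree_def by linarith+
  have "\<exists>w\<in>V - {u}. a q w \<noteq> 0"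
    using 1 by (metis sum.neutral zero_neq_one)
  then obtain w where w: "w \<in> V - {u}" "a q w \<noteq> 0" by blast
  have wq: "w \<noteq> q" using w irrefl by metis
  have "(\<Sum>t\<in>V - {u}. a q t) = a q w + (\<Sum>t\<in>V - {u} - {w}. a q t)" using finite_V w(1) by (intro sum.remove) auto
  moreover have "0 \<le> (\<Sum>t\<in>V - {u} - {w}. a q t)" by (intro sum_nonneg) (simp add: nonneg)
  ultimately have 2: "a q w = 1" "(\<Sum>t\<in>V - {u} - {w}. a q t) = 0"
    using 1 w nonneg[of q w] by linarith+
  then have "\<forall>t\<in>V - {u} - {w}. a q t = 0"
    using finite_V by (subst (asm) sum_nonneg_eq_0_iff) (auto simp: nonneg)
  then have "a q t = of_bool (t = u) + of_bool (t = w)" if "t \<in> V" for t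
    using that w 1 2 by (cases "t = u"; cases "t = w") auto
  then show thesis using that u w uq wq by blast
qed

text \<open>Suppressing a vertex of degree 2 creates no loop: its neighbours are distinct because all
  degrees are at most 3 and there are no bridges.\<close>

lemma smoothing:
  assumes "two_edge_connected_graph V a" "R \<subseteq> V" "2 \<le> card R"
    "\<And>v. v \<in> V - R \<Longrightarrow> degree V a v = 2" "\<And>v. v \<in> V \<Longrightarrow> degree V a v \<le> 3"
  shows "\<exists>b. two_edge_connected_graph R b \<and> (\<forall>v\<in>R. degree R b v = degree V a v) \<and>
    (\<forall>s\<in>R. \<forall>t\<in>R. a s t \<le> b s t) \<and>
    (\<forall>n p r. (\<forall>i<n. p i \<in> R \<and> r i \<in> R) \<longrightarrow>
       (\<forall>s\<in>R. \<forall>t\<in>R. b s t = (\<Sum>i<n. of_bool ({s, t} = {p i, r i}))) \<longrightarrow>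
       (\<exists>I. subdivides V R a n p r I))"
  using assms
proof (induction "card V" arbitrary: V a rule: less_induct)
  case less
  interpret two_edge_connected_graph V a by fact
  show ?case
  proof (cases "V = R")
    case True
    show ?thesis
      by (rule exI[of _ a], use less.prems(1) in
        \<open>auto simp: True subdivides_def intro!: exI[of _ "\<lambda>_. []"]\<close>)
  next
    case False
    then obtain q where q: "q \<in> V - R" using less.prems(2) by blast
    have "card (insert q R) \<le> card V" using q less.prems(2) finite_V by (intro card_mono) auto
    moreover have "finite R" using less.prems(2) finite_V finite_subset by blast
    ultimately have "3 \<le> card V" using q less.prems(3) by auto
    then obtain u w where uw: "u \<in> V - {q}" "w \<in> V - {q}" "u \<noteq> w"
      and row: "\<And>t. t \<in> V \<Longrightarrow> a q t = of_bool (t = u) + of_bool (t = w)"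
      using degree_2_row[of q] q less.prems(4,5) by (metis DiffD1)
    let ?b = "\<lambda>s t. a s t + of_bool ({s, t} = {u, w})"
    have qV: "q \<in> V" using q by blast
    have sm: "two_edge_connected_graph (V - {q}) ?b"
      by (rule smooth_vertex(1)[OF qV uw]) (fact row)
    have deg: "degree (V - {q}) ?b v = degree V a v" if "v \<in> V - {q}" for v
      by (rule smooth_vertex(2)[OF qV uw _ that]) (fact row)
    have "card (V - {q}) < card V" using finite_V qV by (rule card_Diff1_less)
    note ih = less.hyps[OF this sm _ less.prems(3)]
    have "R \<subseteq> V - {q}" using q less.prems(2) by blast
    moreover have "degree (V - {q}) ?b v = 2" if "v \<in> V - {q} - R" for v
      using deg[of v] less.prems(4)[of v] that by simp
    moreover have "degree (V - {q}) ?b v \<le> 3" if "v \<in> V - {q}" for v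
      using deg[OF that] less.prems(5)[of v] that by simp
    ultimately obtain b where b: "two_edge_connected_graph R b"
      "\<forall>v\<in>R. degree R b v = degree (V - {q}) ?b v" "\<forall>s\<in>R. \<forall>t\<in>R. ?b s t \<le> b s t"
      and sub: "\<forall>n p r. (\<forall>i<n. p i \<in> R \<and> r i \<in> R) \<longrightarrow>
       (\<forall>s\<in>R. \<forall>t\<in>R. b s t = (\<Sum>i<n. of_bool ({s, t} = {p i, r i}))) \<longrightarrow>
       (\<exists>I. subdivides (V - {q}) R ?b n p r I)"
      using ih by (elim meta_impE exE conjE) blast+
    show ?thesis
    proof (intro exI[of _ b] conjI ballI allI impI)
      show "two_edge_connected_graph R b" by fact
      show "degree R b v = degree V a v" if "v \<in> R" for v
        using b(2) deg[of v] that q less.prems(2) by auto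
      show "a s t \<le> b s t" if "s \<in> R" "t \<in> R" for s t
      proof -
        have "a s t \<le> ?b s t" by simp
        also have "\<dots> \<le> b s t" using b(3) that by blast
        finally show ?thesis .
      qed
      fix n :: nat and p r assume pr: "\<forall>i<n. p i \<in> R \<and> r i \<in> R"
        "\<forall>s\<in>R. \<forall>t\<in>R. b s t = (\<Sum>i<n. of_bool ({s, t} = {p i, r i}))"
      \<comment> \<open>A list of the edges of \<open>b\<close> is first lifted to paths in the
        graph without \<open>q\<close>; then \<open>q\<close> is inserted into one of them.\<close>
      obtain I where "subdivides (V - {q}) R ?b n p r I" using sub pr by blast
      then show "\<exists>I. subdivides V R a n p r I"
        by (rule subdivides_insert) (use pr(1) less.prems(2) q uw nonneg row adj_sym[of _ q] in auto)
    qed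
  qed
qed


section \<open>Multigraphs and edge multiplicities\<close>

definition adj :: "('v, 'e) multigraph \<Rightarrow> 'v \<Rightarrow> 'v \<Rightarrow> int" where
  "adj G u v = int (card {e\<in>edges G. ends G e = {u, v}})"

lemma lookup_cmul_of: "Poly_Mapping.lookup (frag_cmul c (frag_of y)) v = c * pt y v"
  by (cases "v = y") (simp_all add: pt_def lookup_single when_def)

text \<open>The interface between named edges and multiplicities; \<open>G\<close>,
  \<open>B ls\<close> and \<open>Phi l\<close> all enter through it.\<close>

locale loopless_multigraph =
  fixes G :: "('v, 'e) multigraph"
  assumes finite_verts: "finite (verts G)" and finite_edges: "finite (edges G)"
    and ends_verts: "e \<in> edges G \<Longrightarrow> ends G e \<subseteq> verts G"
    and card_ends: "e \<in> edges G \<Longrightarrow> card (ends G e) = 2"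

sublocale loopless_multigraph \<subseteq> weighted_graph "verts G" "adj G"
proof
  show "finite (verts G)" by (rule finite_verts)
  show "0 \<le> adj G u v" for u v by (simp add: adj_def)
  show "adj G u v = adj G v u" for u v by (simp add: adj_def insert_commute)
  show "adj G v v = 0" for v
  proof -
    have "ends G e \<noteq> {v, v}" if "e \<in> edges G" for e using card_ends[OF that] by auto
    then have "{e\<in>edges G. ends G e = {v, v}} = {}" by blast
    then show ?thesis by (simp only: adj_def) simp
  qed
qed

lemma is_graph_loopless: "is_graph G \<Longrightarrow> loopless_multigraph G"
  unfolding is_graph_def by unfold_locales auto

context loopless_multigraph
begin

lemma other_end_eq:
  assumes "e \<in> edges G" "ends G e = {x, y}"
  shows "other_end G e x = y"
  unfolding other_end_def using assms by (intro the_equality) (auto simp: doubleton_eq_iff)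

lemma ends_other_end:
  assumes "e \<in> edges G" "x \<in> ends G e"
  shows "ends G e = {x, other_end G e x}"
proof -
  obtain p q where "ends G e = {p, q}" using card_ends[OF assms(1)] by (auto simp: card_2_iff)
  then have "ends G e = {x, p} \<or> ends G e = {x, q}" using assms(2) by auto
  then show ?thesis using other_end_eq[OF assms(1)] by metis
qed

text \<open>Grouping the edges at \<open>x\<close> by their far end turns sums over named edges into
  sums over vertices weighted by multiplicity.\<close>

lemma sum_incident:
  fixes F :: "'v \<Rightarrow> int"
  assumes "x \<in> verts G"
  shows "(\<Sum>e\<in>{e\<in>edges G. x \<in> ends G e}. F (other_end G e x)) = (\<Sum>u\<in>verts G. adj G x u * F u)"
proof -
  let ?I = "{e\<in>edges G. x \<in> ends G e}"
  have "(\<Sum>e\<in>?I. F (other_end G e x)) = (\<Sum>u\<in>verts G. \<Sum>e\<in>{e\<in>?I. other_end G e x = u}. F (other_end G e x))"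
  proof (rule sum.group[symmetric])
    show "(\<lambda>e. other_end G e x) ` ?I \<subseteq> verts G"
      using ends_other_end ends_verts by fastforce
  qed (use finite_verts finite_edges in auto)
  also have "\<dots> = (\<Sum>u\<in>verts G. adj G x u * F u)"
  proof (rule sum.cong[OF refl])
    fix u
    have "{e\<in>?I. other_end G e x = u} = {e\<in>edges G. ends G e = {x, u}}"
      using ends_other_end other_end_eq by blast
    moreover have "(\<Sum>e\<in>{e\<in>?I. other_end G e x = u}. F (other_end G e x))
      = (\<Sum>e\<in>{e\<in>?I. other_end G e x = u}. F u)" by (intro sum.cong) auto
    ultimately show "(\<Sum>e\<in>{e\<in>?I. other_end G e x = u}. F (other_end G e x)) = adj G x u * F u"
      by (simp add: adj_def)
  qed
  finally show ?thesis .
qed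

lemma lookup_principal:
  "Poly_Mapping.lookup (principal G f) v = (if v \<in> verts G then lap (verts G) (adj G) f v else 0)"
proof -
  have "Poly_Mapping.lookup (principal G f) v =
    (\<Sum>x\<in>verts G. \<Sum>e\<in>{e\<in>edges G. x \<in> ends G e}. (f x - f (other_end G e x)) * pt x v)"
    by (simp only: principal_def lookup_sum lookup_cmul_of)
  also have "\<dots> = (\<Sum>x\<in>verts G. if x = v then lap (verts G) (adj G) f x else 0)"
    by (intro sum.cong refl) (auto simp: sum_incident[of _ "\<lambda>u. f _ - f u"] lap_def pt_def)
  finally show ?thesis using finite_verts by (simp add: sum.delta)
qed

lemma divisors_iff: "D \<in> divisors G \<longleftrightarrow> (\<forall>v. v \<notin> verts G \<longrightarrow> Poly_Mapping.lookup D v = 0)"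
  unfolding divisors_def by (auto simp: in_keys_iff)

lemma deg_divisors: "D \<in> divisors G \<Longrightarrow> deg D = (\<Sum>v\<in>verts G. Poly_Mapping.lookup D v)"
  unfolding deg_def using finite_verts
  by (intro sum.mono_neutral_left) (auto simp: divisors_iff in_keys_iff)

lemma linear_system_nonempty:
  assumes "D \<in> divisors G"
  shows "linear_system G D \<noteq> {} \<longleftrightarrow> eff_equiv (verts G) (adj G) (Poly_Mapping.lookup D)"
proof
  assume "linear_system G D \<noteq> {}"
  then obtain E f where E: "effective E" "E - D = principal G f"
    by (auto simp: linear_system_def lin_equiv_def)
  have "Poly_Mapping.lookup E v - Poly_Mapping.lookup D v = lap (verts G) (adj G) f v" if "v \<in> verts G" for v
    using arg_cong[OF E(2), of "\<lambda>D. Poly_Mapping.lookup D v"] that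
    by (simp add: lookup_minus lookup_principal)
  then show "eff_equiv (verts G) (adj G) (Poly_Mapping.lookup D)"
    using E(1) unfolding eff_equiv_def effective_def
    by (intro exI[of _ f]) (metis add.commute diff_add_cancel)
next
  assume "eff_equiv (verts G) (adj G) (Poly_Mapping.lookup D)"
  then obtain f where f: "\<forall>v\<in>verts G. 0 \<le> Poly_Mapping.lookup D v + lap (verts G) (adj G) f v"
    unfolding eff_equiv_def by blast
  have "D + principal G f \<in> linear_system G D"
    using assms f by (auto simp: linear_system_def divisors_iff effective_def lin_equiv_def lookup_add lookup_principal)
  then show "linear_system G D \<noteq> {}" by blast
qed

lemma frag_cmul_of_divisors: "y \<in> verts G \<Longrightarrow> frag_cmul c (frag_of y) \<in> divisors G"
  by (auto simp: divisors_iff lookup_cmul_of pt_def)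

lemma diff_divisors: "D \<in> divisors G \<Longrightarrow> E \<in> divisors G \<Longrightarrow> D - E \<in> divisors G"
  by (simp add: divisors_iff lookup_minus)

lemma eff_equiv_mono:
  assumes "eff_equiv V a D" "\<And>v. v \<in> V \<Longrightarrow> D v \<le> D' v"
  shows "eff_equiv V a D'"
  by (rule eff_equiv_prin[OF assms(1) prin_zero]) (use assms(2) in simp)

text \<open>An effective divisor of degree 1 is a single vertex, which gives one direction. In the
  other the greatest \<open>k\<close> may exceed 1; it is tested on \<open>k (y)\<close>, and if
  \<open>k \<ge> 1\<close> chips can be removed from \<open>y\<close>, then so can one.\<close>

lemma rank_ge_1_iff:
  assumes D: "D \<in> divisors G" and ne: "verts G \<noteq> {}"
  shows "1 \<le> rank G D \<longleftrightarrow>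
    (\<forall>y\<in>verts G. eff_equiv (verts G) (adj G) (\<lambda>v. Poly_Mapping.lookup D v - pt y v))"
proof -
  let ?V = "verts G" and ?a = "adj G"
  define P where "P k \<longleftrightarrow> (\<forall>E\<in>divisors G. effective E \<and> deg E = int k \<longrightarrow> linear_system G (D - E) \<noteq> {})" for k
  have rank: "rank G D = (if linear_system G D = {} then - 1 else int (GREATEST k. P k))"
    by (simp add: rank_def P_def)
  have multiple: "eff_equiv ?V ?a (\<lambda>v. Poly_Mapping.lookup D v - int k * pt y v)" if "P k" "y \<in> ?V" for k y
  proof -
    let ?E = "frag_cmul (int k) (frag_of y)"
    have E: "?E \<in> divisors G" by (rule frag_cmul_of_divisors[OF that(2)])
    have "effective ?E" by (simp add: effective_def lookup_cmul_of pt_def)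
    moreover have "deg ?E = int k"
      using that(2) by (simp only: deg_divisors[OF E] lookup_cmul_of sum_distrib_left[symmetric] sum_pt[OF subset_refl]) simp
    ultimately have "linear_system G (D - ?E) \<noteq> {}" using that(1) E by (simp add: P_def)
    then show ?thesis
      using linear_system_nonempty[OF diff_divisors[OF D E]]
      by (simp only: eff_equiv_def lookup_minus lookup_cmul_of simp_thms)
  qed
  \<comment> \<open>Equivalent divisors have equal degree, so the admissible \<open>k\<close> are
    bounded and \<open>GREATEST\<close> is attained.\<close>
  have bound: "k \<le> nat (deg D)" if Pk: "P k" for k
  proof -
    obtain y where y: "y \<in> ?V" using ne by blast
    obtain E where E: "\<And>v. v \<in> ?V \<Longrightarrow> 0 \<le> E v"
      "prin ?V ?a (\<lambda>v. E v - (Poly_Mapping.lookup D v - int k * pt y v))"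
      using multiple[OF Pk y] by (rule eff_equivE) blast
    have "sum E ?V = deg D - int k"
      using prin_sum[OF E(2)] y
      by (simp add: deg_divisors[OF D] sum_subtractf sum_pt flip: sum_distrib_left)
    then show ?thesis using sum_nonneg[of ?V E] E(1) by simp
  qed
  have P1: "P 1 \<longleftrightarrow> (\<forall>y\<in>?V. eff_equiv ?V ?a (\<lambda>v. Poly_Mapping.lookup D v - pt y v))"
  proof
    assume "P 1"
    then show "\<forall>y\<in>?V. eff_equiv ?V ?a (\<lambda>v. Poly_Mapping.lookup D v - pt y v)"
      using multiple[of 1] by simp
  next
    assume R: "\<forall>y\<in>?V. eff_equiv ?V ?a (\<lambda>v. Poly_Mapping.lookup D v - pt y v)"
    show "P 1"
      unfolding P_def
    proof (intro ballI impI)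
      fix E assume E: "E \<in> divisors G" "effective E \<and> deg E = int 1"
      then have s: "(\<Sum>v\<in>?V. Poly_Mapping.lookup E v) = 1" using deg_divisors by simp
      have nn: "0 \<le> Poly_Mapping.lookup E v" for v using E by (simp add: effective_def)
      obtain y where y: "y \<in> ?V" "Poly_Mapping.lookup E y \<noteq> 0"
        using s by (metis sum.neutral zero_neq_one)
      have "(\<Sum>v\<in>?V. Poly_Mapping.lookup E v) = Poly_Mapping.lookup E y + (\<Sum>v\<in>?V - {y}. Poly_Mapping.lookup E v)"
        using finite_verts y(1) by (rule sum.remove)
      moreover have "0 \<le> (\<Sum>v\<in>?V - {y}. Poly_Mapping.lookup E v)" using nn by (intro sum_nonneg)
      ultimately have "Poly_Mapping.lookup E y = 1" "(\<Sum>v\<in>?V - {y}. Poly_Mapping.lookup E v) = 0"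
        using s y(2) nn[of y] by linarith+
      moreover from this(2) have "\<forall>v\<in>?V - {y}. Poly_Mapping.lookup E v = 0"
        using finite_verts nn by (subst (asm) sum_nonneg_eq_0_iff) auto
      ultimately have "Poly_Mapping.lookup E v = pt y v" if "v \<in> ?V" for v
        using that by (cases "v = y") (auto simp: pt_def)
      then have "eff_equiv ?V ?a (Poly_Mapping.lookup (D - E))"
        using R y(1) by (auto simp: lookup_minus eff_equiv_def)
      then show "linear_system G (D - E) \<noteq> {}"
        using linear_system_nonempty[OF diff_divisors[OF D E(1)]] by simp
    qed
  qed
  show ?thesis
  proof
    assume r: "1 \<le> rank G D"
    then have ls: "linear_system G D \<noteq> {}" and g: "1 \<le> (GREATEST k. P k)"
      by (auto simp: rank split: if_splits)
    have "P 0"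
      unfolding P_def
    proof (intro ballI impI)
      fix E assume E: "E \<in> divisors G" "effective E \<and> deg E = int 0"
      then have "\<forall>v\<in>?V. Poly_Mapping.lookup E v = 0"
        using finite_verts by (subst sum_nonneg_eq_0_iff[symmetric]) (auto simp: deg_divisors effective_def)
      then have "E = 0" using E(1) by (intro poly_mapping_eqI) (auto simp: divisors_iff)
      then show "linear_system G (D - E) \<noteq> {}" using ls by simp
    qed
    then have Pg: "P (GREATEST k. P k)" using bound by (rule GreatestI_nat)
    show "\<forall>y\<in>?V. eff_equiv ?V ?a (\<lambda>v. Poly_Mapping.lookup D v - pt y v)"
    proof
      fix y assume "y \<in> ?V"
      from multiple[OF Pg this] show "eff_equiv ?V ?a (\<lambda>v. Poly_Mapping.lookup D v - pt y v)"
        by (rule eff_equiv_mono) (use g in \<open>auto simp: pt_def\<close>)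
    qed
  next
    assume R: "\<forall>y\<in>?V. eff_equiv ?V ?a (\<lambda>v. Poly_Mapping.lookup D v - pt y v)"
    then have "1 \<le> (GREATEST k. P k)" using P1 bound by (intro Greatest_le_nat) auto
    moreover have "linear_system G D \<noteq> {}"
    proof -
      obtain y where "y \<in> ?V" using ne by blast
      with R have "eff_equiv ?V ?a (\<lambda>v. Poly_Mapping.lookup D v - pt y v)" by blast
      then have "eff_equiv ?V ?a (Poly_Mapping.lookup D)"
        by (rule eff_equiv_mono) (simp add: pt_def)
      then show ?thesis using linear_system_nonempty[OF D] by simp
    qed
    ultimately show "1 \<le> rank G D" by (simp add: rank)
  qed
qed

lemma weierstrass_point_iff: "weierstrass_point G x \<longleftrightarrow> wpt (verts G) (adj G) (genus G) x"
proof (cases "x \<in> verts G")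
  case True
  then show ?thesis
    using rank_ge_1_iff[OF frag_cmul_of_divisors[OF True]]
    by (auto simp: weierstrass_point_def wpt_def lookup_cmul_of simp del: lookup_frag_cmul)
qed (simp add: weierstrass_point_def wpt_def)

lemma degree_card: "x \<in> verts G \<Longrightarrow> degree (verts G) (adj G) x = int (card {e\<in>edges G. x \<in> ends G e})"
  using sum_incident[of x "\<lambda>_. 1"] by (simp add: degree_def)

text \<open>Double counting of incidences. The excess of the degrees over 2 is the budget that the
  case distinction on the genus distributes.\<close>

lemma sum_degree: "(\<Sum>x\<in>verts G. degree (verts G) (adj G) x - 2) = 2 * genus G - 2"
proof -
  have "(\<Sum>x\<in>verts G. degree (verts G) (adj G) x) = (\<Sum>x\<in>verts G. \<Sum>e\<in>{e\<in>edges G. x \<in> ends G e}. 1)"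
    by (intro sum.cong refl) (simp add: degree_card)
  also have "\<dots> = (\<Sum>e\<in>edges G. \<Sum>x\<in>{x\<in>verts G. x \<in> ends G e}. 1)"
    by (rule sum.swap_restrict[OF finite_verts finite_edges])
  also have "\<dots> = (\<Sum>e\<in>edges G. 2)"
  proof (rule sum.cong[OF refl])
    fix e assume e: "e \<in> edges G"
    then have "{x\<in>verts G. x \<in> ends G e} = ends G e" using ends_verts by blast
    then show "(\<Sum>x\<in>{x\<in>verts G. x \<in> ends G e}. 1) = (2::int)" using card_ends[OF e] by simp
  qed
  finally show ?thesis by (simp add: sum_subtractf genus_def)
qed

lemma indegree_ge:
  assumes "F \<subseteq> edges G" "\<And>e. e \<in> F \<Longrightarrow> \<exists>u\<in>U. ends G e = {v, u}" "U \<subseteq> verts G"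
  shows "int (card F) \<le> (\<Sum>u\<in>U. adj G v u)"
proof -
  have "finite U" using assms(3) finite_verts finite_subset by blast
  have "card F \<le> card (\<Union>u\<in>U. {e\<in>edges G. ends G e = {v, u}})"
    using assms(1,2) \<open>finite U\<close> finite_edges by (intro card_mono) auto
  also have "\<dots> \<le> (\<Sum>u\<in>U. card {e\<in>edges G. ends G e = {v, u}})"
    using \<open>finite U\<close> by (rule card_UN_le)
  finally show ?thesis unfolding adj_def of_nat_sum[symmetric] by (rule of_nat_mono)
qed

end

section \<open>Cuts and the involution obtained from the graph-theoretic hypotheses\<close>

lemma connected_crossing:
  assumes "connected_graph G" "x \<in> verts G" "x \<in> S" "y \<in> verts G" "y \<notin> S"
  obtains e u v where "e \<in> edges G" "ends G e = {u, v}" "u \<in> S" "v \<notin> S"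
proof -
  have "(x, y) \<in> (adjacency G)\<^sup>*" using assms by (simp add: connected_graph_def)
  then have "y \<notin> S \<longrightarrow> (\<exists>e\<in>edges G. \<exists>u v. ends G e = {u, v} \<and> u \<in> S \<and> v \<notin> S)"
    using assms(3) by (induction rule: rtrancl_induct) (auto simp: adjacency_def)
  then show thesis using that assms(5) by blast
qed

text \<open>Connectedness gives one crossing edge; connectedness after its deletion gives
  another.\<close>

lemma two_edge_connected_weighted:
  assumes "is_graph G" "two_edge_connected G"
  shows "two_edge_connected_graph (verts G) (adj G)"
proof -
  interpret loopless_multigraph G using assms(1) by (rule is_graph_loopless)
  show ?thesis
  proof
    fix S assume S: "S \<subseteq> verts G" "S \<noteq> {}" "S \<noteq> verts G"
    define C where "C = (\<Union>s\<in>S. \<Union>t\<in>verts G - S. {e\<in>edges G. ends G e = {s, t}})"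
    have crossing: "e \<in> C" if "e \<in> edges G" "ends G e = {u, v}" "u \<in> S" "v \<notin> S" for e u v
      using that ends_verts by (fastforce simp: C_def)
    obtain x y where xy: "x \<in> verts G" "x \<in> S" "y \<in> verts G" "y \<notin> S" using S by blast
    have "connected_graph G" using assms(1) by (simp add: is_graph_def)
    then obtain e where e: "e \<in> edges G" "e \<in> C" using xy crossing by (elim connected_crossing[of _ x S y]) auto
    have "connected_graph (delete_edge G e)" using assms(2) e by (simp add: two_edge_connected_def)
    then obtain e' where e': "e' \<in> edges G - {e}" "e' \<in> C"
      using xy crossing by (elim connected_crossing[of _ x S y]) (auto simp: delete_edge_def)
    have fS: "finite S" "finite (verts G - S)" using S finite_verts finite_subset by auto
    have "finite C" using finite_edges by (auto simp: C_def intro: finite_subset)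
    then have "2 \<le> card C" using e e' card_mono[of C "{e, e'}"] by auto
    also have "card C \<le> (\<Sum>s\<in>S. \<Sum>t\<in>verts G - S. card {e\<in>edges G. ends G e = {s, t}})"
      unfolding C_def by (intro order_trans[OF card_UN_le] sum_mono card_UN_le fS)
    finally have "int 2 \<le> int (\<Sum>s\<in>S. \<Sum>t\<in>verts G - S. card {e\<in>edges G. ends G e = {s, t}})"
      by (rule of_nat_mono)
    then show "2 \<le> cut (verts G) (adj G) S" by (simp only: cut_def adj_def of_nat_sum of_nat_numeral)
  qed
qed

text \<open>\<open>D - (y)\<close> is equivalent to an effective divisor of degree 1, a single
  vertex, which is taken as \<open>\<iota> y\<close>. Both \<open>(y) + (\<iota> y)\<close> and
  \<open>(\<iota> y) + (\<iota> (\<iota> y))\<close> are equivalent to \<open>D\<close>, so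
  \<open>y\<close> and \<open>\<iota> (\<iota> y)\<close> are equivalent and hence equal.\<close>

lemma hyperelliptic_involution:
  assumes "is_graph G" "two_edge_connected G" "hyperelliptic G"
  obtains \<iota> where "hyperelliptic_graph (verts G) (adj G) \<iota>"
proof -
  interpret loopless_multigraph G using assms(1) by (rule is_graph_loopless)
  interpret two_edge_connected_graph "verts G" "adj G"
    using assms by (intro two_edge_connected_weighted)
  let ?V = "verts G" and ?a = "adj G"
  have ne: "?V \<noteq> {}" using assms(1) by (simp add: is_graph_def connected_graph_def)
  obtain D where D: "D \<in> divisors G" "deg D = 2" "rank G D = 1"
    using assms(3) by (auto simp: hyperelliptic_def)
  let ?D = "Poly_Mapping.lookup D"
  have R: "eff_equiv ?V ?a (\<lambda>v. ?D v - pt y v)" if "y \<in> ?V" for y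
    using rank_ge_1_iff[OF D(1) ne] D(3) that by simp
  have "\<exists>z\<in>?V. prin ?V ?a (\<lambda>v. pt y v + pt z v - ?D v)" if y: "y \<in> ?V" for y
  proof -
    obtain E where E: "\<And>v. v \<in> ?V \<Longrightarrow> 0 \<le> E v" "prin ?V ?a (\<lambda>v. E v - (?D v - pt y v))"
      using R[OF y] by (rule eff_equivE) blast
    have s: "sum E ?V = 1"
      using prin_sum[OF E(2)] y D(2) deg_divisors[OF D(1)] by (simp add: sum_subtractf sum_pt)
    then obtain z where z: "z \<in> ?V" "E z \<noteq> 0" by (metis sum.neutral zero_neq_one)
    have "sum E ?V = E z + sum E (?V - {z})" using finite_verts z(1) by (rule sum.remove)
    moreover have "0 \<le> sum E (?V - {z})" using E(1) by (intro sum_nonneg) auto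
    ultimately have "E z = 1" "sum E (?V - {z}) = 0" using s z E(1)[OF z(1)] by linarith+
    moreover from this(2) have "\<forall>v\<in>?V - {z}. E v = 0"
      using finite_verts E(1) by (subst (asm) sum_nonneg_eq_0_iff) auto
    ultimately have "E v = pt z v" if "v \<in> ?V" for v using that by (cases "v = z") (auto simp: pt_def)
    then show ?thesis using z(1) by (intro bexI[of _ z] prin_cong[OF E(2)]) auto
  qed
  then obtain \<iota> where iota: "\<And>y. y \<in> ?V \<Longrightarrow> \<iota> y \<in> ?V"
    "\<And>y. y \<in> ?V \<Longrightarrow> prin ?V ?a (\<lambda>v. pt y v + pt (\<iota> y) v - ?D v)"
    by metis
  have "hyperelliptic_graph ?V ?a \<iota>"
  proof
    fix x assume x: "x \<in> ?V"
    show "\<iota> x \<in> ?V" using iota x by blast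
    have "prin ?V ?a (\<lambda>v. pt (\<iota> (\<iota> x)) v - pt x v)"
      by (rule prin_cong[OF prin_diff[OF iota(2)[OF iota(1)[OF x]] iota(2)[OF x]]]) simp
    then show "\<iota> (\<iota> x) = x" by (rule prin_pt_eq) (use iota x in auto)
    fix y assume y: "y \<in> ?V"
    show "prin ?V ?a (\<lambda>v. pt x v + pt (\<iota> x) v - (pt y v + pt (\<iota> y) v))"
      by (rule prin_cong[OF prin_diff[OF iota(2)[OF x] iota(2)[OF y]]]) simp
  qed
  then show thesis by (rule that)
qed

section \<open>Isomorphism expressed through multiplicities\<close>

lemma wpt_transport:
  assumes "wpt V a g x" and \<phi>: "bij_betw \<phi> V W"
    and "\<And>u v. u \<in> V \<Longrightarrow> v \<in> V \<Longrightarrow> b (\<phi> u) (\<phi> v) = a u v"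
  shows "wpt W b g (\<phi> x)"
  unfolding wpt_def
proof (intro conjI ballI)
  show "\<phi> x \<in> W" using assms(1) \<phi> by (auto simp: wpt_def bij_betw_def)
  fix y assume "y \<in> W"
  then obtain y' where y': "y' \<in> V" "y = \<phi> y'" using \<phi> by (auto simp: bij_betw_def)
  then obtain f where f: "\<forall>v\<in>V. 0 \<le> g * pt x v - pt y' v + lap V a f v"
    using assms(1) by (auto simp: wpt_def eff_equiv_def)
  let ?f = "\<lambda>w. f (the_inv_into V \<phi> w)"
  have inj: "inj_on \<phi> V" using \<phi> by (simp add: bij_betw_def)
  have "0 \<le> g * pt (\<phi> x) w - pt y w + lap W b ?f w" if w: "w \<in> W" for w
  proof -
    obtain v where v: "v \<in> V" "w = \<phi> v" using w \<phi> by (auto simp: bij_betw_def)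
    have "lap W b ?f w = (\<Sum>u\<in>V. b w (\<phi> u) * (?f w - ?f (\<phi> u)))"
      unfolding lap_def by (rule sum.reindex_bij_betw[symmetric, OF \<phi>])
    also have "\<dots> = lap V a f v"
      unfolding lap_def using v assms(3) the_inv_into_f_f[OF inj] by (intro sum.cong) auto
    finally have "lap W b ?f w = lap V a f v" .
    moreover have "pt (\<phi> x) w = pt x v" "pt y w = pt y' v"
      using v y' inj assms(1) by (auto simp: pt_def wpt_def inj_on_eq_iff)
    ultimately show ?thesis using f v by auto
  qed
  then show "eff_equiv W b (\<lambda>v. g * pt (\<phi> x) v - pt y v)"
    unfolding eff_equiv_def by blast
qed

lemma adj_isomorphism:
  assumes \<phi>: "bij_betw \<phi> (verts G) (verts H)" and \<psi>: "bij_betw \<psi> (edges G) (edges H)"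
    and ends: "\<And>e. e \<in> edges G \<Longrightarrow> ends H (\<psi> e) = \<phi> ` ends G e"
    and ends_verts: "\<And>e. e \<in> edges G \<Longrightarrow> ends G e \<subseteq> verts G"
    and uv: "u \<in> verts G" "v \<in> verts G"
  shows "adj H (\<phi> u) (\<phi> v) = adj G u v"
proof -
  have iff: "ends H (\<psi> e) = {\<phi> u, \<phi> v} \<longleftrightarrow> ends G e = {u, v}" if "e \<in> edges G" for e
    using ends[OF that] ends_verts[OF that] uv
      inj_on_image_eq_iff[of \<phi> "verts G" "ends G e" "{u, v}"] \<phi> by (simp add: bij_betw_def)
  have "{e\<in>edges H. ends H e = {\<phi> u, \<phi> v}} = \<psi> ` {e\<in>edges G. ends G e = {u, v}}"
  proof (intro Set.equalityI subsetI)
    fix e' assume "e' \<in> {e\<in>edges H. ends H e = {\<phi> u, \<phi> v}}"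
    moreover from this obtain e where "e \<in> edges G" "e' = \<psi> e" using \<psi> by (auto simp: bij_betw_def)
    ultimately show "e' \<in> \<psi> ` {e\<in>edges G. ends G e = {u, v}}" using iff by blast
  qed (use \<psi> iff in \<open>auto simp: bij_betw_def\<close>)
  moreover have "inj_on \<psi> {e\<in>edges G. ends G e = {u, v}}"
    using \<psi> by (auto simp: bij_betw_def intro: inj_on_subset)
  ultimately show ?thesis by (simp add: adj_def card_image)
qed

lemma isomorphicD:
  assumes "isomorphic G H" "\<And>e. e \<in> edges G \<Longrightarrow> ends G e \<subseteq> verts G"
  obtains \<phi> where "bij_betw \<phi> (verts G) (verts H)"
    "\<And>u v. u \<in> verts G \<Longrightarrow> v \<in> verts G \<Longrightarrow> adj H (\<phi> u) (\<phi> v) = adj G u v" "genus H = genus G"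
proof -
  obtain \<phi> \<psi> where iso: "bij_betw \<phi> (verts G) (verts H)" "bij_betw \<psi> (edges G) (edges H)"
    "\<And>e. e \<in> edges G \<Longrightarrow> ends H (\<psi> e) = \<phi> ` ends G e"
    using assms(1) by (auto simp: isomorphic_def)
  have "genus H = genus G"
    using bij_betw_same_card[OF iso(1)] bij_betw_same_card[OF iso(2)] by (simp add: genus_def)
  then show thesis using that[OF iso(1)] adj_isomorphism[OF iso] assms(2) by blast
qed

lemma bij_betw_fibres:
  assumes "finite A" "finite C" "\<And>c. card {x\<in>A. f x = c} = card {y\<in>C. h y = c}"
  shows "\<exists>\<psi>. bij_betw \<psi> A C \<and> (\<forall>x\<in>A. h (\<psi> x) = f x)"
proof -
  have "\<exists>\<psi>. bij_betw \<psi> {x\<in>A. f x = c} {y\<in>C. h y = c}" for c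
    using assms by (intro finite_same_card_bij) auto
  then obtain \<psi> where \<psi>: "\<And>c. bij_betw (\<psi> c) {x\<in>A. f x = c} {y\<in>C. h y = c}" by metis
  define \<chi> where "\<chi> x = \<psi> (f x) x" for x
  have mem: "\<chi> x \<in> C" "h (\<chi> x) = f x" if "x \<in> A" for x
    using \<psi>[of "f x"] that by (auto simp: \<chi>_def bij_betw_def)
  have "inj_on \<chi> A"
  proof (rule inj_onI)
    fix x y assume xy: "x \<in> A" "y \<in> A" "\<chi> x = \<chi> y"
    then have "f x = f y" using mem by metis
    then show "x = y" using \<psi>[of "f x"] xy by (auto simp: \<chi>_def bij_betw_def inj_on_def)
  qed
  moreover have "C \<subseteq> \<chi> ` A"
  proof
    fix y assume "y \<in> C"
    then have "y \<in> \<psi> (h y) ` {x\<in>A. f x = h y}" using \<psi>[of "h y"] by (auto simp: bij_betw_def)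
    then obtain x where x: "x \<in> A" "f x = h y" "y = \<psi> (h y) x" by blast
    then have "y = \<chi> x" by (simp add: \<chi>_def)
    then show "y \<in> \<chi> ` A" using x(1) by blast
  qed
  ultimately show ?thesis using mem by (intro exI[of _ \<chi>]) (auto simp: bij_betw_def)
qed

text \<open>Parallel edges are interchangeable, so equal multiplicities allow an arbitrary matching
  within each class of edges with the same ends. The map goes from \<open>H\<close> to
  \<open>G\<close> because in the applications \<open>H\<close> is concrete and
  \<open>\<phi>\<close> is defined by cases on its vertices.\<close>

lemma isomorphicI:
  assumes "loopless_multigraph G" "loopless_multigraph H" "bij_betw \<phi> (verts H) (verts G)"
    "\<And>u v. u \<in> verts H \<Longrightarrow> v \<in> verts H \<Longrightarrow> adj G (\<phi> u) (\<phi> v) = adj H u v"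
  shows "isomorphic G H"
proof -
  interpret G: loopless_multigraph G by fact
  interpret H: loopless_multigraph H by fact
  let ?\<theta> = "the_inv_into (verts H) \<phi>"
  have \<theta>: "bij_betw ?\<theta> (verts G) (verts H)" using assms(3) by (rule bij_betw_the_inv_into)
  have adj_\<theta>: "adj H (?\<theta> u) (?\<theta> v) = adj G u v" if "u \<in> verts G" "v \<in> verts G" for u v
  proof -
    have "?\<theta> u \<in> verts H" "?\<theta> v \<in> verts H" using \<theta> that by (auto simp: bij_betw_def)
    moreover have "\<phi> (?\<theta> u) = u" "\<phi> (?\<theta> v) = v"
      using assms(3) that f_the_inv_into_f_bij_betw by metis+
    ultimately show ?thesis using assms(4) by metis
  qed
  have inj: "inj_on ?\<theta> (verts G)" using \<theta> by (simp add: bij_betw_def)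
  have "card {e\<in>edges G. ?\<theta> ` ends G e = c} = card {e\<in>edges H. ends H e = c}" for c
  proof (cases "\<exists>u\<in>verts G. \<exists>v\<in>verts G. c = {?\<theta> u, ?\<theta> v}")
    case True
    then obtain u v where uv: "u \<in> verts G" "v \<in> verts G" "c = {?\<theta> u, ?\<theta> v}" by blast
    have "{e\<in>edges G. ?\<theta> ` ends G e = c} = {e\<in>edges G. ends G e = {u, v}}"
    proof (rule Collect_cong, rule conj_cong[OF refl])
      fix e assume "e \<in> edges G"
      then show "?\<theta> ` ends G e = c \<longleftrightarrow> ends G e = {u, v}"
        using inj_on_image_eq_iff[OF inj G.ends_verts, of e "{u, v}"] uv by simp
    qed
    then show ?thesis using adj_\<theta>[OF uv(1,2)] uv(3) by (simp add: adj_def)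
  next
    case False
    \<comment> \<open>Here \<open>c\<close> is not the image of a pair of vertices, so it is the end
      set of no edge on either side.\<close>
    have "{e\<in>edges G. ?\<theta> ` ends G e = c} = {}"
    proof -
      have "?\<theta> ` ends G e \<noteq> c" if e: "e \<in> edges G" for e
      proof
        assume c: "?\<theta> ` ends G e = c"
        obtain u v where "ends G e = {u, v}" using G.card_ends[OF e] by (auto simp: card_2_iff)
        then show False using False c G.ends_verts[OF e] by auto
      qed
      then show ?thesis by blast
    qed
    moreover have "{e\<in>edges H. ends H e = c} = {}"
    proof -
      have "ends H e \<noteq> c" if e: "e \<in> edges H" for e
      proof
        assume c: "ends H e = c"
        obtain u v where uv: "ends H e = {u, v}" using H.card_ends[OF e] by (auto simp: card_2_iff)
        then have "u \<in> ?\<theta> ` verts G" "v \<in> ?\<theta> ` verts G"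
          using H.ends_verts[OF e] \<theta> by (auto simp: bij_betw_def)
        then show False using False c uv by blast
      qed
      then show ?thesis by blast
    qed
    ultimately show ?thesis by (simp only: card.empty)
  qed
  from bij_betw_fibres[OF G.finite_edges H.finite_edges this]
  show ?thesis using \<theta> unfolding isomorphic_def by blast
qed


section \<open>Recognising the graphs of the classification\<close>

lemma edges_B: "edges (B ls) = (SIGMA i:{..<length ls}. {..<ls ! i})"
  by (auto simp: B_def)

lemma loopless_B: "loopless_multigraph (B ls)"
proof
  have "{Inner i j |i j. i < length ls \<and> 0 < j \<and> j < ls ! i} \<subseteq> case_prod Inner ` edges (B ls)"
    by (auto simp: edges_B image_iff Bex_def)
  moreover show "finite (edges (B ls))" by (simp add: edges_B)
  ultimately show "finite (verts (B ls))" by (simp add: B_def finite_subset)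
  fix e assume "e \<in> edges (B ls)"
  then show "ends (B ls) e \<subseteq> verts (B ls)" "card (ends (B ls) e) = 2"
    by (auto simp: B_def banana_vertex_at_def split: if_splits)
qed

lemma loopless_Phi: "loopless_multigraph (Phi l)"
  by unfold_locales (auto simp: Phi_def split: phi_edge.splits)

lemma adj_B:
  "adj (B ls) u v = (\<Sum>i<length ls. int (card {j. j < ls ! i \<and>
     {banana_vertex_at ls i j, banana_vertex_at ls i (Suc j)} = {u, v}}))"
proof -
  have "{e\<in>edges (B ls). ends (B ls) e = {u, v}} = (SIGMA i:{..<length ls}. {j. j < ls ! i \<and>
     {banana_vertex_at ls i j, banana_vertex_at ls i (Suc j)} = {u, v}})"
    by (auto simp: B_def)
  then show ?thesis by (simp add: adj_def card_SigmaI)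
qed

lemma adj_Phi:
  "adj (Phi l) u v = 2 * of_bool ({u, v} = {X 0, Y 0}) + 2 * of_bool ({u, v} = {X l, Y l})
     + int (card {j. j < l \<and> {X j, X (Suc j)} = {u, v}}) + int (card {j. j < l \<and> {Y j, Y (Suc j)} = {u, v}})"
proof -
  define p where "p = {u, v}"
  define A where "A = {j. j < l \<and> {X j, X (Suc j)} = p}"
  define C where "C = {j. j < l \<and> {Y j, Y (Suc j)} = p}"
  define S where "S = (if p = {X 0, Y 0} then range Start else {})"
  define F where "F = (if p = {X l, Y l} then range Finish else {})"
  have E: "{e\<in>edges (Phi l). ends (Phi l) e = p} = X_step ` A \<union> (Y_step ` C \<union> (S \<union> F))"
  proof (rule Set.set_eqI)
    fix e
    have "{X 0, Y 0} = p \<longleftrightarrow> p = {X 0, Y 0}" "{X l, Y l} = p \<longleftrightarrow> p = {X l, Y l}"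
      by (rule eq_commute)+
    then show "e \<in> {e\<in>edges (Phi l). ends (Phi l) e = p} \<longleftrightarrow> e \<in> X_step ` A \<union> (Y_step ` C \<union> (S \<union> F))"
      by (cases e) (simp_all add: Phi_def image_iff A_def C_def S_def F_def)
  qed
  have fin: "finite A" "finite C" "finite S" "finite F" by (simp_all add: A_def C_def S_def F_def)
  have SF: "S \<subseteq> range Start" "F \<subseteq> range Finish" by (simp_all add: S_def F_def)
  have "card (S \<union> F) = card S + card F"
    using fin SF by (intro card_Un_disjoint) auto
  moreover have "card (Y_step ` C \<union> (S \<union> F)) = card (Y_step ` C) + card (S \<union> F)"
    using fin SF by (intro card_Un_disjoint) auto
  moreover have "card (X_step ` A \<union> (Y_step ` C \<union> (S \<union> F))) = card (X_step ` A) + card (Y_step ` C \<union> (S \<union> F))"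
    using fin SF by (intro card_Un_disjoint) auto
  moreover have "card (X_step ` A) = card A" "card (Y_step ` C) = card C"
    by (intro card_image inj_onI; simp)+
  moreover have "card (range Start) = 2" "card (range Finish) = 2"
    by (simp_all add: card_image inj_on_def)
  then have "card S = 2 * of_bool (p = {X 0, Y 0})" "card F = 2 * of_bool (p = {X l, Y l})"
    by (simp_all add: S_def F_def)
  ultimately have "int (card {e\<in>edges (Phi l). ends (Phi l) e = p}) =
      2 * of_bool (p = {X 0, Y 0}) + 2 * of_bool (p = {X l, Y l}) + int (card A) + int (card C)"
    unfolding E by simp
  then show ?thesis unfolding adj_def A_def C_def p_def .
qed

lemma subdivides_isomorphic_B:
  fixes G :: "('v, 'e) multigraph"
  assumes G: "loopless_multigraph G" and xy: "x \<in> verts G" "y \<in> verts G" "x \<noteq> y"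
    and S: "subdivides (verts G) {x, y} (adj G) n (\<lambda>_. x) (\<lambda>_. y) I"
  shows "isomorphic G (B (map (\<lambda>i. length (I i) + 1) [0..<n]))"
proof -
  define ls where "ls = map (\<lambda>i. length (I i) + 1) [0..<n]"
  have len: "length ls = n" "\<And>i. i < n \<Longrightarrow> ls ! i = length (I i) + 1" by (simp_all add: ls_def)
  have adj_G: "\<And>s t. s \<in> verts G \<Longrightarrow> t \<in> verts G \<Longrightarrow> adj G s t = (\<Sum>i<n. path_adj x (I i) y s t)"
    and dist: "\<And>i. i < n \<Longrightarrow> distinct (I i)"
    and disj: "\<And>i j. i < n \<Longrightarrow> j < n \<Longrightarrow> i \<noteq> j \<Longrightarrow> set (I i) \<inter> set (I j) = {}"
    and un: "(\<Union>i<n. set (I i)) = verts G - {x, y}"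
    using S by (auto simp: subdivides_def)
  \<comment> \<open>Position 0 of a path is the pole, so \<open>Inner i j\<close> is entry
    \<open>j - 1\<close> of the list of inner vertices; a list of \<open>k\<close> inner vertices
    makes a path of \<open>k + 1\<close> edges.\<close>
  define \<phi> where "\<phi> b = (case b of Pole_x \<Rightarrow> x | Pole_y \<Rightarrow> y | Inner i j \<Rightarrow> I i ! (j - 1))" for b
  have verts: "verts (B ls) = {Pole_x, Pole_y} \<union> {Inner i j |i j. i < n \<and> 0 < j \<and> j \<le> length (I i)}"
    using len by (auto simp: B_def)
  have inner: "I i ! (j - 1) \<in> set (I i)" "I i ! (j - 1) \<in> verts G - {x, y}"
    if "i < n" "0 < j" "j \<le> length (I i)" for i j
  proof -
    show "I i ! (j - 1) \<in> set (I i)" using that by simp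
    then show "I i ! (j - 1) \<in> verts G - {x, y}" using un that by blast
  qed
  have inner_inj: "i = i' \<and> j = j'" if "i < n" "0 < j" "j \<le> length (I i)"
    "i' < n" "0 < j'" "j' \<le> length (I i')" "I i ! (j - 1) = I i' ! (j' - 1)" for i j i' j'
  proof -
    have "I i ! (j - 1) \<in> set (I i) \<inter> set (I i')"
      using inner(1)[OF that(1-3)] inner(1)[OF that(4-6)] that(7) by simp
    then have "i = i'" using disj[OF that(1,4)] by blast
    then show ?thesis using nth_eq_iff_index_eq[OF dist[OF that(1)], of "j - 1" "j' - 1"] that by auto
  qed
  have \<phi>: "bij_betw \<phi> (verts (B ls)) (verts G)"
    unfolding bij_betw_def
  proof
    show inj: "inj_on \<phi> (verts (B ls))"
    proof (rule inj_onI)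
      fix b c assume "b \<in> verts (B ls)" "c \<in> verts (B ls)" "\<phi> b = \<phi> c"
      then show "b = c"
        unfolding verts using xy(3) inner(2) inner_inj
        by (cases b; cases c) (auto simp: \<phi>_def; metis DiffE insertCI)+
    qed
    show "\<phi> ` verts (B ls) = verts G"
    proof (intro Set.equalityI subsetI)
      fix v assume "v \<in> \<phi> ` verts (B ls)"
      then show "v \<in> verts G" unfolding verts using xy inner(2) by (auto simp: \<phi>_def)
    next
      fix v assume v: "v \<in> verts G"
      show "v \<in> \<phi> ` verts (B ls)"
      proof (cases "v = x \<or> v = y")
        case True
        then show ?thesis unfolding verts by (auto simp: \<phi>_def image_iff)
      next
        case False
        then obtain i where i: "i < n" "v \<in> set (I i)" using un v by blast
        then obtain j where "j < length (I i)" "I i ! j = v" by (auto simp: in_set_conv_nth)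
        then have "Inner i (Suc j) \<in> verts (B ls)" "v = \<phi> (Inner i (Suc j))"
          using i by (auto simp: verts \<phi>_def)
        then show ?thesis by blast
      qed
    qed
  qed
  have \<phi>_at: "\<phi> (banana_vertex_at ls i j) = (x # I i @ [y]) ! j" if "i < n" "j \<le> ls ! i" for i j
    using that len by (auto simp: banana_vertex_at_def \<phi>_def nth_append nth_Cons')
  have at_verts: "banana_vertex_at ls i j \<in> verts (B ls)" if "i < n" "j \<le> ls ! i" for i j
    using that len by (auto simp: banana_vertex_at_def verts)
  have "adj G (\<phi> u) (\<phi> v) = adj (B ls) u v" if u: "u \<in> verts (B ls)" and v: "v \<in> verts (B ls)" for u v
  proof -
    have "\<phi> u \<in> verts G" "\<phi> v \<in> verts G" using \<phi> u v by (auto simp: bij_betw_def)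
    then have "adj G (\<phi> u) (\<phi> v) = (\<Sum>i<n. path_adj x (I i) y (\<phi> u) (\<phi> v))" by (rule adj_G)
    also have "\<dots> = (\<Sum>i<length ls. int (card {j. j < ls ! i \<and>
        {banana_vertex_at ls i j, banana_vertex_at ls i (Suc j)} = {u, v}}))"
      unfolding path_adj_card
    proof (rule sum.cong)
      fix i assume "i \<in> {..<length ls}"
      then have i: "i < n" using len by simp
      have "{j. j \<le> length (I i) \<and> {(x # I i @ [y]) ! j, (x # I i @ [y]) ! Suc j} = {\<phi> u, \<phi> v}}
        = {j. j < ls ! i \<and> {banana_vertex_at ls i j, banana_vertex_at ls i (Suc j)} = {u, v}}"
      proof (rule Collect_cong, rule conj_cong)
        fix j assume j: "j < ls ! i"
        let ?E = "{banana_vertex_at ls i j, banana_vertex_at ls i (Suc j)}"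
        have "{(x # I i @ [y]) ! j, (x # I i @ [y]) ! Suc j} = \<phi> ` ?E"
          using \<phi>_at[OF i, of j] \<phi>_at[OF i, of "Suc j"] j by simp
        moreover have "\<phi> ` ?E = \<phi> ` {u, v} \<longleftrightarrow> ?E = {u, v}"
          using at_verts[OF i, of j] at_verts[OF i, of "Suc j"] j u v \<phi>
          by (intro inj_on_image_eq_iff[of \<phi> "verts (B ls)"]) (auto simp: bij_betw_def)
        ultimately show "{(x # I i @ [y]) ! j, (x # I i @ [y]) ! Suc j} = {\<phi> u, \<phi> v} \<longleftrightarrow> ?E = {u, v}"
          by simp
      qed (use len i in auto)
      then show "int (card {j. j \<le> length (I i) \<and> {(x # I i @ [y]) ! j, (x # I i @ [y]) ! Suc j} = {\<phi> u, \<phi> v}})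
        = int (card {j. j < ls ! i \<and> {banana_vertex_at ls i j, banana_vertex_at ls i (Suc j)} = {u, v}})"
        by (simp only:)
    qed (simp add: len)
    also have "\<dots> = adj (B ls) u v" by (simp only: adj_B)
    finally show ?thesis .
  qed
  from isomorphicI[OF G loopless_B \<phi> this] show ?thesis by (simp only: ls_def)
qed

lemma isomorphic_Phi:
  fixes G :: "('v, 'e) multigraph"
  assumes G: "loopless_multigraph G" and len: "length P = length Q"
    and dist: "distinct ((v # P @ [y]) @ (w # Q @ [z]))"
    and set: "set ((v # P @ [y]) @ (w # Q @ [z])) = verts G"
    and adj: "\<And>s t. s \<in> verts G \<Longrightarrow> t \<in> verts G \<Longrightarrow> adj G s t =
      2 * of_bool ({s, t} = {v, w}) + 2 * of_bool ({s, t} = {y, z}) + path_adj v P y s t + path_adj w Q z s t"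
  shows "isomorphic G (Phi (length P + 1))"
proof -
  define l where "l = length P + 1"
  let ?L = "v # P @ [y]" and ?M = "w # Q @ [z]"
  define \<phi> where "\<phi> b = (case b of X j \<Rightarrow> ?L ! j | Y j \<Rightarrow> ?M ! j)" for b
  have L: "length ?L = Suc l" "length ?M = Suc l" using len by (simp_all add: l_def)
  have verts: "verts (Phi l) = X ` {..l} \<union> Y ` {..l}" by (simp add: Phi_def)
  have dL: "distinct ?L" "distinct ?M" "set ?L \<inter> set ?M = {}" using dist by auto
  have \<phi>X: "\<phi> (X j) = ?L ! j" "\<phi> (Y j) = ?M ! j" for j by (simp_all only: \<phi>_def phi_vertex.case)
  have memL: "?L ! j \<in> set ?L" "?M ! j \<in> set ?M" if "j \<le> l" for j
    using nth_mem[of j ?L] nth_mem[of j ?M] L that by (metis less_Suc_eq_le)+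
  have inj: "inj_on \<phi> (verts (Phi l))"
  proof (rule inj_onI)
    fix b c assume bc: "b \<in> verts (Phi l)" "c \<in> verts (Phi l)" "\<phi> b = \<phi> c"
    then consider (XX) i j where "b = X i" "c = X j" "i \<le> l" "j \<le> l"
      | (YY) i j where "b = Y i" "c = Y j" "i \<le> l" "j \<le> l"
      | (XY) i j where "b = X i" "c = Y j" "i \<le> l" "j \<le> l"
      | (YX) i j where "b = Y i" "c = X j" "i \<le> l" "j \<le> l"
      unfolding verts by blast
    then show "b = c"
    proof cases
      case XX
      then have "i < Suc l" "j < Suc l" by simp_all
      then show ?thesis using bc(3) nth_eq_iff_index_eq[OF dL(1), of i j] unfolding XX(1,2) \<phi>X L by blast
    next
      case YY
      then have "i < Suc l" "j < Suc l" by simp_all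
      then show ?thesis using bc(3) nth_eq_iff_index_eq[OF dL(2), of i j] unfolding YY(1,2) \<phi>X L by blast
    next
      case XY
      have "?L ! i = ?M ! j" using bc(3) unfolding XY(1,2) \<phi>X .
      then show ?thesis using memL(1)[OF XY(3)] memL(2)[OF XY(4)] dL(3) by (simp only: disjoint_iff)
    next
      case YX
      have "?M ! i = ?L ! j" using bc(3) unfolding YX(1,2) \<phi>X .
      then show ?thesis using memL(1)[OF YX(4)] memL(2)[OF YX(3)] dL(3) by (simp only: disjoint_iff)
    qed
  qed
  have "\<phi> ` verts (Phi l) = set ?L \<union> set ?M"
  proof -
    have "\<phi> ` verts (Phi l) = (\<lambda>j. ?L ! j) ` {..<Suc l} \<union> (\<lambda>j. ?M ! j) ` {..<Suc l}"
      unfolding verts image_Un image_image \<phi>X lessThan_Suc_atMost ..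
    also have "(\<lambda>j. ?L ! j) ` {..<Suc l} = set ?L"
      unfolding L(1)[symmetric] set_conv_nth by blast
    also have "(\<lambda>j. ?M ! j) ` {..<Suc l} = set ?M"
      unfolding L(2)[symmetric] set_conv_nth by blast
    finally show ?thesis .
  qed
  then have \<phi>: "bij_betw \<phi> (verts (Phi l)) (verts G)"
    using inj set by (simp only: bij_betw_def set_append)
  have "adj G (\<phi> b) (\<phi> c) = adj (Phi l) b c" if b: "b \<in> verts (Phi l)" and c: "c \<in> verts (Phi l)" for b c
  proof -
    have inV: "\<phi> b \<in> verts G" "\<phi> c \<in> verts G" using \<phi> b c by (auto simp: bij_betw_def)
    have eq: "{\<phi> p, \<phi> q} = {\<phi> b, \<phi> c} \<longleftrightarrow> {p, q} = {b, c}" if "p \<in> verts (Phi l)" "q \<in> verts (Phi l)" for p q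
      using inj_on_image_eq_iff[OF inj, of "{p, q}" "{b, c}"] that b c by simp
    have ends: "v = \<phi> (X 0)" "w = \<phi> (Y 0)" "y = \<phi> (X l)" "z = \<phi> (Y l)"
      using len by (simp_all add: \<phi>X l_def nth_append)
    have mem: "X j \<in> verts (Phi l)" "Y j \<in> verts (Phi l)" if "j \<le> l" for j using that by (auto simp: verts)
    have 1: "{\<phi> b, \<phi> c} = {v, w} \<longleftrightarrow> {b, c} = {X 0, Y 0}" "{\<phi> b, \<phi> c} = {y, z} \<longleftrightarrow> {b, c} = {X l, Y l}"
      unfolding ends using eq[OF mem(1) mem(2)] by (metis le0 order_refl)+
    have 2: "{j. j \<le> length P \<and> {?L ! j, ?L ! Suc j} = {\<phi> b, \<phi> c}} = {j. j < l \<and> {X j, X (Suc j)} = {b, c}}"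
    proof (rule Collect_cong, rule conj_cong)
      fix j assume "j < l"
      then show "{?L ! j, ?L ! Suc j} = {\<phi> b, \<phi> c} \<longleftrightarrow> {X j, X (Suc j)} = {b, c}"
        using eq[OF mem(1) mem(1), of j "Suc j"] unfolding \<phi>X by simp
    qed (auto simp: l_def)
    have 3: "{j. j \<le> length Q \<and> {?M ! j, ?M ! Suc j} = {\<phi> b, \<phi> c}} = {j. j < l \<and> {Y j, Y (Suc j)} = {b, c}}"
    proof (rule Collect_cong, rule conj_cong)
      fix j assume "j < l"
      then show "{?M ! j, ?M ! Suc j} = {\<phi> b, \<phi> c} \<longleftrightarrow> {Y j, Y (Suc j)} = {b, c}"
        using eq[OF mem(2) mem(2), of j "Suc j"] unfolding \<phi>X by simp
    qed (auto simp: l_def len)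
    show ?thesis unfolding adj[OF inV] adj_Phi path_adj_card 1 2 3 ..
  qed
  from isomorphicI[OF G loopless_Phi \<phi> this] show ?thesis by (simp only: l_def)
qed


section \<open>Paths of degree 2 vertices\<close>

context weighted_graph
begin

lemma row_degree_2:
  assumes "s \<in> V" "t \<in> V" "s \<noteq> t" "0 < a q s" "0 < a q t" "degree V a q = 2" "v \<in> V"
  shows "a q v = pt s v + pt t v"
proof -
  have 1: "degree V a q = a q s + (\<Sum>v\<in>V - {s}. a q v)"
    unfolding degree_def using finite_V assms(1) by (rule sum.remove)
  have 2: "(\<Sum>v\<in>V - {s}. a q v) = a q t + (\<Sum>v\<in>V - {s} - {t}. a q v)"
    using finite_V assms(2,3) by (intro sum.remove) auto
  have "0 \<le> (\<Sum>v\<in>V - {s} - {t}. a q v)" by (intro sum_nonneg) (simp add: nonneg)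
  then have 3: "a q s = 1" "a q t = 1" "(\<Sum>v\<in>V - {s} - {t}. a q v) = 0"
    using 1 2 assms(4-6) by linarith+
  then have "\<forall>v\<in>V - {s} - {t}. a q v = 0"
    using finite_V by (subst (asm) sum_nonneg_eq_0_iff) (auto simp: nonneg)
  then show ?thesis using 3 assms(3,7) by (cases "v = s"; cases "v = t") (auto simp: pt_def)
qed

lemma row_path:
  assumes "distinct L" "set L \<subseteq> V" "\<And>j. Suc j < length L \<Longrightarrow> 0 < a (L ! j) (L ! Suc j)"
    "\<And>j. 0 < j \<Longrightarrow> Suc j < length L \<Longrightarrow> degree V a (L ! j) = 2"
    and j: "0 < j" "Suc j < length L" and v: "v \<in> V"
  shows "a (L ! j) v = pt (L ! (j - 1)) v + pt (L ! Suc j) v"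
proof (rule row_degree_2)
  have "j - 1 < length L" "Suc j < length L" using j by auto
  then show "L ! (j - 1) \<in> V" "L ! Suc j \<in> V" using assms(2) nth_mem by blast+
  show "L ! (j - 1) \<noteq> L ! Suc j" using assms(1) j by (simp add: nth_eq_iff_index_eq)
  show "0 < a (L ! j) (L ! (j - 1))" using assms(3)[of "j - 1"] j adj_sym[of "L ! j"] by simp
  show "0 < a (L ! j) (L ! Suc j)" "degree V a (L ! j) = 2" using assms(3,4) j by auto
qed (fact v)

lemma subdivides_path:
  assumes S: "subdivides V R a n p r I" and i: "i < n" and ends: "p i \<in> R" "r i \<in> R" "p i \<noteq> r i"
    and R: "R \<subseteq> V"
  defines "L \<equiv> p i # I i @ [r i]"
  shows "distinct L" "set L \<subseteq> V" "Suc j < length L \<Longrightarrow> 0 < a (L ! j) (L ! Suc j)"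
    "0 < j \<Longrightarrow> Suc j < length L \<Longrightarrow> L ! j \<in> V - R"
proof -
  have adj: "\<And>s t. s \<in> V \<Longrightarrow> t \<in> V \<Longrightarrow> a s t = (\<Sum>i<n. path_adj (p i) (I i) (r i) s t)"
    and dist: "distinct (I i)" and sub: "set (I i) \<subseteq> V - R"
    using S i by (auto simp: subdivides_def)
  show "distinct L" using dist sub ends by (auto simp: L_def)
  show LV: "set L \<subseteq> V" using sub ends R by (auto simp: L_def)
  show "0 < a (L ! j) (L ! Suc j)" if j: "Suc j < length L"
  proof -
    have "L ! j \<in> V" "L ! Suc j \<in> V" using LV j nth_mem Suc_lessD by blast+
    then have "a (L ! j) (L ! Suc j) = (\<Sum>i<n. path_adj (p i) (I i) (r i) (L ! j) (L ! Suc j))"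
      by (rule adj)
    moreover have "path_adj (p i) (I i) (r i) (L ! j) (L ! Suc j) \<le>
        (\<Sum>i<n. path_adj (p i) (I i) (r i) (L ! j) (L ! Suc j))"
      using i by (intro member_le_sum) (auto simp: path_adj_nonneg)
    moreover have "0 < path_adj (p i) (I i) (r i) (L ! j) (L ! Suc j)"
      using path_adj_nth[of j "I i" "p i" "r i"] j by (simp add: L_def)
    ultimately show ?thesis by linarith
  qed
  show "L ! j \<in> V - R" if "0 < j" "Suc j < length L"
  proof -
    have "L ! j = I i ! (j - 1)" "j - 1 < length (I i)" using that by (auto simp: L_def nth_append nth_Cons')
    then have "L ! j \<in> set (I i)" by simp
    then show ?thesis using sub by blast
  qed
qed

end

context free_hyperelliptic_graph
begin

text \<open>If \<open>c\<close> is the midpoint of a path of degree 2 vertices from \<open>x\<close> to \<open>\<iota> x\<close>, then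
  \<open>2 (c)\<close> is equivalent to \<open>(x) + (\<iota> x)\<close>.\<close>

lemma midpoint_wpt:
  assumes "distinct L" "set L \<subseteq> V" "\<And>j. Suc j < length L \<Longrightarrow> 0 < a (L ! j) (L ! Suc j)"
    "\<And>j. 0 < j \<Longrightarrow> Suc j < length L \<Longrightarrow> degree V a (L ! j) = 2"
    and x: "x \<in> V" "L ! 0 = x" "L ! (2 * k) = \<iota> x" and len: "length L = 2 * k + 1"
  shows "wpt V a 2 (L ! k)"
proof -
  have LV: "L ! j \<in> V" if "j \<le> 2 * k" for j using assms(2) len that by (auto simp: subset_iff)
  have ar: "prin V a (\<lambda>v. pt (L ! j) v - pt (L ! 0) v - int j * (pt (L ! 1) v - pt (L ! 0) v))"
    if "j \<le> 2 * k" for j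
    by (rule prin_arith[of "2 * k" "\<lambda>j. L ! j"])
      (use LV row_path[OF assms(1-4)] len that in auto)
  show ?thesis
  proof (rule wpt_if_pair[OF LV x(1), of k "\<lambda>v. pt x v + pt (\<iota> x) v"])
    \<comment> \<open>Term \<open>2 * k\<close> of the progression minus twice term
      \<open>k\<close>: the multiples of the common difference cancel.\<close>
    show "prin V a (\<lambda>v. pt x v + pt (\<iota> x) v - 2 * pt (L ! k) v)"
      by (rule prin_cong[OF prin_diff[OF ar[of "2 * k"] prin_cmul[OF ar[of k], of 2]]])
        (simp_all only: x(2,3), simp_all add: algebra_simps)
  qed auto
qed

text \<open>The automorphism \<open>\<iota>\<close> carries \<open>L\<close> vertex by vertex onto
  \<open>M\<close>: at each inner vertex of \<open>M\<close>, of degree 2, the image of the next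
  step has only one way to continue. Since \<open>\<iota>\<close> also matches the last vertices,
  neither path can end before the other.\<close>

lemma parallel_paths_length:
  assumes v: "v \<in> V" "a v (\<iota> v) = 2" "degree V a (\<iota> v) = 3"
    and L: "distinct L" "set L \<subseteq> V" "\<And>j. Suc j < length L \<Longrightarrow> 0 < a (L ! j) (L ! Suc j)"
    and M: "distinct M" "set M \<subseteq> V" "\<And>j. Suc j < length M \<Longrightarrow> 0 < a (M ! j) (M ! Suc j)"
      "\<And>j. 0 < j \<Longrightarrow> Suc j < length M \<Longrightarrow> degree V a (M ! j) = 2"
    and ends: "L ! 0 = v" "M ! 0 = \<iota> v" "last M = \<iota> (last L)" "\<iota> v \<notin> set L" "v \<notin> set M"
    and len: "2 \<le> length L" "2 \<le> length M"
  shows "length L = length M"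
proof -
  have inV: "L ! j \<in> V" if "j < length L" for j using L(2) that by auto
  have MV: "M ! j \<in> V" if "j < length M" for j using M(2) that by auto
  \<comment> \<open>The double edge to \<open>v\<close> and the edge to \<open>M ! 1\<close> use up
    degree 3; another neighbour would make it at least 4.\<close>
  have row0: "t = v \<or> t = M ! 1" if t: "t \<in> V" "0 < a (\<iota> v) t" for t
  proof (rule ccontr)
    assume ne: "\<not> ?thesis"
    have m: "M ! 1 \<in> V" "M ! 1 \<in> set M" "0 < a (\<iota> v) (M ! 1)"
      using MV[of 1] M(3)[of 0] ends len by auto
    then have "v \<noteq> M ! 1" using ends by metis
    then have "(\<Sum>u\<in>{v, M ! 1, t}. a (\<iota> v) u) = a (\<iota> v) v + (a (\<iota> v) (M ! 1) + a (\<iota> v) t)"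
      using ne by auto
    also have "\<dots> \<ge> 4" using m t v adj_sym[of "\<iota> v" v] by simp
    finally show False using degree_ge[of "{v, M ! 1, t}" "\<iota> v"] v m t by simp
  qed
  have iota: "\<iota> (L ! j) = M ! j" if "j < length L" "j < length M" for j
    using that
  proof (induction j rule: less_induct)
    case (less j)
    have adj: "0 < a (\<iota> (L ! k)) (\<iota> (L ! Suc k))" if "Suc k < length L" for k
      using adj_iota[OF inV inV] L(3) that by simp
    consider "j = 0" | "j = 1" | k where "j = Suc (Suc k)"
      by (metis One_nat_def not0_implies_Suc)
    then show ?case
    proof cases
      case 1
      then show ?thesis using ends by simp
    next
      case 2
      have "\<iota> (L ! 1) = v \<or> \<iota> (L ! 1) = M ! 1"
        using row0[of "\<iota> (L ! 1)"] adj[of 0] less.prems 2 ends inV iota_V by simp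
      moreover have "\<iota> (L ! 1) \<noteq> v"
      proof
        assume "\<iota> (L ! 1) = v"
        then have "\<iota> v = L ! 1" using iota_iota inV less.prems(1) 2 by metis
        then show False using ends(4) less.prems(1) 2 by simp
      qed
      ultimately show ?thesis using 2 by simp
    next
      case 3
      have IH: "\<iota> (L ! k) = M ! k" "\<iota> (L ! Suc k) = M ! Suc k"
        using less.IH less.prems 3 by simp_all
      have jL: "L ! j \<in> V" "L ! k \<in> V" using inV less.prems 3 by simp_all
      have "a (M ! Suc k) (\<iota> (L ! j)) = pt (M ! k) (\<iota> (L ! j)) + pt (M ! j) (\<iota> (L ! j))"
        using row_path[OF M, of "Suc k" "\<iota> (L ! j)"] less.prems 3 jL iota_V by simp
      moreover have "0 < a (M ! Suc k) (\<iota> (L ! j))" using adj[of "Suc k"] IH less.prems 3 by simp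
      ultimately have "\<iota> (L ! j) = M ! k \<or> \<iota> (L ! j) = M ! j" by (auto simp: pt_def split: if_splits)
      \<comment> \<open>The image cannot turn back, since \<open>\<iota>\<close> is injective and
        \<open>L\<close> has no repeated vertex.\<close>
      moreover have "\<iota> (L ! j) \<noteq> M ! k"
        unfolding IH(1)[symmetric] using iota_eq_iff[OF jL] L(1) less.prems 3
        by (simp add: nth_eq_iff_index_eq)
      ultimately show ?thesis by blast
    qed
  qed
  have lastL: "last L = L ! (length L - 1)" "last M = M ! (length M - 1)"
    using len by (metis last_conv_nth list.size(3) not_numeral_le_zero)+
  show ?thesis
  proof (rule linorder_cases[of "length L" "length M"])
    assume l: "length L < length M"
    then have "M ! (length L - 1) = M ! (length M - 1)" using iota[of "length L - 1"] len ends(3) lastL by simp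
    moreover have "length L - 1 < length M" "length M - 1 < length M" using l len by linarith+
    ultimately have "length L - 1 = length M - 1" using nth_eq_iff_index_eq[OF M(1)] by blast
    then show ?thesis using l len by linarith
  next
    assume l: "length M < length L"
    then have "\<iota> (L ! (length M - 1)) = \<iota> (L ! (length L - 1))"
      using iota[of "length M - 1"] len ends(3) lastL by simp
    then have "L ! (length M - 1) = L ! (length L - 1)" using iota_eq_iff inV l len by simp
    moreover have "length M - 1 < length L" "length L - 1 < length L" using l len by linarith+
    ultimately have "length M - 1 = length L - 1" using nth_eq_iff_index_eq[OF L(1)] by blast
    then show ?thesis using l len by linarith
  qed
qed

end

lemma path_adj_ends:
  assumes "p \<noteq> r" "p \<notin> set I" "r \<notin> set I"
  shows "path_adj p I r p r = of_bool (I = [])"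
proof (cases I)
  case (Cons q J)
  then show ?thesis using assms path_adj_eq_0[of p q r J r] by (auto simp: doubleton_eq_iff)
qed simp


section \<open>Graphs without Weierstrass points\<close>

locale no_weierstrass =
  loopless_multigraph G + free_hyperelliptic_graph "verts G" "adj G" \<iota>
  for G :: "('v, 'e) multigraph" and \<iota> +
  assumes genus_ge_2: "2 \<le> genus G" and no_wpt: "\<not> wpt (verts G) (adj G) (genus G) x"
begin

abbreviation "V \<equiv> verts G"
abbreviation "a \<equiv> adj G"

text \<open>All edges run between \<open>x\<close> and \<open>\<iota> x\<close>, and the degree sum
  makes their number \<open>g + 1\<close>; each is a path without inner vertices.\<close>

lemma banana_case:
  assumes x: "x \<in> V" and V: "V = {x, \<iota> x}"
  shows "\<exists>n\<ge>3. isomorphic G (banana n)"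
proof -
  have ix: "\<iota> x \<in> V" "\<iota> x \<noteq> x" using x iota_V iota_neq by auto
  have "degree V a x = a x (\<iota> x)"
    unfolding degree_def by (subst V) (use ix irrefl in simp)
  then have "2 * genus G - 2 = 2 * (a x (\<iota> x) - 2)"
    unfolding sum_degree[symmetric] by (subst (1) V) (use ix degree_iota[OF x] in simp)
  then have n: "a x (\<iota> x) = genus G + 1" by simp
  define n where "n = nat (genus G + 1)"
  have "subdivides V {x, \<iota> x} a n (\<lambda>_. x) (\<lambda>_. \<iota> x) (\<lambda>_. [])"
    unfolding subdivides_def
  proof (intro conjI ballI)
    fix s t assume "s \<in> V" "t \<in> V"
    then have "s = x \<or> s = \<iota> x" "t = x \<or> t = \<iota> x" using V by blast+
    then show "a s t = (\<Sum>i<n. path_adj x [] (\<iota> x) s t)"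
      using n ix irrefl adj_sym[of "\<iota> x" x] genus_ge_2
      by (auto simp: n_def doubleton_eq_iff)
  qed (use V in auto)
  from subdivides_isomorphic_B[OF loopless_multigraph_axioms x ix(1) ix(2)[symmetric] this]
  have "isomorphic G (banana n)" by (simp add: banana_def map_replicate_const)
  moreover have "3 \<le> n" using genus_ge_2 by (simp add: n_def)
  ultimately show ?thesis by blast
qed

text \<open>The total excess 2 over degree 2 is shared equally by a vertex and its conjugate, so
  exactly one fibre has degree 3. Suppressing everything else leaves three parallel edges between
  \<open>x\<close> and \<open>\<iota> x\<close>.\<close>

lemma genus_2_case:
  assumes g: "genus G = 2"
  shows "\<exists>l\<^sub>1 l\<^sub>2 l\<^sub>3. odd l\<^sub>1 \<and> odd l\<^sub>2 \<and> odd l\<^sub>3 \<and> isomorphic G (B [l\<^sub>1, l\<^sub>2, l\<^sub>3])"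
proof -
  have deg_ge: "0 \<le> degree V a v - 2" if "v \<in> V" for v
    using degree_ge_2[OF that not_singleton[OF that]] by simp
  have sum: "(\<Sum>v\<in>V. degree V a v - 2) = 2" using sum_degree g by simp
  then obtain x where x: "x \<in> V" "degree V a x - 2 \<noteq> 0" by (metis sum.neutral zero_neq_numeral)
  have ix: "\<iota> x \<in> V" "\<iota> x \<noteq> x" using x iota_V iota_neq by auto
  have "(\<Sum>v\<in>V. degree V a v - 2) = (\<Sum>v\<in>V - {x, \<iota> x}. degree V a v - 2) + (\<Sum>v\<in>{x, \<iota> x}. degree V a v - 2)"
    using x ix finite_V by (intro sum.subset_diff) auto
  moreover have "0 \<le> (\<Sum>v\<in>V - {x, \<iota> x}. degree V a v - 2)" using deg_ge by (intro sum_nonneg) auto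
  ultimately have dx: "degree V a x = 3" and "(\<Sum>v\<in>V - {x, \<iota> x}. degree V a v - 2) = 0"
    using sum x deg_ge[OF x(1)] ix degree_iota[OF x(1)] by auto
  then have d2: "degree V a v = 2" if "v \<in> V - {x, \<iota> x}" for v
    using that finite_V deg_ge by (subst (asm) sum_nonneg_eq_0_iff) auto
  have dix: "degree V a (\<iota> x) = 3" using dx degree_iota x by simp
  let ?R = "{x, \<iota> x}"
  have R: "?R \<subseteq> V" "2 \<le> card ?R" using x ix by auto
  have le3: "degree V a v \<le> 3" if "v \<in> V" for v
    using d2[of v] dx dix that by (cases "v \<in> ?R") auto
  obtain b where b: "two_edge_connected_graph ?R b" "\<forall>v\<in>?R. degree ?R b v = degree V a v"
    and sub: "\<And>n p r. (\<forall>i<n. p i \<in> ?R \<and> r i \<in> ?R) \<Longrightarrow>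
       (\<forall>s\<in>?R. \<forall>t\<in>?R. b s t = (\<Sum>i<n. of_bool ({s, t} = {p i, r i}))) \<Longrightarrow>
       (\<exists>I. subdivides V ?R a n p r I)"
    using smoothing[OF two_edge_connected_graph_axioms R d2 le3] by blast
  interpret b: two_edge_connected_graph ?R b by fact
  have "b x (\<iota> x) = 3" using b(2) dx ix b.irrefl by (simp add: degree_def)
  then have "\<forall>s\<in>?R. \<forall>t\<in>?R. b s t = (\<Sum>i<(3::nat). of_bool ({s, t} = {x, \<iota> x}))"
    using b.irrefl b.adj_sym[of "\<iota> x" x] ix by (auto simp: doubleton_eq_iff)
  then obtain I where I: "subdivides V ?R a 3 (\<lambda>_. x) (\<lambda>_. \<iota> x) I"
    using sub[of 3 "\<lambda>_. x" "\<lambda>_. \<iota> x"] by auto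
  \<comment> \<open>A path with an even number of edges has a middle vertex, which would be a
    Weierstrass point because \<open>g = 2\<close>.\<close>
  have "odd (length (I i) + 1)" if i: "i < 3" for i
  proof
    assume "even (length (I i) + 1)"
    then obtain k where k: "length (I i) + 1 = 2 * k" by (rule evenE)
    let ?L = "x # I i @ [\<iota> x]"
    note path = subdivides_path[OF I i _ _ _ R(1), simplified, OF ix(2)[symmetric]]
    have "wpt V a 2 (?L ! k)"
    proof (rule midpoint_wpt[of _ x])
      show "distinct ?L" "set ?L \<subseteq> V" using path(1,2) ix by auto
      show "0 < a (?L ! j) (?L ! Suc j)" if "Suc j < length ?L" for j
        using path(3)[of j] that by simp
      show "degree V a (?L ! j) = 2" if "0 < j" "Suc j < length ?L" for j
        using path(4)[of j] that by (intro d2) simp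
      show "?L ! (2 * k) = \<iota> x" using k by (simp flip: k add: nth_append)
      show "length ?L = 2 * k + 1" using k by simp
    qed (use x in auto)
    then show False using no_wpt g by simp
  qed
  moreover have "isomorphic G (B [length (I 0) + 1, length (I 1) + 1, length (I 2) + 1])"
    using subdivides_isomorphic_B[OF loopless_multigraph_axioms x(1) ix(1) ix(2)[symmetric] I]
    by (simp add: upt_rec numeral_eq_Suc)
  ultimately show ?thesis
    by (intro exI[of _ "length (I 0) + 1"] exI[of _ "length (I 1) + 1"] exI[of _ "length (I 2) + 1"]) simp
qed

lemma leaf_multiplicity: "leaf v u \<Longrightarrow> genus G - 1 \<le> a v (\<iota> v)"
  using leaf_wpt[of v u "genus G"] no_wpt[of v] by (cases "a v (\<iota> v) + 2 \<le> genus G") auto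

text \<open>Two leaves \<open>v\<close>, \<open>y\<close> of the quotient tree contribute
  \<open>2 (a v (\<iota> v) - 1) + 2 (a y (\<iota> y) - 1) \<ge> 4 (g - 2)\<close> to \<open>\<Sum>x. (deg x - 2) = 2 g - 2\<close>,
  which leaves only \<open>g = 3\<close> and no further vertices of degree greater than 2.\<close>

lemma two_leaves_genus_3:
  assumes g: "3 \<le> genus G" and l: "leaf v u" "leaf y z" "y \<noteq> v" "y \<noteq> \<iota> v"
  defines "R \<equiv> {v, \<iota> v, y, \<iota> y}"
  shows "card R = 4" "R \<subseteq> V" "a v (\<iota> v) = 2" "a y (\<iota> y) = 2"
    "w \<in> R \<Longrightarrow> degree V a w = 3" "w \<in> V - R \<Longrightarrow> degree V a w = 2"
proof -
  have vy: "v \<in> V" "y \<in> V" "\<iota> v \<in> V" "\<iota> y \<in> V" using l iota_V by (auto simp: leaf_def)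
  have ne: "\<iota> v \<noteq> v" "\<iota> y \<noteq> y" "\<iota> y \<noteq> \<iota> v" "\<iota> y \<noteq> v"
    using iota_neq vy l(3,4) iota_iota by metis+
  show "card R = 4" "R \<subseteq> V" using vy ne l(3,4) by (auto simp: R_def)
  note d = leaf_degree(1)[OF l(1)] leaf_degree(1)[OF l(2)] degree_iota[OF vy(1)] degree_iota[OF vy(2)]
  have deg_ge: "0 \<le> degree V a v - 2" if "v \<in> V" for v
    using degree_ge_2[OF that not_singleton[OF that]] by simp
  have "(\<Sum>v\<in>V. degree V a v - 2) = (\<Sum>v\<in>V - R. degree V a v - 2) + (\<Sum>v\<in>R. degree V a v - 2)"
    using finite_V \<open>R \<subseteq> V\<close> by (intro sum.subset_diff) auto
  moreover have "(\<Sum>v\<in>R. degree V a v - 2) = 2 * (a v (\<iota> v) - 1) + 2 * (a y (\<iota> y) - 1)"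
    unfolding R_def using ne l(3,4) d by (simp add: eq_commute)
  moreover have "0 \<le> (\<Sum>v\<in>V - R. degree V a v - 2)" using deg_ge by (intro sum_nonneg) auto
  ultimately have *: "a v (\<iota> v) = 2 \<and> a y (\<iota> y) = 2 \<and> (\<Sum>v\<in>V - R. degree V a v - 2) = 0"
    using sum_degree leaf_multiplicity[OF l(1)] leaf_multiplicity[OF l(2)] g by presburger
  then show "a v (\<iota> v) = 2" "a y (\<iota> y) = 2" by auto
  show "degree V a w = 3" if "w \<in> R" using that d * by (auto simp: R_def)
  show "degree V a w = 2" if "w \<in> V - R"
    using * that finite_V deg_ge by (subst (asm) sum_nonneg_eq_0_iff) auto
qed

text \<open>Only the four vertices of two leaf fibres have degree 3. Suppressing the others leaves a
  cubic multigraph on them, determined by the two double edges; \<open>\<iota>\<close> then makes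
  the two remaining paths equally long.\<close>

lemma Phi_case:
  assumes g: "3 \<le> genus G" and x: "x \<in> V" "V \<noteq> {x, \<iota> x}"
  shows "\<exists>l\<ge>1. isomorphic G (Phi l)"
proof -
  obtain v u y0 z0 where l: "leaf v u" "leaf y0 z0" "y0 \<noteq> v" "y0 \<noteq> \<iota> v"
    using x by (rule two_leaves)
  define w where "w = \<iota> v"
  define R where "R = {v, \<iota> v, y0, \<iota> y0}"
  note t = two_leaves_genus_3[OF g l, folded R_def]
  have R0: "R \<subseteq> V" by (rule t(2))
  have le3: "degree V a v \<le> 3" if "v \<in> V" for v
    using t(5)[of v] t(6)[of v] that by (cases "v \<in> R") auto
  have card2: "2 \<le> card R" using t(1) by simp
  obtain b where b: "two_edge_connected_graph R b" "\<forall>v\<in>R. degree R b v = degree V a v"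
    "\<forall>s\<in>R. \<forall>t\<in>R. a s t \<le> b s t"
    and sub: "\<And>n p r. (\<forall>i<n. p i \<in> R \<and> r i \<in> R) \<Longrightarrow>
       (\<forall>s\<in>R. \<forall>t\<in>R. b s t = (\<Sum>i<n. of_bool ({s, t} = {p i, r i}))) \<Longrightarrow>
       (\<exists>I. subdivides V R a n p r I)"
    using smoothing[OF two_edge_connected_graph_axioms R0 card2 t(6) le3] by blast
  interpret b: two_edge_connected_graph R b by fact
  have y0V: "y0 \<in> V" "\<iota> (\<iota> y0) = y0" and vV: "v \<in> V" using R0 iota_iota by (auto simp: R_def)
  have d4: "v \<noteq> w" "v \<noteq> y0" "v \<noteq> \<iota> y0" "w \<noteq> y0" "w \<noteq> \<iota> y0" "y0 \<noteq> \<iota> y0"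
    using l(3,4) iota_neq vV y0V iota_iota unfolding w_def by metis+
  have deg_b: "degree R b s = 3" if "s \<in> R" for s using b(2) t(5) that by metis
  have sum_b: "degree R b s = b s v + b s w + b s y0 + b s (\<iota> y0)" for s
    unfolding degree_def using d4 by (simp add: w_def R_def)
  have dv: "b v w + b v y0 + b v (\<iota> y0) = 3" "b v w + b w y0 + b w (\<iota> y0) = 3"
    "b v y0 + b w y0 + b y0 (\<iota> y0) = 3" "b v (\<iota> y0) + b w (\<iota> y0) + b y0 (\<iota> y0) = 3"
    using deg_b[of v] deg_b[of w] deg_b[of y0] deg_b[of "\<iota> y0"] b.irrefl
      b.adj_sym[of w v] b.adj_sym[of y0 v] b.adj_sym[of y0 w] b.adj_sym[of "\<iota> y0"]
    unfolding sum_b by (simp_all add: w_def R_def)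
  \<comment> \<open>With all degrees 3, this cut has \<open>6 - 2 * b v w\<close> edges, so
    \<open>b v w \<le> 2\<close>; the same cut bounds \<open>b y0 (\<iota> y0)\<close>.\<close>
  have "2 \<le> cut R b {v, w}" using d4 by (intro b.cut_ge_2) (auto simp: w_def R_def)
  moreover have "cut R b {v, w} = b v y0 + b v (\<iota> y0) + b w y0 + b w (\<iota> y0)"
  proof -
    have "R - {v, w} = {y0, \<iota> y0}" using d4 by (auto simp: w_def R_def)
    then show ?thesis unfolding cut_def using d4 by simp
  qed
  moreover have "2 \<le> b v w" "2 \<le> b y0 (\<iota> y0)" using b(3) t(3,4) by (auto simp: w_def R_def)
  ultimately have bvw: "b v w = 2" "b y0 (\<iota> y0) = 2" using dv b.nonneg by linarith+
  \<comment> \<open>One edge at \<open>v\<close> is left after the double edge. Its far end in the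
    second fibre is named \<open>y\<close>, so that \<open>w\<close> is joined to the conjugate
    \<open>z\<close>.\<close>
  obtain y z where yz: "{y, z} = {y0, \<iota> y0}" "z = \<iota> y" "b v y = 1" "b v z = 0"
  proof (cases "b v y0 = 0")
    case True
    then show thesis using that[of "\<iota> y0" y0] y0V dv bvw by auto
  next
    case False
    then show thesis using that[of y0 "\<iota> y0"] dv bvw b.nonneg[of v y0] b.nonneg[of v "\<iota> y0"] by auto
  qed
  have "(y = y0 \<and> z = \<iota> y0) \<or> (y = \<iota> y0 \<and> z = y0)" using yz(1) by (auto simp: doubleton_eq_iff)
  then have ne: "v \<noteq> w" "v \<noteq> y" "v \<noteq> z" "w \<noteq> y" "w \<noteq> z" "y \<noteq> z"
    and bs: "b w y = 0" "b w z = 1" "b y z = 2" and ayz: "a y z = 2"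
    using d4 dv bvw yz(3,4) t(4) b.adj_sym[of "\<iota> y0" y0] adj_sym[of "\<iota> y0" y0] by auto
  let ?R = "{v, w, y, z}"
  have RR: "R = ?R" using yz(1) by (auto simp: w_def R_def)
  have inV: "v \<in> V" "w \<in> V" "y \<in> V" "z \<in> V"
    using R0 yz(1) by (auto simp: w_def R_def doubleton_eq_iff)
  \<comment> \<open>Paths 0 to 3 are the two pairs of parallel edges, path 4 joins \<open>v\<close>
    to \<open>y\<close>, and path 5 joins \<open>w\<close> to \<open>z\<close>.\<close>
  define p where "p i = [v, v, y, y, v, w] ! i" for i
  define r where "r i = [w, w, z, z, y, z] ! i" for i
  have pr: "p 0 = v" "p 1 = v" "p 2 = y" "p 3 = y" "p 4 = v" "p 5 = w"
    "r 0 = w" "r 1 = w" "r 2 = z" "r 3 = z" "r 4 = y" "r 5 = z"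
    by (simp_all add: p_def r_def)
  have sum6: "(\<Sum>i<6. F i) = F 0 + F 1 + F 2 + F 3 + F 4 + F (5::nat)" for F :: "nat \<Rightarrow> int"
    by (simp add: eval_nat_numeral)
  have pr_R: "\<forall>i<6. p i \<in> ?R \<and> r i \<in> ?R"
    by (auto simp: p_def r_def less_Suc_eq eval_nat_numeral)
  have "\<forall>s\<in>?R. \<forall>t\<in>?R. b s t = (\<Sum>i<6. of_bool ({s, t} = {p i, r i}))"
    unfolding sum6 pr
    using ne bs bvw yz(3,4) b.irrefl b.adj_sym[of w v] b.adj_sym[of y v] b.adj_sym[of z v]
      b.adj_sym[of y w] b.adj_sym[of z w] b.adj_sym[of z y]
    by (simp add: doubleton_eq_iff)
  then obtain I where I: "subdivides V ?R a 6 p r I" using sub[of 6 p r] pr_R unfolding RR by auto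
  have adj: "a s t = (\<Sum>i<6. path_adj (p i) (I i) (r i) s t)" if "s \<in> V" "t \<in> V" for s t
    using I that by (auto simp: subdivides_def)
  have sub_I: "set (I i) \<subseteq> V - ?R" if "i < 6" for i using I that by (auto simp: subdivides_def)
  have notin: "v \<notin> set (I i)" "w \<notin> set (I i)" "y \<notin> set (I i)" "z \<notin> set (I i)" if "i < 6" for i
    using sub_I[OF that] by auto
  \<comment> \<open>Both edges between \<open>v\<close> and \<open>w\<close> are already present in
    \<open>G\<close>, and the other paths contribute none, so these two paths have no inner
    vertices.\<close>
  have I01: "I 0 = []" "I 1 = []"
  proof -
    have "path_adj y (I 2) z v w = 0" "path_adj y (I 3) z v w = 0"
      "path_adj v (I 4) y v w = 0" "path_adj w (I 5) z v w = 0"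
      using notin ne path_adj_commute[of v "I 4" y v w] by (auto intro!: path_adj_eq_0)
    moreover have "a v w = 2" using t(3) by (simp add: w_def)
    ultimately have "path_adj v (I 0) w v w + path_adj v (I 1) w v w = 2"
      using adj[OF inV(1,2)] unfolding sum6 pr by simp
    then show "I 0 = []" "I 1 = []"
      using path_adj_ends[OF ne(1) notin(1,2)[of 0]] path_adj_ends[OF ne(1) notin(1,2)[of 1]]
      by (auto split: if_splits simp: of_bool_def)
  qed
  have I23: "I 2 = []" "I 3 = []"
  proof -
    have "path_adj v (I 0) w y z = 0" "path_adj v (I 1) w y z = 0"
      "path_adj v (I 4) y y z = 0" "path_adj w (I 5) z y z = 0"
      using notin ne path_adj_commute[of v "I 4" y y z] by (auto intro!: path_adj_eq_0)
    then have "path_adj y (I 2) z y z + path_adj y (I 3) z y z = 2"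
      using adj[OF inV(3,4)] ayz unfolding sum6 pr by simp
    then show "I 2 = []" "I 3 = []"
      using path_adj_ends[OF ne(6) notin(3,4)[of 2]] path_adj_ends[OF ne(6) notin(3,4)[of 3]]
      by (auto split: if_splits simp: of_bool_def)
  qed
  let ?L = "v # I 4 @ [y]" and ?M = "w # I 5 @ [z]"
  have R: "?R \<subseteq> V" using inV by simp
  have d2: "degree V a s = 2" if "s \<in> V - ?R" for s using t(6) that unfolding RR by blast
  have pL: "distinct ?L" "set ?L \<subseteq> V" "\<And>j. Suc j < length ?L \<Longrightarrow> 0 < a (?L ! j) (?L ! Suc j)"
    using subdivides_path[OF I, of 4] R ne unfolding pr by auto
  have pM: "distinct ?M" "set ?M \<subseteq> V" "\<And>j. Suc j < length ?M \<Longrightarrow> 0 < a (?M ! j) (?M ! Suc j)"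
    "\<And>j. 0 < j \<Longrightarrow> Suc j < length ?M \<Longrightarrow> ?M ! j \<in> V - ?R"
    using subdivides_path[OF I, of 5] R ne unfolding pr by auto
  have "length ?L = length ?M"
  proof (rule parallel_paths_length[of v])
    show "degree V a (\<iota> v) = 3" using t(5) by (simp add: R_def)
    show "degree V a (?M ! j) = 2" if "0 < j" "Suc j < length ?M" for j
      using d2 pM(4)[OF that] .
    show "\<iota> v \<notin> set ?L" "v \<notin> set ?M" using notin[of 4] notin[of 5] ne unfolding w_def[symmetric] by auto
  qed (use inV t(3) pL pM yz(2) in \<open>auto simp: w_def\<close>)
  then have "isomorphic G (Phi (length (I 4) + 1))"
  proof (intro isomorphic_Phi[of G "I 4" "I 5" v y w z] loopless_multigraph_axioms)
    have "set (I 4) \<inter> set (I 5) = {}" using I by (auto simp: subdivides_def)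
    then show "distinct (?L @ ?M)" using pL(1) pM(1) notin[of 4] notin[of 5] ne by auto
    have "(\<Union>i<6. set (I i)) = V - ?R" using I by (auto simp: subdivides_def)
    moreover have "{..<6::nat} = {0, 1, 2, 3, 4, 5}" by auto
    ultimately have "set (I 4) \<union> set (I 5) = V - ?R" using I01 I23 by simp
    then show "set (?L @ ?M) = V" using R by auto
    show "a s t = 2 * of_bool ({s, t} = {v, w}) + 2 * of_bool ({s, t} = {y, z})
        + path_adj v (I 4) y s t + path_adj w (I 5) z s t" if "s \<in> V" "t \<in> V" for s t
      using adj[OF that] unfolding sum6 pr I01 I23 by simp
  qed simp
  then show ?thesis by (intro exI[of _ "length (I 4) + 1"]) simp
qed

lemma classification:
  "(\<exists>n\<ge>3. isomorphic G (banana n))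
   \<or> (\<exists>l\<^sub>1 l\<^sub>2 l\<^sub>3. odd l\<^sub>1 \<and> odd l\<^sub>2 \<and> odd l\<^sub>3 \<and> isomorphic G (B [l\<^sub>1, l\<^sub>2, l\<^sub>3]))
   \<or> (\<exists>l\<ge>1. isomorphic G (Phi l))"
proof -
  have "V \<noteq> {}"
    using sum_degree genus_ge_2 by auto
  then obtain x where x: "x \<in> V" by blast
  show ?thesis
  proof (cases "V = {x, \<iota> x}")
    case True
    then show ?thesis using banana_case[OF x] by blast
  next
    case False
    then show ?thesis using genus_2_case Phi_case[OF _ x] genus_ge_2 by (cases "genus G = 2") auto
  qed
qed

end


section \<open>The listed graphs have no Weierstrass points\<close>

context loopless_multigraph
begin

lemma adj_pos: "e \<in> edges G \<Longrightarrow> ends G e = {u, v} \<Longrightarrow> 0 < adj G u v"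
  using finite_edges by (auto simp: adj_def card_gt_0_iff)

text \<open>A set \<open>F\<close> of edges to earlier vertices bounds their number from below, so
  multiplicities need not be computed exactly.\<close>

lemma not_eff_equiv_edge_order:
  fixes \<rho> :: "'v \<Rightarrow> nat"
  assumes "verts G \<noteq> {}"
    and "\<And>v. v \<in> verts G \<Longrightarrow> \<exists>F\<subseteq>edges G. D v < int (card F) \<and>
      (\<forall>e\<in>F. \<exists>u\<in>verts G. ends G e = {v, u} \<and> \<rho> u < \<rho> v)"
  shows "\<not> eff_equiv (verts G) (adj G) D"
proof (rule not_eff_equiv_order[OF assms(1), of D \<rho>])
  fix v assume "v \<in> verts G"
  from assms(2)[OF this] obtain F where F: "F \<subseteq> edges G" "D v < int (card F)"
    "\<forall>e\<in>F. \<exists>u\<in>verts G. ends G e = {v, u} \<and> \<rho> u < \<rho> v" by blast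
  have "int (card F) \<le> (\<Sum>u\<in>{u\<in>verts G. \<rho> u < \<rho> v}. adj G v u)"
    using F(1,3) by (intro indegree_ge) auto
  then show "D v < (\<Sum>u\<in>{u\<in>verts G. \<rho> u < \<rho> v}. adj G v u)" using F(2) by linarith
qed

lemma not_wptI:
  assumes "y \<in> verts G" "prin (verts G) (adj G) (\<lambda>v. E v - (g * pt x v - pt y v))"
    "\<not> eff_equiv (verts G) (adj G) E"
  shows "\<not> wpt (verts G) (adj G) g x"
proof
  assume "wpt (verts G) (adj G) g x"
  then have "eff_equiv (verts G) (adj G) (\<lambda>v. g * pt x v - pt y v)"
    using assms(1) by (simp add: wpt_def)
  then have "eff_equiv (verts G) (adj G) E" by (rule eff_equiv_prin[OF _ assms(2)]) simp
  then show False using assms(3) by blast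
qed

end

section \<open>The graphs \<open>B\<close>\<close>

lemma genus_B:
  assumes "\<And>i. i < length ls \<Longrightarrow> 0 < ls ! i"
  shows "genus (B ls) = int (length ls) - 1"
proof -
  let ?n = "length ls"
  have e: "card (edges (B ls)) = (\<Sum>i<?n. ls ! i)" by (simp add: edges_B)
  have "verts (B ls) = {Pole_x, Pole_y} \<union> case_prod Inner ` (SIGMA i:{..<?n}. {0<..<ls ! i})"
    by (auto simp: B_def image_iff)
  also have "card \<dots> = card {Pole_x, Pole_y} + card (case_prod Inner ` (SIGMA i:{..<?n}. {0<..<ls ! i}))"
    by (intro card_Un_disjoint) auto
  also have "card (case_prod Inner ` (SIGMA i:{..<?n}. {0<..<ls ! i})) = (\<Sum>i<?n. ls ! i - 1)"
    by (subst card_image) (auto simp: inj_on_def)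
  finally have "int (card (verts (B ls))) = 2 + (\<Sum>i<?n. int (ls ! i - 1))" by simp
  also have "(\<Sum>i<?n. int (ls ! i - 1)) = (\<Sum>i<?n. int (ls ! i) - 1)"
    using assms by (intro sum.cong refl) (auto simp: of_nat_diff Suc_le_eq)
  finally show ?thesis using e by (simp add: genus_def sum_subtractf)
qed

text \<open>No rewriting of \<open>g (x) - (y)\<close> is needed when \<open>y\<close> is the other
  pole: ordering \<open>y\<close> before \<open>x\<close>, the value -1 at \<open>y\<close> is below
  0 and the value \<open>g = n - 1\<close> at \<open>x\<close> is below its \<open>n\<close>
  edges.\<close>

lemma not_wpt_banana: "\<not> wpt (verts (banana n)) (adj (banana n)) (genus (banana n)) x"
proof
  interpret loopless_multigraph "banana n" unfolding banana_def by (rule loopless_B)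
  have V: "verts (banana n) = {Pole_x, Pole_y}" by (auto simp: banana_def B_def)
  have E: "edges (banana n) = {..<n} \<times> {0}" by (auto simp: banana_def edges_B)
  have ends: "ends (banana n) e = {Pole_x, Pole_y}" if "e \<in> edges (banana n)" for e
    using that by (auto simp: banana_def B_def banana_vertex_at_def)
  have g: "genus (banana n) = int n - 1" by (simp add: genus_def V E card_cartesian_product)
  assume w: "wpt (verts (banana n)) (adj (banana n)) (genus (banana n)) x"
  then have x: "x \<in> {Pole_x, Pole_y}" by (simp add: wpt_def V)
  define y where "y = (if x = Pole_x then Pole_y else Pole_x)"
  have y: "y \<in> verts (banana n)" "y \<noteq> x" "{x, y} = {Pole_x, Pole_y}" using x by (auto simp: y_def V)
  have "\<not> eff_equiv (verts (banana n)) (adj (banana n)) (\<lambda>v. genus (banana n) * pt x v - pt y v)"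
  proof (rule not_eff_equiv_edge_order[of _ "\<lambda>v. if v = x then 1 else 0"])
    fix v assume v: "v \<in> verts (banana n)"
    show "\<exists>F\<subseteq>edges (banana n). genus (banana n) * pt x v - pt y v < int (card F) \<and>
      (\<forall>e\<in>F. \<exists>u\<in>verts (banana n). ends (banana n) e = {v, u} \<and>
         (if u = x then 1 else 0) < (if v = x then 1 else (0::nat)))"
    proof (cases "v = x")
      case True
      then show ?thesis using y g ends
        by (intro exI[of _ "edges (banana n)"]) (auto simp: E card_cartesian_product pt_def)
    next
      case False
      then have "v = y" using v y(3) V by auto
      then show ?thesis using y by (intro exI[of _ "{}"]) (auto simp: pt_def)
    qed
  qed (simp add: V)
  then show False using w y(1) by (simp add: wpt_def)
qed

context
  fixes ls :: "nat list"
  assumes pos: "\<And>i. i < length ls \<Longrightarrow> 0 < ls ! i"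
begin

interpretation loopless_multigraph "B ls" by (rule loopless_B)

abbreviation (input) "at \<equiv> banana_vertex_at ls"

lemma at_simps:
  "at i 0 = Pole_x" "i < length ls \<Longrightarrow> at i (ls ! i) = Pole_y"
  "0 < j \<Longrightarrow> j < ls ! i \<Longrightarrow> at i j = Inner i j"
  using pos by (auto simp: banana_vertex_at_def)

lemma at_verts: "i < length ls \<Longrightarrow> j \<le> ls ! i \<Longrightarrow> at i j \<in> verts (B ls)"
  by (auto simp: banana_vertex_at_def B_def)

lemma verts_at:
  assumes "v \<in> verts (B ls)" "ls \<noteq> []"
  obtains i j where "i < length ls" "j \<le> ls ! i" "v = at i j"
proof -
  consider "v = Pole_x" | "v = Pole_y" | i j where "v = Inner i j" "i < length ls" "0 < j" "j < ls ! i"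
    using assms(1) by (auto simp: B_def)
  then show thesis
  proof cases
    case 1
    then show ?thesis using that[of 0 0] assms(2) at_simps(1) by simp
  next
    case 2
    then show ?thesis using that[of 0 "ls ! 0"] assms(2) at_simps(2) by simp
  next
    case 3
    then show ?thesis using that[of i j] at_simps(3) by simp
  qed
qed

lemma adj_at:
  assumes i: "i < length ls" and m: "0 < m" "m < ls ! i" and v: "v \<in> verts (B ls)"
  shows "adj (B ls) (at i m) v = pt (at i (m - 1)) v + pt (at i (m + 1)) v"
proof (rule row_degree_2)
  show "at i (m - 1) \<in> verts (B ls)" "at i (m + 1) \<in> verts (B ls)" using i m by (auto intro: at_verts)
  show "at i (m - 1) \<noteq> at i (m + 1)" using m by (auto simp: banana_vertex_at_def)
  show "0 < adj (B ls) (at i m) (at i (m - 1))"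
    by (rule adj_pos[of "(i, m - 1)"]) (use i m in \<open>auto simp: B_def\<close>)
  show "0 < adj (B ls) (at i m) (at i (m + 1))"
    by (rule adj_pos[of "(i, m)"]) (use i m in \<open>auto simp: B_def\<close>)
  have "{e\<in>edges (B ls). at i m \<in> ends (B ls) e} = {(i, m - 1), (i, m)}"
    using i m by (auto simp: B_def banana_vertex_at_def split: if_splits)
  then show "degree (verts (B ls)) (adj (B ls)) (at i m) = 2"
    using degree_card[OF at_verts[OF i, of m]] m by simp
qed (fact v)

lemma prin_at:
  assumes i: "i < length ls" and j: "2 * j \<le> ls ! i"
  shows "prin (verts (B ls)) (adj (B ls)) (\<lambda>v. pt Pole_x v + pt (at i (2 * j)) v - 2 * pt (at i j) v)"
proof -
  have ar: "prin (verts (B ls)) (adj (B ls)) (\<lambda>v. pt (at i k) v - pt (at i 0) v - int k * (pt (at i 1) v - pt (at i 0) v))"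
    if "k \<le> ls ! i" for k
    by (rule prin_arith[of "ls ! i" "at i"]) (use i that at_verts adj_at in auto)
  have "j \<le> ls ! i" using j by simp
  then show ?thesis
    by (intro prin_cong[OF prin_diff[OF ar[OF j] prin_cmul[OF ar, of j 2]]]) (simp_all add: at_simps(1) algebra_simps)
qed

lemma reversal:
  obtains \<phi> where "bij_betw \<phi> (verts (B ls)) (verts (B ls))"
    "\<And>u v. u \<in> verts (B ls) \<Longrightarrow> v \<in> verts (B ls) \<Longrightarrow> adj (B ls) (\<phi> u) (\<phi> v) = adj (B ls) u v"
    "\<And>i j. i < length ls \<Longrightarrow> j \<le> ls ! i \<Longrightarrow> \<phi> (at i j) = at i (ls ! i - j)"
proof -
  define \<phi> where "\<phi> b = (case b of Pole_x \<Rightarrow> Pole_y | Pole_y \<Rightarrow> Pole_x | Inner i j \<Rightarrow> Inner i (ls ! i - j))" for b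
  \<comment> \<open>Edge \<open>j\<close> joins positions \<open>j\<close> and \<open>j + 1\<close>;
    the mirrored edge is indexed by its smaller position \<open>ls ! i - (j + 1)\<close>.\<close>
  define \<psi> where "\<psi> = (\<lambda>(i, j). (i, ls ! i - Suc j))"
  have 1: "bij_betw \<phi> (verts (B ls)) (verts (B ls))"
    by (rule bij_betw_byWitness[of _ \<phi>]) (auto simp: B_def \<phi>_def)
  have 2: "bij_betw \<psi> (edges (B ls)) (edges (B ls))"
    by (rule bij_betw_byWitness[of _ \<psi>]) (auto simp: B_def \<psi>_def)
  have 3: "\<phi> (at i j) = at i (ls ! i - j)" if "i < length ls" "j \<le> ls ! i" for i j
    using that pos by (auto simp: banana_vertex_at_def \<phi>_def)
  have 4: "ends (B ls) (\<psi> e) = \<phi> ` ends (B ls) e" if e: "e \<in> edges (B ls)" for e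
  proof -
    obtain i j where e: "e = (i, j)" "i < length ls" "j < ls ! i" using e by (auto simp: B_def)
    then have "Suc (ls ! i - Suc j) = ls ! i - j" by simp
    then show ?thesis using e 3[of i j] 3[of i "Suc j"] by (auto simp: B_def \<psi>_def)
  qed
  show thesis by (rule that[OF 1 adj_isomorphism[OF 1 2 4 ends_verts] 3])
qed

end

text \<open>The test vertex is \<open>Pole_y\<close>. By the progression from \<open>Pole_x\<close>,
  two chips at position \<open>j\<close> spread to positions 0 and \<open>2 * j\<close>; the strict
  bound on \<open>2 * j\<close> keeps the second one away from \<open>Pole_y\<close>.\<close>

lemma not_wpt_B_aux:
  assumes pos: "\<And>i. i < 3 \<Longrightarrow> 0 < ls ! i" and len: "length ls = 3" and i: "i < 3" and j: "2 * j < ls ! i"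
  shows "\<not> wpt (verts (B ls)) (adj (B ls)) 2 (banana_vertex_at ls i j)"
proof -
  interpret loopless_multigraph "B ls" by (rule loopless_B)
  let ?at = "banana_vertex_at ls"
  have pos': "\<And>i. i < length ls \<Longrightarrow> 0 < ls ! i" using pos len by simp
  note at = at_simps[OF pos'] and at_V = at_verts[OF pos']
  define M where "M = sum_list ls"
  have M: "ls ! k \<le> M" if "k < 3" for k using that len unfolding M_def by (intro member_le_sum_list) auto
  have Mpos: "0 < M" using M[of 0] pos[of 0] by simp
  \<comment> \<open>The order starts at \<open>Pole_y\<close> and runs each path backwards, then
    reaches \<open>Pole_x\<close>; the stretch of path \<open>i\<close> up to position
    \<open>2 * j\<close> comes after \<open>Pole_x\<close>, forwards. So \<open>Pole_x\<close> has
    two earlier neighbours along the other paths, three if \<open>j = 0\<close>, and position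
    \<open>2 * j\<close> of path \<open>i\<close>, if inner, has both neighbours earlier.\<close>
  define \<rho> where "\<rho> v = (case v of Pole_x \<Rightarrow> M | Pole_y \<Rightarrow> 0
      | Inner k m \<Rightarrow> if k = i \<and> m \<le> 2 * j then M + m else ls ! k - m)" for v
  have \<rho>_at: "\<rho> (?at k m) = (if m = 0 then M else if m = ls ! k then 0
      else if k = i \<and> m \<le> 2 * j then M + m else ls ! k - m)" for k m
    by (simp add: banana_vertex_at_def \<rho>_def)
  have edge: "(k, m) \<in> edges (B ls)" "ends (B ls) (k, m) = {?at k m, ?at k (Suc m)}"
    if "k < 3" "m < ls ! k" for k m using that len by (auto simp: B_def)
  let ?E = "\<lambda>v. pt Pole_x v + pt (?at i (2 * j)) v - pt Pole_y v"
  have "\<not> eff_equiv (verts (B ls)) (adj (B ls)) ?E"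
  proof (rule not_eff_equiv_edge_order[of _ \<rho>])
    fix v assume "v \<in> verts (B ls)"
    then consider (x) "v = Pole_x" | (y) "v = Pole_y"
      | (inner) k m where "v = Inner k m" "k < 3" "0 < m" "m < ls ! k"
      using len by (auto simp: B_def)
    then show "\<exists>F\<subseteq>edges (B ls). ?E v < int (card F) \<and> (\<forall>e\<in>F. \<exists>u\<in>verts (B ls). ends (B ls) e = {v, u} \<and> \<rho> u < \<rho> v)"
    proof cases
      case x
      define F where "F = (\<lambda>k. (k, 0::nat)) ` {k. k < 3 \<and> (k = i \<longrightarrow> j = 0)}"
      have "{k. k < 3 \<and> (k = i \<longrightarrow> j = 0)} = (if j = 0 then {0, 1, 2} else {0, 1, 2} - {i})" by auto
      moreover have "i = 0 \<or> i = 1 \<or> i = 2" using i by linarith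
      then have "card (if j = 0 then {0, 1, 2} else {0, 1, 2} - {i}) = (if j = 0 then 3 else 2)"
        by (elim disjE) simp_all
      moreover have "card F = card {k. k < 3 \<and> (k = i \<longrightarrow> j = 0)}"
        unfolding F_def by (rule card_image) (simp add: inj_on_def)
      ultimately have "card F = (if j = 0 then 3 else 2)" by (simp only:)
      moreover have "?E v = (if j = 0 then 2 else 1)"
        using x j by (auto simp: pt_def banana_vertex_at_def)
      moreover have "F \<subseteq> edges (B ls)" using edge(1) pos by (auto simp: F_def)
      moreover have "\<exists>u\<in>verts (B ls). ends (B ls) e = {v, u} \<and> \<rho> u < \<rho> v" if e: "e \<in> F" for e
      proof -
        obtain k where k: "e = (k, 0)" "k < 3" "k = i \<longrightarrow> j = 0" using e by (auto simp: F_def)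
        have "\<rho> (?at k 1) < M" using \<rho>_at[of k 1] k pos[of k] M[of k] Mpos by auto
        then show ?thesis
          using k edge(2)[of k 0] at(1) x pos at_V[of k 1] len
          by (intro bexI[of _ "?at k 1"]) (auto simp: \<rho>_def Suc_le_eq)
      qed
      ultimately show ?thesis by (intro exI[of _ F]) auto
    next
      case y
      have "?E v < 0" using y j by (simp add: pt_def banana_vertex_at_def)
      then show ?thesis by (intro exI[of _ "{}"]) auto
    next
      case inner
      have v: "v = ?at k m" using inner at(3) by simp
      have down: "ends (B ls) (k, m - 1) = {v, ?at k (m - 1)}" "(k, m - 1) \<in> edges (B ls)" "?at k (m - 1) \<in> verts (B ls)"
        using edge[of k "m - 1"] inner v at_V[of k "m - 1"] len by auto
      have up: "ends (B ls) (k, m) = {v, ?at k (Suc m)}" "(k, m) \<in> edges (B ls)" "?at k (Suc m) \<in> verts (B ls)"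
        using edge[of k m] inner v at_V[of k "Suc m"] len by auto
      have \<rho>_up: "\<rho> (?at k (Suc m)) < \<rho> v" if "\<not> (k = i \<and> m < 2 * j)"
        unfolding v \<rho>_at using inner that M[of k] by auto
      have \<rho>_down: "\<rho> (?at k (m - 1)) < \<rho> v" if "k = i \<and> m \<le> 2 * j"
        unfolding v \<rho>_at using inner that by auto
      have Ev: "?E v = of_bool (k = i \<and> m = 2 * j)"
        using inner j by (auto simp: pt_def banana_vertex_at_def)
      consider "k = i" "m < 2 * j" | "k = i" "m = 2 * j" | "\<not> (k = i \<and> m \<le> 2 * j)" by linarith
      then show ?thesis
      proof cases
        case 1
        then show ?thesis using down \<rho>_down Ev by (intro exI[of _ "{(k, m - 1)}"]) auto
      next
        case 2
        then have "card {(k, m - 1), (k, m)} = 2" using inner by simp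
        then show ?thesis using 2 down up \<rho>_down \<rho>_up Ev by (intro exI[of _ "{(k, m - 1), (k, m)}"]) auto
      next
        case 3
        then show ?thesis using up \<rho>_up Ev by (intro exI[of _ "{(k, m)}"]) auto
      qed
    qed
  qed (simp add: B_def)
  moreover have "prin (verts (B ls)) (adj (B ls)) (\<lambda>v. ?E v - (2 * pt (?at i j) v - pt Pole_y v))"
    by (rule prin_cong[OF prin_at[OF pos', of i j]]) (use i j len in auto)
  ultimately show ?thesis
    by (intro not_wptI[of Pole_y ?E]) (auto simp: B_def)
qed

text \<open>Odd length excludes a midpoint, so either \<open>x\<close> or its mirror image lies in
  the first half of its path.\<close>

lemma not_wpt_B:
  assumes odd: "odd l\<^sub>1" "odd l\<^sub>2" "odd l\<^sub>3"
  defines "ls \<equiv> [l\<^sub>1, l\<^sub>2, l\<^sub>3]"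
  shows "\<not> wpt (verts (B ls)) (adj (B ls)) (genus (B ls)) x"
proof
  assume w: "wpt (verts (B ls)) (adj (B ls)) (genus (B ls)) x"
  have len: "length ls = 3" by (simp add: ls_def)
  have oddi: "odd (ls ! i)" if "i < 3" for i
    using that odd by (auto simp: ls_def less_Suc_eq numeral_3_eq_3 nth_Cons')
  then have pos: "0 < ls ! i" if "i < 3" for i using that odd_pos by blast
  have pos': "\<And>i. i < length ls \<Longrightarrow> 0 < ls ! i" using pos len by simp
  have g: "genus (B ls) = 2" using genus_B[OF pos'] len by simp
  obtain i j where ij: "i < length ls" "j \<le> ls ! i" "x = banana_vertex_at ls i j"
    using verts_at[OF pos', of x] w by (auto simp: wpt_def ls_def)
  show False
  proof (cases "2 * j < ls ! i")
    case True
    then show False using not_wpt_B_aux[OF pos len _ True] w ij len g by simp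
  next
    case False
    obtain \<phi> where \<phi>: "bij_betw \<phi> (verts (B ls)) (verts (B ls))"
      "\<And>u v. u \<in> verts (B ls) \<Longrightarrow> v \<in> verts (B ls) \<Longrightarrow> adj (B ls) (\<phi> u) (\<phi> v) = adj (B ls) u v"
      "\<And>i j. i < length ls \<Longrightarrow> j \<le> ls ! i \<Longrightarrow> \<phi> (banana_vertex_at ls i j) = banana_vertex_at ls i (ls ! i - j)"
      using reversal[OF pos'] by blast
    have "ls ! i \<noteq> 2 * j" using oddi[of i] ij len by auto
    then have "2 * (ls ! i - j) < ls ! i" using False ij(2) by linarith
    moreover have "wpt (verts (B ls)) (adj (B ls)) 2 (banana_vertex_at ls i (ls ! i - j))"
      using wpt_transport[OF w \<phi>(1,2)] ij \<phi>(3) g by simp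
    ultimately show False using not_wpt_B_aux[OF pos len] ij len by simp
  qed
qed

section \<open>The graphs \<open>Phi l\<close>\<close>

lemma not_wpt_Phi_aux:
  assumes l: "1 \<le> l" and i: "2 * i \<le> l"
  shows "\<not> wpt (verts (Phi l)) (adj (Phi l)) 3 (X i)"
proof -
  interpret loopless_multigraph "Phi l" by (rule loopless_Phi)
  let ?V = "verts (Phi l)" and ?a = "adj (Phi l)"
  have V: "X j \<in> ?V \<longleftrightarrow> j \<le> l" "Y j \<in> ?V \<longleftrightarrow> j \<le> l" for j by (auto simp: Phi_def)
  have stepX: "X_step j \<in> edges (Phi l)" "ends (Phi l) (X_step j) = {X j, X (Suc j)}"
    and stepY: "Y_step j \<in> edges (Phi l)" "ends (Phi l) (Y_step j) = {Y j, Y (Suc j)}" if "j < l" for j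
    using that by (auto simp: Phi_def)
  have rung: "Start c \<in> edges (Phi l)" "ends (Phi l) (Start c) = {X 0, Y 0}"
    "Finish c \<in> edges (Phi l)" "ends (Phi l) (Finish c) = {X l, Y l}" for c
    by (auto simp: Phi_def)
  have rowX: "?a (X j) v = pt (X (j - 1)) v + pt (X (j + 1)) v" if j: "0 < j" "j < l" and "v \<in> ?V" for j v
  proof (rule row_degree_2)
    show "0 < ?a (X j) (X (j - 1))"
      by (rule adj_pos[of "X_step (j - 1)"]) (use j in \<open>auto simp: Phi_def\<close>)
    show "0 < ?a (X j) (X (j + 1))"
      by (rule adj_pos[of "X_step j"]) (use j in \<open>auto simp: Phi_def\<close>)
    have "{e\<in>edges (Phi l). X j \<in> ends (Phi l) e} = {X_step (j - 1), X_step j}"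
      using j by (auto simp: Phi_def)
    then show "degree ?V ?a (X j) = 2" using degree_card[of "X j"] j V by simp
  qed (use j \<open>v \<in> ?V\<close> V in auto)
  have rowY: "?a (Y j) v = pt (Y (j - 1)) v + pt (Y (j + 1)) v" if j: "0 < j" "j < l" and "v \<in> ?V" for j v
  proof (rule row_degree_2)
    show "0 < ?a (Y j) (Y (j - 1))"
      by (rule adj_pos[of "Y_step (j - 1)"]) (use j in \<open>auto simp: Phi_def\<close>)
    show "0 < ?a (Y j) (Y (j + 1))"
      by (rule adj_pos[of "Y_step j"]) (use j in \<open>auto simp: Phi_def\<close>)
    have "{e\<in>edges (Phi l). Y j \<in> ends (Phi l) e} = {Y_step (j - 1), Y_step j}"
      using j by (auto simp: Phi_def)
    then show "degree ?V ?a (Y j) = 2" using degree_card[of "Y j"] j V by simp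
  qed (use j \<open>v \<in> ?V\<close> V in auto)
  have arX: "prin ?V ?a (\<lambda>v. pt (X j) v - pt (X 0) v - int j * (pt (X 1) v - pt (X 0) v))" if "j \<le> l" for j
    by (rule prin_arith[of l X]) (use that rowX V in auto)
  have arY: "prin ?V ?a (\<lambda>v. pt (Y j) v - pt (Y 0) v - int j * (pt (Y 1) v - pt (Y 0) v))" if "j \<le> l" for j
    by (rule prin_arith[of l Y]) (use that rowY V in auto)
  \<comment> \<open>Firing \<open>X 0\<close> and \<open>Y 0\<close> together cancels the parallel
    edges between them, so one chip moves along each side: the progressions on the two sides have
    opposite differences.\<close>
  have "lap ?V ?a (\<lambda>v. pt (X 0) v + pt (Y 0) v) v = pt (X 0) v + pt (Y 0) v - (pt (X 1) v + pt (Y 1) v)"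
    if v: "v \<in> ?V" for v
  proof -
    have "{e\<in>edges (Phi l). X 0 \<in> ends (Phi l) e} = {Start True, Start False, X_step 0}"
      using l by (auto simp: Phi_def)
    then have dX: "degree ?V ?a (X 0) = 3" using degree_card[of "X 0"] V by simp
    have "{e\<in>edges (Phi l). Y 0 \<in> ends (Phi l) e} = {Start True, Start False, Y_step 0}"
      using l by (auto simp: Phi_def)
    then have dY: "degree ?V ?a (Y 0) = 3" using degree_card[of "Y 0"] V by simp
    have "{j. j < l \<and> {X j, X (Suc j)} = {X 0, v}} = (if v = X 1 then {0} else {})"
      "{j. j < l \<and> {Y j, Y (Suc j)} = {X 0, v}} = {}"
      "{j. j < l \<and> {Y j, Y (Suc j)} = {Y 0, v}} = (if v = Y 1 then {0} else {})"
      "{j. j < l \<and> {X j, X (Suc j)} = {Y 0, v}} = {}"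
      using l by (auto simp: doubleton_eq_iff)
    then have "?a (X 0) v = 2 * pt (Y 0) v + pt (X 1) v" "?a (Y 0) v = 2 * pt (X 0) v + pt (Y 1) v"
      unfolding adj_Phi using l by (auto simp: pt_def doubleton_eq_iff)
    then show ?thesis using v V by (simp add: lap_add lap_pt dX dY)
  qed
  then have rungs: "prin ?V ?a (\<lambda>v. pt (X 0) v + pt (Y 0) v - (pt (X 1) v + pt (Y 1) v))"
    unfolding prin_def by metis
  \<comment> \<open>A representative of \<open>3 (X i) - (Y l)\<close>: two of the three chips at
    \<open>X i\<close> spread to both ends of the \<open>X\<close> side, and to compensate the debt
    moves from \<open>Y l\<close> to \<open>Y (2 * i)\<close>.\<close>
  let ?E = "\<lambda>v. pt (X 0) v + pt (X l) v + pt (X i) v - pt (Y (2 * i)) v"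
  define M where "M = l + 1"
  \<comment> \<open>The \<open>Y\<close> side comes first, by distance from the debt
    \<open>Y (2 * i)\<close>, written with truncated subtractions. The \<open>X\<close> side follows
    from both ends inwards, with \<open>X i\<close> last. Each end of the \<open>X\<close> side then
    has two earlier edges from the \<open>Y\<close> side, and an inner \<open>X i\<close> has both
    its edges.\<close>
  define \<rho> where "\<rho> v = (case v of Y m \<Rightarrow> (m - 2 * i) + (2 * i - m)
      | X m \<Rightarrow> if m = i then 2 * M else if m < i then M + m else M + (l - m))" for v
  have \<rho>: "\<rho> (Y m) = (m - 2 * i) + (2 * i - m)"
    "\<rho> (X m) = (if m = i then 2 * M else if m < i then M + m else M + (l - m))" for m
    by (simp_all add: \<rho>_def)
  have "\<not> eff_equiv ?V ?a ?E"
  proof (rule not_eff_equiv_edge_order[of _ \<rho>])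
    fix v assume v: "v \<in> ?V"
    define ok where "ok e \<longleftrightarrow> e \<in> edges (Phi l) \<and> (\<exists>u\<in>?V. ends (Phi l) e = {v, u} \<and> \<rho> u < \<rho> v)" for e
    have "\<exists>F. ?E v < int (card F) \<and> (\<forall>e\<in>F. ok e)"
    proof (cases v)
      case (Y m)
      then have m: "m \<le> l" using v V by simp
      have "m < 2 * i \<Longrightarrow> ok (Y_step m)"
        unfolding ok_def using stepY[of m] Y V i by (intro conjI bexI[of _ "Y (Suc m)"]) (auto simp: \<rho>)
      moreover have "2 * i < m \<Longrightarrow> ok (Y_step (m - 1))"
        unfolding ok_def using stepY[of "m - 1"] Y V m
        by (intro conjI bexI[of _ "Y (m - 1)"]) (auto simp: \<rho>)
      moreover have "?E v = - of_bool (m = 2 * i)" using Y by (simp add: pt_def)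
      ultimately show ?thesis
        by (cases m "2 * i" rule: linorder_cases)
          (force intro: exI[of _ "{Y_step m}"] exI[of _ "{Y_step (m - 1)}"] exI[of _ "{}"])+
    next
      case (X m)
      then have m: "m \<le> l" using v V by simp
      have up: "ok (X_step m)" if "i \<le> m" "m < l"
        unfolding ok_def using stepX[of m] X V that i
        by (intro conjI bexI[of _ "X (Suc m)"]) (auto simp: \<rho> M_def)
      have down: "ok (X_step (m - 1))" if "0 < m" "m \<le> i"
        unfolding ok_def using stepX[of "m - 1"] X V that i m
        by (intro conjI bexI[of _ "X (m - 1)"]) (auto simp: \<rho> M_def)
      have start: "ok (Start c)" if "m = 0" for c
        unfolding ok_def using rung[of c] X V that i
        by (intro conjI bexI[of _ "Y 0"]) (auto simp: \<rho> M_def)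
      have finish: "ok (Finish c)" if "m = l" for c
        unfolding ok_def using rung[of c] X V that i
        by (intro conjI bexI[of _ "Y l"]) (auto simp: \<rho> M_def)
      have E: "?E v = of_bool (m = 0) + of_bool (m = l) + of_bool (m = i)"
        using X by (simp add: pt_def)
      consider "m = 0" "i = 0" | "m = 0" "0 < i" | "m = l" | "0 < m" "m = i" "m < l"
        | "0 < m" "m < i" | "i < m" "m < l" using m i by linarith
      then show ?thesis
      proof cases
        case 1
        then show ?thesis using start up E l
          by (intro exI[of _ "{Start True, Start False, X_step m}"]) auto
      next
        case 2
        then show ?thesis using start E l by (intro exI[of _ "{Start True, Start False}"]) auto
      next
        case 3
        then show ?thesis using finish E l i by (intro exI[of _ "{Finish True, Finish False}"]) auto
      next
        case 4
        then have "card {X_step m, X_step (m - 1)} = 2" by simp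
        then show ?thesis using up down E 4 by (intro exI[of _ "{X_step m, X_step (m - 1)}"]) auto
      next
        case 5
        then show ?thesis using down E i by (intro exI[of _ "{X_step (m - 1)}"]) auto
      next
        case 6
        then show ?thesis using up E by (intro exI[of _ "{X_step m}"]) auto
      qed
    qed
    then show "\<exists>F\<subseteq>edges (Phi l). ?E v < int (card F) \<and> (\<forall>e\<in>F. \<exists>u\<in>?V. ends (Phi l) e = {v, u} \<and> \<rho> u < \<rho> v)"
      unfolding ok_def by blast
  qed (use V in blast)
  moreover have "prin ?V ?a (\<lambda>v. ?E v - (3 * pt (X i) v - pt (Y l) v))"
  proof -
    have le: "l \<le> l" "i \<le> l" using i by auto
    \<comment> \<open>Each point is expressed by its progression; what remains is
      \<open>l - 2 * i\<close> times the sum of the two differences, removed by the last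
      summand.\<close>
    have "prin ?V ?a (\<lambda>v. (pt (X l) v - pt (X 0) v - int l * (pt (X 1) v - pt (X 0) v))
        + (pt (Y l) v - pt (Y 0) v - int l * (pt (Y 1) v - pt (Y 0) v))
        + (- 2) * (pt (X i) v - pt (X 0) v - int i * (pt (X 1) v - pt (X 0) v))
        + (- 1) * (pt (Y (2 * i)) v - pt (Y 0) v - int (2 * i) * (pt (Y 1) v - pt (Y 0) v))
        + (int (2 * i) - int l) * (pt (X 0) v + pt (Y 0) v - (pt (X 1) v + pt (Y 1) v)))"
      by (intro prin_add prin_cmul arX arY rungs le i)
    then show ?thesis by (rule prin_cong) (simp add: algebra_simps)
  qed
  ultimately show ?thesis by (intro not_wptI[of "Y l" ?E]) (auto simp: V)
qed

text \<open>Exchanging the two sides and reversing both of them reduces every vertex to some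
  \<open>X i\<close> with \<open>2 * i \<le> l\<close>.\<close>

lemma not_wpt_Phi:
  assumes l: "1 \<le> l"
  shows "\<not> wpt (verts (Phi l)) (adj (Phi l)) (genus (Phi l)) x"
proof
  interpret loopless_multigraph "Phi l" by (rule loopless_Phi)
  let ?V = "verts (Phi l)" and ?a = "adj (Phi l)"
  assume w: "wpt ?V ?a (genus (Phi l)) x"
  have g: "genus (Phi l) = 3"
  proof -
    have "card (X ` {..l} \<union> Y ` {..l}) = (l + 1) + (l + 1)"
      by (subst card_Un_disjoint) (auto simp: card_image inj_on_def)
    moreover have "card (X_step ` {..<l} \<union> Y_step ` {..<l} \<union> range Start \<union> range Finish) = ((l + l) + 2) + 2"
      by (subst card_Un_disjoint; (auto; fail)?)+ (simp add: card_image inj_on_def)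
    ultimately show ?thesis by (simp add: genus_def Phi_def)
  qed
  define swap where "swap b = (case b of X j \<Rightarrow> Y j | Y j \<Rightarrow> X j)" for b
  define swap_e where "swap_e e = (case e of X_step j \<Rightarrow> Y_step j | Y_step j \<Rightarrow> X_step j | Start c \<Rightarrow> Start c | Finish c \<Rightarrow> Finish c)" for e
  have s1: "bij_betw swap ?V ?V"
    by (rule bij_betw_byWitness[of _ swap]) (auto simp: Phi_def swap_def)
  have s2: "bij_betw swap_e (edges (Phi l)) (edges (Phi l))"
    by (rule bij_betw_byWitness[of _ swap_e]) (auto simp: Phi_def swap_e_def)
  have s3: "ends (Phi l) (swap_e e) = swap ` ends (Phi l) e" for e
    by (cases e) (auto simp: Phi_def swap_def swap_e_def)
  have s4: "?a (swap u) (swap v) = ?a u v" if "u \<in> ?V" "v \<in> ?V" for u v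
    by (rule adj_isomorphism[OF s1 s2 s3 ends_verts that])
  define rv where "rv b = (case b of X j \<Rightarrow> X (l - j) | Y j \<Rightarrow> Y (l - j))" for b
  define rv_e where "rv_e e = (case e of X_step j \<Rightarrow> X_step (l - Suc j) | Y_step j \<Rightarrow> Y_step (l - Suc j)
      | Start c \<Rightarrow> Finish c | Finish c \<Rightarrow> Start c)" for e
  have r1: "bij_betw rv ?V ?V"
    by (rule bij_betw_byWitness[of _ rv]) (auto simp: Phi_def rv_def)
  have r2: "bij_betw rv_e (edges (Phi l)) (edges (Phi l))"
    by (rule bij_betw_byWitness[of _ rv_e]) (auto simp: Phi_def rv_e_def)
  have r3: "ends (Phi l) (rv_e e) = rv ` ends (Phi l) e" if "e \<in> edges (Phi l)" for e
  proof (cases e)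
    case (X_step j)
    then have "Suc (l - Suc j) = l - j" using that by (auto simp: Phi_def)
    then show ?thesis using X_step by (auto simp: Phi_def rv_def rv_e_def)
  next
    case (Y_step j)
    then have "Suc (l - Suc j) = l - j" using that by (auto simp: Phi_def)
    then show ?thesis using Y_step by (auto simp: Phi_def rv_def rv_e_def)
  qed (auto simp: Phi_def rv_def rv_e_def)
  have r4: "?a (rv u) (rv v) = ?a u v" if "u \<in> ?V" "v \<in> ?V" for u v
    by (rule adj_isomorphism[OF r1 r2 r3 ends_verts that])
  have no_X: "\<not> wpt ?V ?a 3 (X j)" if j: "j \<le> l" for j
  proof (cases "2 * j \<le> l")
    case True
    then show ?thesis by (rule not_wpt_Phi_aux[OF l])
  next
    case False
    then have "\<not> wpt ?V ?a 3 (X (l - j))" by (intro not_wpt_Phi_aux[OF l]) simp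
    moreover have "rv (X j) = X (l - j)" by (simp add: rv_def)
    ultimately show ?thesis
      using wpt_transport[where \<phi> = rv and V = ?V and W = ?V and a = ?a and b = ?a, OF _ r1 r4] by metis
  qed
  have no_Y: "\<not> wpt ?V ?a 3 (Y j)" if j: "j \<le> l" for j
  proof -
    have "swap (Y j) = X j" by (simp add: swap_def)
    then show ?thesis
      using no_X[OF j] wpt_transport[where \<phi> = swap and V = ?V and W = ?V and a = ?a and b = ?a, OF _ s1 s4] by metis
  qed
  have "x \<in> X ` {..l} \<union> Y ` {..l}" using w by (simp add: wpt_def Phi_def)
  then show False using w no_X no_Y unfolding g by blast
qed

section \<open>Transfer along isomorphisms and the classification\<close>

lemma not_weierstrass_isomorphic:
  assumes "is_graph G" and iso: "isomorphic G H"
    and H: "\<And>y. \<not> wpt (verts H) (adj H) (genus H) y"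
  shows "\<not> weierstrass_point G x"
proof
  interpret loopless_multigraph G using assms(1) by (rule is_graph_loopless)
  assume "weierstrass_point G x"
  then have w: "wpt (verts G) (adj G) (genus G) x" by (simp add: weierstrass_point_iff)
  obtain \<phi> where \<phi>: "bij_betw \<phi> (verts G) (verts H)"
    "\<And>u v. u \<in> verts G \<Longrightarrow> v \<in> verts G \<Longrightarrow> adj H (\<phi> u) (\<phi> v) = adj G u v" "genus H = genus G"
    using isomorphicD[OF iso ends_verts] by blast
  from wpt_transport[OF w \<phi>(1,2)] show False using H \<phi>(3) by metis
qed

theorem theorem5p26:
  fixes G :: "('v, 'e) multigraph"
  assumes "is_graph G"
    and "two_edge_connected G"
    and "hyperelliptic G"
    and "genus G \<ge> 2"
  shows "(\<nexists>x. weierstrass_point G x) \<longleftrightarrow>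
           (\<exists>n\<ge>3. isomorphic G (banana n))
         \<or> (\<exists>l\<^sub>1 l\<^sub>2 l\<^sub>3. odd l\<^sub>1 \<and> odd l\<^sub>2 \<and> odd l\<^sub>3 \<and> isomorphic G (B [l\<^sub>1, l\<^sub>2, l\<^sub>3]))
         \<or> (\<exists>l\<ge>1. isomorphic G (Phi l))"
    (is "?none \<longleftrightarrow> ?list")
proof
  interpret loopless_multigraph G using assms(1) by (rule is_graph_loopless)
  let ?V = "verts G" and ?a = "adj G"
  assume ?none
  then have no: "\<not> wpt ?V ?a (genus G) x" for x using weierstrass_point_iff by blast
  obtain \<iota> where "hyperelliptic_graph ?V ?a \<iota>"
    using assms(1-3) by (rule hyperelliptic_involution)
  then interpret hyperelliptic_graph ?V ?a \<iota> .
  \<comment> \<open>For a fixed vertex the pair \<open>(x) + (\<iota> x)\<close> is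
    \<open>2 (x)\<close>, already contained in \<open>g (x)\<close> as
    \<open>g \<ge> 2\<close>.\<close>
  have "\<iota> x \<noteq> x" if x: "x \<in> ?V" for x
  proof
    assume fix_x: "\<iota> x = x"
    have "wpt ?V ?a (genus G) x"
    proof (rule wpt_if_pair[OF x x, of "\<lambda>v. genus G * pt x v"])
      show "prin ?V ?a (\<lambda>v. genus G * pt x v - genus G * pt x v)" using prin_zero by simp
    qed (use fix_x assms(4) in \<open>auto simp: pt_def\<close>)
    then show False using no by blast
  qed
  then interpret no_weierstrass G \<iota>
    by unfold_locales (use assms(4) no in auto)
  show ?list by (rule classification)
next
  assume ?list
  then show ?none
  proof (elim disjE exE conjE)
    fix n assume "isomorphic G (banana n)"
    then show ?none using not_weierstrass_isomorphic[OF assms(1) _ not_wpt_banana] by blast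
  next
    fix l\<^sub>1 l\<^sub>2 l\<^sub>3 assume "odd l\<^sub>1" "odd l\<^sub>2" "odd l\<^sub>3" "isomorphic G (B [l\<^sub>1, l\<^sub>2, l\<^sub>3])"
    then show ?none using not_weierstrass_isomorphic[OF assms(1) _ not_wpt_B] by blast
  next
    fix l :: nat assume "1 \<le> l" "isomorphic G (Phi l)"
    then show ?none using not_weierstrass_isomorphic[OF assms(1) _ not_wpt_Phi] by blast
  qed
qed

end
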